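(* Let $\mathcal{C}$ be a small category satisfying the following conditions: (C1) the canonical functor $\mathcal{C}^{\mathrm{op}}\to\mathrm{Sh}(\mathcal{C}^{\mathrm{op}},J_{\mathrm{at}})$ is fully faithful and sends each object of $\mathcal{C}^{\mathrm{op}}$ to an atom; (C2) $\mathcal{C}^{\mathrm{op}}$ has pushouts and $\mathcal{C}^{\mathrm{op}}\to\mathrm{Sh}(\mathcal{C}^{\mathrm{op}},J_{\mathrm{at}})$ preserves them; (C3) $\mathcal{C}$ is well-founded; (C4) the automorphism groups of the objects of $\mathcal{C}$ are Noetherian. Then the topos $\mathrm{Sh}(\mathcal{C}^{\mathrm{op}},J_{\mathrm{at}})$ is locally finitely presentable.
   Context: The atomic topology $J_{\mathrm{at}}$ on $\mathcal{C}^{\mathrm{op}}$ is the Grothendieck topology generated by declaring all non-empty sieves covering; when every span in $\mathcal{C}$ admits a cocone (which is implied by (C1)), the covering sieves are exactly the non-empty sieves. Sheaves on $\mathcal{C}^{\mathrm{op}}$ are functors $\mathcal{C}\to\mathrm{Set}$. The canonical functor $\mathcal{C}^{\mathrm{op}}\to \mathrm{Sh}(\mathcal{C}^{\mathrm{op}},J_{\mathrm{at}})$ is the Yoneda embedding $n\mapsto\mathrm{Hom}_{\mathcal{C}}(n,-)$ followed by sheafification. An atom of a topos is a non-initial object whose only sub-objects are the initial object and itself. A category is co-well-founded if every diagram $x_0\to x_1\to x_2\to\cdots$ in it stabilizes, i.e. there is $i$ such that $x_i\to x_j$ is an isomorphism for all $j>i$. A category $\mathcal{C}$ is well-founded if $\mathcal{C}^{\mathrm{op}}$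 is co-well-founded. A group is Noetherian if every ascending chain of subgroups stabilizes. *)

theory Defs
  imports "HOL-Library.FuncSet" "HOL-Algebra.Group"
begin

unbundle cardinal_syntax

section \<open>Smallness\<close>

text \<open>
  The type \<open>'u\<close> plays the role of the universe of sets: up to bijection, the small sets are the
  sets of cardinality less than that of \<open>'u\<close>. If \<open>'u\<close> has strongly inaccessible cardinality \<open>\<kappa>\<close>,
  then the small subsets of \<open>'u\<close> and the maps between them form a category equivalent to the
  category of sets of the Grothendieck universe \<open>V\<^sub>\<kappa>\<close>.
\<close>

definition small :: "'u itself \<Rightarrow> 'x set \<Rightarrow> bool" where
  "small U A \<longleftrightarrow> |A| <o |UNIV :: 'u set|"

text \<open>
  What the theory of sheaves on a small site with arrow set \<open>I\<close> needs of a universe: its cardinality is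
  uncountable and regular, and small sets are closed under powers with exponent \<open>I\<close>.
  Strongly inaccessible cardinalities satisfy this for every small \<open>I\<close> (\<open>inaccessible_universe_for\<close>),
  which covers Grothendieck universes. Inaccessibility itself is not required, because HOL cannot
  construct types of such cardinality, whereas it has types with the property below for every \<open>I\<close>
  (\<open>suc_universe_for\<close>).
\<close>

definition universe_for :: "'u itself \<Rightarrow> 'i set \<Rightarrow> bool" where
  "universe_for U I \<longleftrightarrow>
     natLeq <o |UNIV :: 'u set| \<and>
     regularCard |UNIV :: 'u set| \<and>
     (\<forall>A :: 'u set. small U A \<longrightarrow> small U (I \<rightarrow>\<^sub>E A))"

lemma inaccessible_universe_for:
  fixes I :: "'i set"
  assumes "natLeq <o |UNIV :: 'u set|" "regularCard |UNIV :: 'u set|"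
    and pow: "\<And>A :: 'u set. small TYPE('u) A \<Longrightarrow> small TYPE('u) (Pow A)"
    and "small TYPE('u) I"
  shows "universe_for TYPE('u) I"
  unfolding universe_for_def
proof (intro conjI allI impI assms)
  fix A :: "'u set" assume A: "small TYPE('u) A"
  have inf: "infinite (UNIV :: 'u set)"
    using assms(1) by (metis infinite_iff_natLeq_ordLeq ordLess_imp_ordLeq)
  have "small TYPE('u) (I \<times> A)"
    using stable_elim[OF regularCard_stable[OF card_of_Card_order _ assms(2)], of I "\<lambda>_. A"] inf A assms(4)
    by (simp add: small_def Field_card_of)
  then obtain B :: "'u set" and f where f: "bij_betw f (I \<times> A) B"
    unfolding small_def by (meson card_of_ordLeq ordLess_imp_ordLeq inj_on_imp_bij_betw)
  then have "|B| =o |I \<times> A|" by (meson card_of_ordIso ordIso_symmetric)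
  with \<open>small TYPE('u) (I \<times> A)\<close> have "small TYPE('u) B" unfolding small_def by (metis ordIso_ordLess_trans)
  then have P: "small TYPE('u) (Pow B)" by (rule pow)
  have "inj_on (\<lambda>h. f ` {(i, h i) |i. i \<in> I}) (I \<rightarrow>\<^sub>E A)"
  proof (rule inj_onI)
    fix h k assume hk: "h \<in> I \<rightarrow>\<^sub>E A" "k \<in> I \<rightarrow>\<^sub>E A" "f ` {(i, h i) |i. i \<in> I} = f ` {(i, k i) |i. i \<in> I}"
    have "{(i, h i) |i. i \<in> I} = {(i, k i) |i. i \<in> I}"
      by (rule inj_on_image_eq_iff[THEN iffD1, OF bij_betw_imp_inj_on[OF f] _ _ hk(3)]) (use hk in auto)
    then have "h i = k i" if "i \<in> I" for i using that by blast
    then show "h = k" using hk by (auto intro: PiE_ext)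
  qed
  moreover have "(\<lambda>h. f ` {(i, h i) |i. i \<in> I}) ` (I \<rightarrow>\<^sub>E A) \<subseteq> Pow B"
    using bij_betw_imp_surj_on[OF f] by auto
  ultimately have "|I \<rightarrow>\<^sub>E A| \<le>o |Pow B|"
    using card_of_ordLeq[of "I \<rightarrow>\<^sub>E A" "Pow B"] by blast
  then show "small TYPE('u) (I \<rightarrow>\<^sub>E A)" using P unfolding small_def by (metis ordLeq_ordLess_trans)
qed

lemma suc_universe_for:
  fixes I :: "'i set"
  assumes inf: "infinite (UNIV :: 'a set)" and I: "|I| \<le>o |UNIV :: 'a set|"
  shows "universe_for TYPE('a set suc) I"
proof -
  let ?r = "|UNIV :: 'a set set|"
  have co: "card_order ?r" by (rule card_of_card_order_on)
  have isu: "card_suc ?r =o |UNIV :: 'a set suc set|"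
    by (metis Card_order_card_suc Field_card_suc card_of_Field_ordIso co ordIso_symmetric)
  have gr: "?r <o |UNIV :: 'a set suc set|" using card_suc_greater[OF co] isu by (metis ordLess_ordIso_trans)
  have leq: "|X| \<le>o ?r \<longleftrightarrow> |X| <o |UNIV :: 'a set suc set|" for X :: "'x set"
  proof
    assume "|X| <o |UNIV :: 'a set suc set|"
    then have "|X| <o cardSuc ?r" by (metis isu cardSuc_ordIso_card_suc co ordIso_symmetric ordLess_ordIso_trans)
    then show "|X| \<le>o ?r" using cardSuc_ordLeq_ordLess[OF card_of_Card_order card_of_Card_order] by blast
  qed (use gr ordLeq_ordLess_trans in blast)
  have "natLeq \<le>o |UNIV :: 'a set|" using inf infinite_iff_natLeq_ordLeq by blast
  moreover have aP: "|UNIV :: 'a set| <o ?r" using card_of_Pow[of "UNIV :: 'a set"] unfolding Pow_UNIV .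
  ultimately have nat: "natLeq <o |UNIV :: 'a set suc set|" using gr using ordLeq_ordLess_trans ordLess_transitive by blast
  have infr: "infinite (UNIV :: 'a set set)" using inf by (simp add: Finite_Set.finite_set)
  have "regularCard (card_suc ?r)" by (rule regularCard_card_suc) (use infr co in \<open>auto simp: cinfinite_def Field_card_of card_of_Card_order\<close>)
  then have reg: "regularCard |UNIV :: 'a set suc set|"
    using regularCard_ordIso[OF isu Cinfinite_card_suc] infr co by (simp add: cinfinite_def Field_card_of card_of_Card_order)
  have pw: "small TYPE('a set suc) (I \<rightarrow>\<^sub>E A)" if A: "small TYPE('a set suc) A" for A :: "'a set suc set"
  proof -
    from A have "|A| \<le>o ?r" unfolding small_def leq[symmetric] .
    then obtain f :: "'a set suc \<Rightarrow> 'a set" where f: "inj_on f A" by (metis card_of_ordLeq)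
    obtain g :: "'i \<Rightarrow> 'a" where g: "inj_on g I" using I by (metis card_of_ordLeq)
    have "|UNIV \<times> UNIV :: ('a \<times> 'a) set| \<le>o |UNIV :: 'a set|" 
      by (metis card_of_Times_same_infinite inf ordIso_iff_ordLeq)
    then obtain p :: "'a \<times> 'a \<Rightarrow> 'a" where p: "inj p" by (metis card_of_ordLeq UNIV_Times_UNIV)
    let ?F = "\<lambda>h. {p (g i, a) |i a. i \<in> I \<and> a \<in> f (h i)}"
    have "inj_on ?F (I \<rightarrow>\<^sub>E A)"
    proof (rule inj_onI)
      fix h k assume hk: "h \<in> I \<rightarrow>\<^sub>E A" "k \<in> I \<rightarrow>\<^sub>E A" "?F h = ?F k"
      have m: "p (g i, a) \<in> ?F h \<longleftrightarrow> a \<in> f (h i)" if "i \<in> I" for i a h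
        using that injD[OF p] inj_onD[OF g] by blast
      have "f (h i) = f (k i)" if "i \<in> I" for i using m[OF that] hk(3) by blast
      then have "h i = k i" if "i \<in> I" for i using that hk f by (meson PiE_mem inj_onD)
      then show "h = k" using hk by (auto intro: PiE_ext)
    qed
    then have "|I \<rightarrow>\<^sub>E A| \<le>o ?r" using card_of_ordLeq[of "I \<rightarrow>\<^sub>E A" "UNIV :: 'a set set"] by blast
    then show ?thesis unfolding small_def leq .
  qed
  show ?thesis unfolding universe_for_def using nat reg pw by auto
qed


section \<open>Categories\<close>

text \<open>\<open>Comp C g f\<close> is the composite \<open>g \<circ> f\<close>, meaningful when \<open>Cod C f = Dom C g\<close>.\<close>

record ('o, 'a) category =
  Obj :: "'o set"
  Arr :: "'a set"
  Dom :: "'a \<Rightarrow> 'o"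
  Cod :: "'a \<Rightarrow> 'o"
  Ide :: "'o \<Rightarrow> 'a"
  Comp :: "'a \<Rightarrow> 'a \<Rightarrow> 'a"

definition Hom :: "('o, 'a) category \<Rightarrow> 'o \<Rightarrow> 'o \<Rightarrow> 'a set" where
  "Hom C x y = {f \<in> Arr C. Dom C f = x \<and> Cod C f = y}"

locale category =
  fixes C :: "('o, 'a) category"
  assumes Dom_closed: "f \<in> Arr C \<Longrightarrow> Dom C f \<in> Obj C"
    and Cod_closed: "f \<in> Arr C \<Longrightarrow> Cod C f \<in> Obj C"
    and Ide_closed: "x \<in> Obj C \<Longrightarrow> Ide C x \<in> Hom C x x"
    and Comp_closed: "\<lbrakk>f \<in> Hom C x y; g \<in> Hom C y z\<rbrakk> \<Longrightarrow> Comp C g f \<in> Hom C x z"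
    and Comp_Ide: "f \<in> Hom C x y \<Longrightarrow> Comp C f (Ide C x) = f"
    and Ide_Comp: "f \<in> Hom C x y \<Longrightarrow> Comp C (Ide C y) f = f"
    and Comp_assoc: "\<lbrakk>f \<in> Hom C w x; g \<in> Hom C x y; h \<in> Hom C y z\<rbrakk>
      \<Longrightarrow> Comp C h (Comp C g f) = Comp C (Comp C h g) f"

text \<open>There are at most as many objects as arrows, because of the identities.\<close>

definition small_category :: "'u itself \<Rightarrow> ('o, 'a) category \<Rightarrow> bool" where
  "small_category U C \<longleftrightarrow> category C \<and> small U (Arr C)"

definition opposite :: "('o, 'a) category \<Rightarrow> ('o, 'a) category" where
  "opposite C = \<lparr>Obj = Obj C, Arr = Arr C, Dom = Cod C, Cod = Dom C, Ide = Ide C,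
                 Comp = (\<lambda>g f. Comp C f g)\<rparr>"

definition full_subcategory :: "('o, 'a) category \<Rightarrow> ('o \<Rightarrow> bool) \<Rightarrow> ('o, 'a) category" where
  "full_subcategory C P = C\<lparr>Obj := {x \<in> Obj C. P x},
                            Arr := {f \<in> Arr C. P (Dom C f) \<and> P (Cod C f)}\<rparr>"

definition is_iso :: "('o, 'a) category \<Rightarrow> 'a \<Rightarrow> bool" where
  "is_iso C f \<longleftrightarrow> f \<in> Arr C \<and>
     (\<exists>g \<in> Hom C (Cod C f) (Dom C f).
        Comp C g f = Ide C (Dom C f) \<and> Comp C f g = Ide C (Cod C f))"

definition is_mono :: "('o, 'a) category \<Rightarrow> 'a \<Rightarrow> bool" where
  "is_mono C m \<longleftrightarrow> m \<in> Arr C \<and>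
     (\<forall>x \<in> Obj C. \<forall>f \<in> Hom C x (Dom C m). \<forall>g \<in> Hom C x (Dom C m).
        Comp C m f = Comp C m g \<longrightarrow> f = g)"

definition is_initial :: "('o, 'a) category \<Rightarrow> 'o \<Rightarrow> bool" where
  "is_initial C x \<longleftrightarrow> x \<in> Obj C \<and> (\<forall>y \<in> Obj C. \<exists>!f. f \<in> Hom C x y)"

definition is_atom :: "('o, 'a) category \<Rightarrow> 'o \<Rightarrow> bool" where
  "is_atom C x \<longleftrightarrow> x \<in> Obj C \<and> \<not> is_initial C x \<and>
     (\<forall>m. is_mono C m \<and> Cod C m = x \<longrightarrow> is_initial C (Dom C m) \<or> is_iso C m)"

definition Aut :: "('o, 'a) category \<Rightarrow> 'o \<Rightarrow> 'a monoid" where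
  "Aut C x = \<lparr>carrier = {f \<in> Hom C x x. is_iso C f}, mult = Comp C, one = Ide C x\<rparr>"

definition noetherian_group :: "('a, 'b) monoid_scheme \<Rightarrow> bool" where
  "noetherian_group G \<longleftrightarrow> group G \<and>
     (\<forall>H :: nat \<Rightarrow> 'a set. (\<forall>i. subgroup (H i) G \<and> H i \<subseteq> H (Suc i)) \<longrightarrow>
        (\<exists>i. \<forall>j \<ge> i. H j = H i))"

text \<open>For \<open>x 0 \<rightarrow> x 1 \<rightarrow> \<dots>\<close> with \<open>f i : x i \<rightarrow> x (i + 1)\<close>: the composite \<open>x i \<rightarrow> x (i + n)\<close>.\<close>

primrec chain_comp ::
  "('o, 'a) category \<Rightarrow> (nat \<Rightarrow> 'o) \<Rightarrow> (nat \<Rightarrow> 'a) \<Rightarrow> nat \<Rightarrow> nat \<Rightarrow> 'a" where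
  "chain_comp C x f i 0 = Ide C (x i)"
| "chain_comp C x f i (Suc n) = Comp C (f (i + n)) (chain_comp C x f i n)"

definition co_well_founded :: "('o, 'a) category \<Rightarrow> bool" where
  "co_well_founded C \<longleftrightarrow>
     (\<forall>x f. (\<forall>i. x i \<in> Obj C \<and> f i \<in> Hom C (x i) (x (Suc i))) \<longrightarrow>
        (\<exists>i. \<forall>j > i. is_iso C (chain_comp C x f i (j - i))))"

definition well_founded :: "('o, 'a) category \<Rightarrow> bool" where
  "well_founded C \<longleftrightarrow> co_well_founded (opposite C)"


section \<open>Functors\<close>

text \<open>
  Functors and natural transformations are extensional (equal to \<^const>\<open>undefined\<close> outside their
  domain), so that equality in HOL is equality in the functor category.
\<close>

record ('o, 'a, 'p, 'b) functor_data =
  FObj :: "'o \<Rightarrow> 'p"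
  FArr :: "'a \<Rightarrow> 'b"

locale cat_functor = dom: category C + cod: category D
  for C :: "('o, 'a) category" and D :: "('p, 'b) category" +
  fixes F :: "('o, 'a, 'p, 'b) functor_data"
  assumes FObj_closed: "FObj F \<in> Obj C \<rightarrow>\<^sub>E Obj D"
    and FArr_ext: "FArr F \<in> extensional (Arr C)"
    and FArr_closed: "f \<in> Hom C x y \<Longrightarrow> FArr F f \<in> Hom D (FObj F x) (FObj F y)"
    and FArr_Ide: "x \<in> Obj C \<Longrightarrow> FArr F (Ide C x) = Ide D (FObj F x)"
    and FArr_Comp: "\<lbrakk>f \<in> Hom C x y; g \<in> Hom C y z\<rbrakk>
      \<Longrightarrow> FArr F (Comp C g f) = Comp D (FArr F g) (FArr F f)"

text \<open>\<open>functor_comp C G F\<close> is \<open>G \<circ> F\<close>, where \<open>C\<close> is the domain of \<open>F\<close>.\<close>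

definition functor_comp ::
  "('o, 'a) category \<Rightarrow> ('p, 'b, 'q, 'c) functor_data \<Rightarrow> ('o, 'a, 'p, 'b) functor_data
    \<Rightarrow> ('o, 'a, 'q, 'c) functor_data" where
  "functor_comp C G F = \<lparr>FObj = (\<lambda>x \<in> Obj C. FObj G (FObj F x)),
                         FArr = (\<lambda>f \<in> Arr C. FArr G (FArr F f))\<rparr>"

definition fully_faithful ::
  "('o, 'a) category \<Rightarrow> ('p, 'b) category \<Rightarrow> ('o, 'a, 'p, 'b) functor_data \<Rightarrow> bool" where
  "fully_faithful C D F \<longleftrightarrow> cat_functor C D F \<and>
     (\<forall>x \<in> Obj C. \<forall>y \<in> Obj C. bij_betw (FArr F) (Hom C x y) (Hom D (FObj F x) (FObj F y)))"

text \<open>A natural transformation is a triple (source, components, target).\<close>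

definition functor_category ::
  "('o, 'a) category \<Rightarrow> ('p, 'b) category
    \<Rightarrow> (('o, 'a, 'p, 'b) functor_data,
         ('o, 'a, 'p, 'b) functor_data \<times> ('o \<Rightarrow> 'b) \<times> ('o, 'a, 'p, 'b) functor_data) category" where
  "functor_category C D =
     \<lparr>Obj = {F. cat_functor C D F},
      Arr = {(F, \<eta>, G). cat_functor C D F \<and> cat_functor C D G \<and>
               \<eta> \<in> extensional (Obj C) \<and>
               (\<forall>x \<in> Obj C. \<eta> x \<in> Hom D (FObj F x) (FObj G x)) \<and>
               (\<forall>f \<in> Arr C. Comp D (FArr G f) (\<eta> (Dom C f)) = Comp D (\<eta> (Cod C f)) (FArr F f))},
      Dom = (\<lambda>(F, \<eta>, G). F),
      Cod = (\<lambda>(F, \<eta>, G). G),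
      Ide = (\<lambda>F. (F, \<lambda>x \<in> Obj C. Ide D (FObj F x), F)),
      Comp = (\<lambda>(G, \<theta>, H) (F, \<eta>, G'). (F, \<lambda>x \<in> Obj C. Comp D (\<theta> x) (\<eta> x), H))\<rparr>"


section \<open>Colimits\<close>

definition cocone ::
  "('i, 'j) category \<Rightarrow> ('o, 'a) category \<Rightarrow> ('i, 'j, 'o, 'a) functor_data
    \<Rightarrow> 'o \<Rightarrow> ('i \<Rightarrow> 'a) \<Rightarrow> bool" where
  "cocone J K D c \<iota> \<longleftrightarrow> c \<in> Obj K \<and>
     (\<forall>i \<in> Obj J. \<iota> i \<in> Hom K (FObj D i) c) \<and>
     (\<forall>u \<in> Arr J. Comp K (\<iota> (Cod J u)) (FArr D u) = \<iota> (Dom J u))"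

definition is_colimit ::
  "('i, 'j) category \<Rightarrow> ('o, 'a) category \<Rightarrow> ('i, 'j, 'o, 'a) functor_data
    \<Rightarrow> 'o \<Rightarrow> ('i \<Rightarrow> 'a) \<Rightarrow> bool" where
  "is_colimit J K D c \<iota> \<longleftrightarrow> cocone J K D c \<iota> \<and>
     (\<forall>d \<tau>. cocone J K D d \<tau> \<longrightarrow>
        (\<exists>!h. h \<in> Hom K c d \<and> (\<forall>i \<in> Obj J. Comp K h (\<iota> i) = \<tau> i)))"

text \<open>
  Small index categories are taken with objects and arrows in \<open>'u\<close>; every small category is
  isomorphic to such a one.
\<close>

definition cocomplete :: "'u itself \<Rightarrow> ('o, 'a) category \<Rightarrow> bool" where
  "cocomplete U K \<longleftrightarrow>
     (\<forall>(J :: ('u, 'u) category) D. small_category U J \<and> cat_functor J K D \<longrightarrow>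
        (\<exists>c \<iota>. is_colimit J K D c \<iota>))"

definition filtered :: "('i, 'j) category \<Rightarrow> bool" where
  "filtered J \<longleftrightarrow> category J \<and> Obj J \<noteq> {} \<and>
     (\<forall>x \<in> Obj J. \<forall>y \<in> Obj J. \<exists>z \<in> Obj J. Hom J x z \<noteq> {} \<and> Hom J y z \<noteq> {}) \<and>
     (\<forall>x \<in> Obj J. \<forall>y \<in> Obj J. \<forall>f \<in> Hom J x y. \<forall>g \<in> Hom J x y.
        \<exists>z \<in> Obj J. \<exists>h \<in> Hom J y z. Comp J h f = Comp J h g)"

definition is_pushout :: "('o, 'a) category \<Rightarrow> 'a \<Rightarrow> 'a \<Rightarrow> 'a \<Rightarrow> 'a \<Rightarrow> bool" where
  "is_pushout K f g p q \<longleftrightarrow>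
     {f, g, p, q} \<subseteq> Arr K \<and> Dom K f = Dom K g \<and>
     Dom K p = Cod K f \<and> Dom K q = Cod K g \<and> Cod K p = Cod K q \<and>
     Comp K p f = Comp K q g \<and>
     (\<forall>z \<in> Obj K. \<forall>r \<in> Hom K (Cod K f) z. \<forall>s \<in> Hom K (Cod K g) z.
        Comp K r f = Comp K s g \<longrightarrow>
        (\<exists>!h. h \<in> Hom K (Cod K p) z \<and> Comp K h p = r \<and> Comp K h q = s))"

definition has_pushouts :: "('o, 'a) category \<Rightarrow> bool" where
  "has_pushouts K \<longleftrightarrow>
     (\<forall>f \<in> Arr K. \<forall>g \<in> Arr K. Dom K f = Dom K g \<longrightarrow> (\<exists>p q. is_pushout K f g p q))"

definition preserves_pushouts ::
  "('o, 'a) category \<Rightarrow> ('p, 'b) category \<Rightarrow> ('o, 'a, 'p, 'b) functor_data \<Rightarrow> bool" where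
  "preserves_pushouts K L F \<longleftrightarrow> cat_functor K L F \<and>
     (\<forall>f g p q. is_pushout K f g p q \<longrightarrow>
        is_pushout L (FArr F f) (FArr F g) (FArr F p) (FArr F q))"


section \<open>The category of small sets\<close>

text \<open>A map is a triple (source, extensional function, target).\<close>

type_synonym 'x set_map = "'x set \<times> ('x \<Rightarrow> 'x) \<times> 'x set"

definition map_fun_of :: "'x set_map \<Rightarrow> 'x \<Rightarrow> 'x" where
  "map_fun_of = (\<lambda>(A, f, B). f)"

definition set_category :: "'u itself \<Rightarrow> ('x set, 'x set_map) category" where
  "set_category U =
     \<lparr>Obj = {A. small U A},
      Arr = {(A, f, B). small U A \<and> small U B \<and> f \<in> A \<rightarrow>\<^sub>E B},
      Dom = (\<lambda>(A, f, B). A),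
      Cod = (\<lambda>(A, f, B). B),
      Ide = (\<lambda>A. (A, \<lambda>x \<in> A. x, A)),
      Comp = (\<lambda>(B, g, E) (A, f, B'). (A, \<lambda>x \<in> A. g (f x), E))\<rparr>"

text \<open>The functor \<open>Hom(p, -)\<close>.\<close>

definition hom_functor :: "('o, 'a) category \<Rightarrow> 'o \<Rightarrow> ('o, 'a, 'a set, 'a set_map) functor_data" where
  "hom_functor K p =
     \<lparr>FObj = (\<lambda>x \<in> Obj K. Hom K p x),
      FArr = (\<lambda>f \<in> Arr K. (Hom K p (Dom K f), \<lambda>g \<in> Hom K p (Dom K f). Comp K f g,
                           Hom K p (Cod K f)))\<rparr>"


section \<open>Locally finitely presentable categories\<close>

text \<open>That \<open>Hom(p, -)\<close> is a functor to small sets includes that the sets \<open>Hom(p, x)\<close> are small.\<close>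

definition finitely_presentable :: "'u itself \<Rightarrow> ('o, 'a) category \<Rightarrow> 'o \<Rightarrow> bool" where
  "finitely_presentable U K p \<longleftrightarrow> p \<in> Obj K \<and>
     cat_functor K (set_category U) (hom_functor K p) \<and>
     (\<forall>(J :: ('u, 'u) category) D c \<iota>.
        small_category U J \<and> filtered J \<and> cat_functor J K D \<and> is_colimit J K D c \<iota> \<longrightarrow>
        is_colimit J (set_category U) (functor_comp J (hom_functor K p) D)
          (FObj (hom_functor K p) c) (\<lambda>i. FArr (hom_functor K p) (\<iota> i)))"

text \<open>
  Local smallness is not listed separately: \<open>Hom(x, y)\<close> embeds into a small product of small sets
  \<open>Hom(D i, y)\<close> with \<open>D i\<close> finitely presentable, hence is small when \<open>'u\<close> is inaccessible.
\<close>

definition locally_finitely_presentable :: "'u itself \<Rightarrow> ('o, 'a) category \<Rightarrow> bool" where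
  "locally_finitely_presentable U K \<longleftrightarrow> category K \<and> cocomplete U K \<and>
     (\<exists>G. small U G \<and> (\<forall>p \<in> G. finitely_presentable U K p) \<and>
        (\<forall>x \<in> Obj K. \<exists>(J :: ('u, 'u) category) D \<iota>.
           small_category U J \<and> filtered J \<and> cat_functor J K D \<and>
           (\<forall>i \<in> Obj J. FObj D i \<in> G) \<and> is_colimit J K D x \<iota>))"


section \<open>Grothendieck topologies\<close>

definition is_sieve :: "('o, 'a) category \<Rightarrow> 'o \<Rightarrow> 'a set \<Rightarrow> bool" where
  "is_sieve D x S \<longleftrightarrow> S \<subseteq> {f \<in> Arr D. Cod D f = x} \<and>
     (\<forall>f \<in> S. \<forall>g \<in> Arr D. Cod D g = Dom D f \<longrightarrow> Comp D f g \<in> S)"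

definition pullback_sieve :: "('o, 'a) category \<Rightarrow> 'a \<Rightarrow> 'a set \<Rightarrow> 'a set" where
  "pullback_sieve D f S = {g \<in> Arr D. Cod D g = Dom D f \<and> Comp D f g \<in> S}"

definition grothendieck_topology :: "('o, 'a) category \<Rightarrow> ('o \<Rightarrow> 'a set set) \<Rightarrow> bool" where
  "grothendieck_topology D J \<longleftrightarrow>
     (\<forall>x \<in> Obj D. \<forall>S \<in> J x. is_sieve D x S) \<and>
     (\<forall>x \<in> Obj D. {f \<in> Arr D. Cod D f = x} \<in> J x) \<and>
     (\<forall>f \<in> Arr D. \<forall>S \<in> J (Cod D f). pullback_sieve D f S \<in> J (Dom D f)) \<and>
     (\<forall>x \<in> Obj D. \<forall>S \<in> J x. \<forall>R. is_sieve D x R \<and>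
        (\<forall>f \<in> S. pullback_sieve D f R \<in> J (Dom D f)) \<longrightarrow> R \<in> J x)"

definition generated_topology ::
  "('o, 'a) category \<Rightarrow> ('o \<Rightarrow> 'a set set) \<Rightarrow> 'o \<Rightarrow> 'a set set" where
  "generated_topology D K x =
     \<Inter> {J x | J. grothendieck_topology D J \<and> (\<forall>y \<in> Obj D. K y \<subseteq> J y)}"

definition atomic_topology :: "('o, 'a) category \<Rightarrow> 'o \<Rightarrow> 'a set set" where
  "atomic_topology D = generated_topology D (\<lambda>x. {S. is_sieve D x S \<and> S \<noteq> {}})"


section \<open>Sheaves\<close>

type_synonym ('o, 'u) presheaf = "('o, 'u, 'u set, 'u set_map) functor_data"
type_synonym ('o, 'u) presheaf_map = "('o, 'u) presheaf \<times> ('o \<Rightarrow> 'u set_map) \<times> ('o, 'u) presheaf"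

definition presheaf_category ::
  "('o, 'u) category \<Rightarrow> (('o, 'u) presheaf, ('o, 'u) presheaf_map) category" where
  "presheaf_category D = functor_category (opposite D) (set_category TYPE('u))"

definition matching_family ::
  "('o, 'u) category \<Rightarrow> ('o, 'u) presheaf \<Rightarrow> 'u set \<Rightarrow> ('u \<Rightarrow> 'u) \<Rightarrow> bool" where
  "matching_family D F S s \<longleftrightarrow>
     (\<forall>f \<in> S. s f \<in> FObj F (Dom D f)) \<and>
     (\<forall>f \<in> S. \<forall>g \<in> Arr D. Cod D g = Dom D f \<longrightarrow> map_fun_of (FArr F g) (s f) = s (Comp D f g))"

definition is_sheaf ::
  "('o, 'u) category \<Rightarrow> ('o \<Rightarrow> 'u set set) \<Rightarrow> ('o, 'u) presheaf \<Rightarrow> bool" where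
  "is_sheaf D J F \<longleftrightarrow> F \<in> Obj (presheaf_category D) \<and>
     (\<forall>x \<in> Obj D. \<forall>S \<in> J x. \<forall>s. matching_family D F S s \<longrightarrow>
        (\<exists>!a. a \<in> FObj F x \<and> (\<forall>f \<in> S. map_fun_of (FArr F f) a = s f)))"

definition sheaf_category ::
  "('o, 'u) category \<Rightarrow> ('o \<Rightarrow> 'u set set)
    \<Rightarrow> (('o, 'u) presheaf, ('o, 'u) presheaf_map) category" where
  "sheaf_category D J = full_subcategory (presheaf_category D) (is_sheaf D J)"

definition yoneda ::
  "('o, 'u) category \<Rightarrow> ('o, 'u, ('o, 'u) presheaf, ('o, 'u) presheaf_map) functor_data" where
  "yoneda D =
     (let y = (\<lambda>x. \<lparr>FObj = (\<lambda>z \<in> Obj D. Hom D z x),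
                    FArr = (\<lambda>f \<in> Arr D. (Hom D (Cod D f) x,
                                         \<lambda>g \<in> Hom D (Cod D f) x. Comp D g f,
                                         Hom D (Dom D f) x))\<rparr>)
      in \<lparr>FObj = (\<lambda>x \<in> Obj D. y x),
          FArr = (\<lambda>h \<in> Arr D.
            (y (Dom D h),
             \<lambda>z \<in> Obj D. (Hom D z (Dom D h), \<lambda>g \<in> Hom D z (Dom D h). Comp D h g,
                          Hom D z (Cod D h)),
             y (Cod D h)))\<rparr>)"

text \<open>
  The sheafification of a presheaf \<open>P\<close> is a sheaf \<open>S\<close> with a universal map \<open>\<eta> : P \<rightarrow> S\<close>, determined up
  to unique isomorphism; a choice is made for each \<open>P\<close>, and sheafification of a map is then the
  induced map.
\<close>

definition is_sheafification ::
  "('o, 'u) category \<Rightarrow> ('o \<Rightarrow> 'u set set) \<Rightarrow> ('o, 'u) presheaf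
    \<Rightarrow> ('o, 'u) presheaf \<Rightarrow> ('o, 'u) presheaf_map \<Rightarrow> bool" where
  "is_sheafification D J P S \<eta> \<longleftrightarrow>
     S \<in> Obj (sheaf_category D J) \<and> \<eta> \<in> Hom (presheaf_category D) P S \<and>
     (\<forall>F \<in> Obj (sheaf_category D J). \<forall>f \<in> Hom (presheaf_category D) P F.
        \<exists>!g. g \<in> Hom (sheaf_category D J) S F \<and> Comp (presheaf_category D) g \<eta> = f)"

definition sheafify ::
  "('o, 'u) category \<Rightarrow> ('o \<Rightarrow> 'u set set) \<Rightarrow> ('o, 'u) presheaf
    \<Rightarrow> ('o, 'u) presheaf \<times> ('o, 'u) presheaf_map" where
  "sheafify D J P = (SOME (S, \<eta>). is_sheafification D J P S \<eta>)"

definition sheafification ::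
  "('o, 'u) category \<Rightarrow> ('o \<Rightarrow> 'u set set)
    \<Rightarrow> (('o, 'u) presheaf, ('o, 'u) presheaf_map, ('o, 'u) presheaf, ('o, 'u) presheaf_map)
        functor_data" where
  "sheafification D J =
     (let a = (\<lambda>P. fst (sheafify D J P)); \<eta> = (\<lambda>P. snd (sheafify D J P))
      in \<lparr>FObj = (\<lambda>P \<in> Obj (presheaf_category D). a P),
          FArr = (\<lambda>h \<in> Arr (presheaf_category D).
            let P = Dom (presheaf_category D) h; Q = Cod (presheaf_category D) h
            in THE g. g \<in> Hom (sheaf_category D J) (a P) (a Q) \<and>
                      Comp (presheaf_category D) g (\<eta> P) = Comp (presheaf_category D) (\<eta> Q) h)\<rparr>)"

definition canonical_functor ::
  "('o, 'u) category \<Rightarrow> ('o \<Rightarrow> 'u set set)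
    \<Rightarrow> ('o, 'u, ('o, 'u) presheaf, ('o, 'u) presheaf_map) functor_data" where
  "canonical_functor D J = functor_comp D (sheafification D J) (yoneda D)"

end

theory Submission
  imports Defs "HOL-Library.Countable_Set"
begin

text \<open>
  If some span in \<open>\<C>\<close> had no cocone, the empty sieve would cover an object, whose image in the topos
  would be initial; so by (C1) the covering sieves are the non-empty ones, and a sheaf is a functor
  \<open>F : \<C> \<rightarrow> Set\<close> that sends every \<open>f : x \<rightarrow> y\<close> to an injection whose image is the set of all \<open>b \<in> F y\<close>
  with \<open>F g b = F h b\<close> whenever \<open>g f = h f\<close>. By (C2), sheaves preserve pullbacks. By (C3), every \<open>b \<in> F y\<close>
  is \<open>F m c\<close> for some \<open>c \<in> F w\<close> of minimal support, and because of the pullbacks two such elements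
  with a common image differ by an isomorphism of their supports. Hence \<open>F\<close> is a disjoint union of
  orbits \<open>Hom(w, -)/Stab(c)\<close>, and it is the directed union of its finite unions of orbits.

  By (C4), the stabilizer of an element of a filtered colimit of sheaves is already attained at some
  stage. Together with minimal supports this shows that the colimit formed pointwise is again a sheaf,
  and then that finite unions of orbits are finitely presentable.
\<close>

section \<open>Smallness\<close>

text \<open>The obstacle is uniformity. Gluing along \<open>f\<close> in a filtered colimit involves
  one equation for every pair \<open>g\<close>, \<open>h\<close> with \<open>g f = h f\<close>, and
  each of them holds only from a stage of its own. Writing the element as \<open>m c\<close> with
  \<open>c\<close> of minimal support turns each equation into the statement that some automorphism
  of one fixed object fixes \<open>c\<close>. These automorphisms lie in the stabilizer of the germ
  of \<open>c\<close>, and the ascending chain condition attains it at a single stage. Finite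
  presentability meets the same difficulty: an orbit has one generator, but its relations are
  indexed by a whole stabilizer.

  Under the Ore condition, sheafified representables, small colimits and filtered colimits all come
  from one construction, \<open>completion\<close>, applied to raw elements with an action and a
  congruence that can be tested after any arrow. Agreement under all maps to sheaves, or under all
  cocones, gives universal properties at once but hides the elements; equality of germs gives
  control of the elements. Uniqueness of colimits links the two descriptions.\<close>

lemma small_inj:
  assumes "inj_on f A" "f ` A \<subseteq> B" "small U B" shows "small U A"
  using assms card_of_ordLeq[of A B] unfolding small_def by (blast intro: ordLeq_ordLess_trans)

lemma small_subset: "A \<subseteq> B \<Longrightarrow> small U B \<Longrightarrow> small U A"
  by (rule small_inj[of id]) auto

lemma small_image: "small U A \<Longrightarrow> small U (f ` A)"
  unfolding small_def by (rule ordLeq_ordLess_trans[OF card_of_image])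

lemma small_embed:
  assumes "small (U :: 'u itself) A"
  obtains e :: "'x \<Rightarrow> 'u" where "inj_on e A"
  using assms card_of_ordLeq[of A "UNIV :: 'u set"] unfolding small_def by (blast dest: ordLess_imp_ordLeq)

text \<open>The cardinal conditions that do not mention the site. Closure under powers, which does,
  enters with \<open>noetherian_universe_site\<close>.\<close>

locale universe =
  fixes U :: "'u itself"
  assumes uncountable: "natLeq <o |UNIV :: 'u set|"
    and regular: "regularCard |UNIV :: 'u set|"
begin

abbreviation sml :: "'x set \<Rightarrow> bool" where "sml \<equiv> small U"

lemma infinite_universe: "infinite (UNIV :: 'u set)"
  using uncountable infinite_iff_natLeq_ordLeq[of "UNIV :: 'u set"] by (blast dest: ordLess_imp_ordLeq)

lemma small_countable: "countable A \<Longrightarrow> sml A"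
proof -
  assume "countable A"
  then have "|A| \<le>o |UNIV :: nat set|" unfolding countable_def card_of_ordLeq[symmetric] by auto
  then show ?thesis unfolding small_def
    by (rule ordLeq_ordLess_trans[OF _ ordIso_ordLess_trans[OF card_of_nat uncountable]])
qed

text \<open>Regularity of the universe enters here: an infinite regular cardinal is stable, that is,
  sums of smaller sets over a smaller index set stay smaller.\<close>

lemma small_Sigma: "sml I \<Longrightarrow> (\<And>i. i \<in> I \<Longrightarrow> sml (A i)) \<Longrightarrow> sml (Sigma I A)"
  unfolding small_def
  by (rule stable_elim[OF regularCard_stable[OF card_of_Card_order _ regular]]) (simp_all add: Field_card_of infinite_universe)

lemma small_UN: "sml I \<Longrightarrow> (\<And>i. i \<in> I \<Longrightarrow> sml (A i)) \<Longrightarrow> sml (\<Union>i\<in>I. A i)"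
  by (rule small_subset[OF _ small_image[OF small_Sigma, of I A snd]]) force+

lemma small_Times: "sml A \<Longrightarrow> sml B \<Longrightarrow> sml (A \<times> B)"
  by (rule small_Sigma)

text \<open>The universe being uncountable, the set of possible lengths is small, and lists of a
  fixed length are iterated products.\<close>

lemma small_lists: assumes "sml A" shows "sml (lists A)"
proof -
  have "sml {xs \<in> lists A. length xs = n}" for n
  proof (induction n)
    case 0
    have "{xs \<in> lists A. length xs = 0} = {[]}" by auto
    then show ?case by (simp add: small_countable)
  next
    case (Suc n)
    have "{xs \<in> lists A. length xs = Suc n} = (\<lambda>(x, xs). x # xs) ` (A \<times> {xs \<in> lists A. length xs = n})"
      by (auto simp: length_Suc_conv)
    then show ?case using small_image[OF small_Times[OF assms Suc]] by simp
  qed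
  then have "sml (\<Union>n. {xs \<in> lists A. length xs = n})" by (intro small_UN small_countable[of UNIV]) auto
  then show ?thesis by (rule small_subset[rotated]) auto
qed

text \<open>Serves twice: to index a sheaf by the finite unions of its orbits, and to bound the maps
  out of a finitely generated sheaf by their graphs on generators.\<close>

lemma small_Fpow: assumes "sml A" shows "sml {E. finite E \<and> E \<subseteq> A}"
proof -
  have "{E. finite E \<and> E \<subseteq> A} \<subseteq> set ` lists A"
    using finite_list by fastforce
  then show ?thesis by (rule small_subset[OF _ small_image[OF small_lists[OF assms]]])
qed

end

section \<open>Functors to small sets\<close>

text \<open>Functors to sets and their transformations are stored as triples with extensional
  functions. \<open>act\<close> and \<open>app\<close> extract the underlying functions, and later
  arguments are carried out on elements.\<close>

definition act :: "('o, 'a, 'x set, 'x set_map) functor_data \<Rightarrow> 'a \<Rightarrow> 'x \<Rightarrow> 'x" where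
  "act F f = map_fun_of (FArr F f)"

definition app :: "'f \<times> ('o \<Rightarrow> 'x set_map) \<times> 'g \<Rightarrow> 'o \<Rightarrow> 'x \<Rightarrow> 'x" where
  "app m x = map_fun_of (fst (snd m) x)"

lemma HomI: "f \<in> Arr C \<Longrightarrow> f \<in> Hom C (Dom C f) (Cod C f)"
  by (simp add: Hom_def)

lemma HomD: "f \<in> Hom C x y \<Longrightarrow> f \<in> Arr C" "f \<in> Hom C x y \<Longrightarrow> Dom C f = x" "f \<in> Hom C x y \<Longrightarrow> Cod C f = y"
  by (auto simp: Hom_def)

lemma opposite_opposite: "opposite (opposite C) = (C :: ('o, 'a) category)"
  by (simp add: opposite_def)

lemma opposite_sel [simp]:
  "Obj (opposite C) = Obj C" "Arr (opposite C) = Arr C" "Dom (opposite C) = Cod C"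
  "Cod (opposite C) = Dom C" "Ide (opposite C) = Ide C" "Comp (opposite C) g f = Comp C f g"
  by (simp_all add: opposite_def)

lemma Hom_opposite [simp]: "Hom (opposite C) x y = Hom C y x"
  by (auto simp: Hom_def)

lemma set_category_sel [simp]:
  "Obj (set_category U) = {A. small U A}"
  "Arr (set_category U) = {(A, f, B). small U A \<and> small U B \<and> f \<in> A \<rightarrow>\<^sub>E B}"
  "Dom (set_category U) = fst" "Cod (set_category U) = (\<lambda>m. snd (snd m))"
  "Ide (set_category U) A = (A, \<lambda>x \<in> A. x, A)"
  "Comp (set_category U) n m = (fst m, \<lambda>x \<in> fst m. map_fun_of n (map_fun_of m x), snd (snd n))"
  by (auto simp: set_category_def map_fun_of_def split: prod.split)

lemma Hom_set_category:
  "m \<in> Hom (set_category U) A B \<longleftrightarrow> small U A \<and> small U B \<and> (\<exists>f. m = (A, f, B) \<and> f \<in> A \<rightarrow>\<^sub>E B)"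
  by (auto simp: Hom_def)

lemma map_fun_of_simp [simp]: "map_fun_of (A, f, B) = f"
  by (simp add: map_fun_of_def)

lemma category_set_category: "category (set_category U)"
  by unfold_locales (auto simp: Hom_set_category intro!: ext split: if_splits)

section \<open>Set-valued functors and natural maps in terms of elements\<close>

context category
begin

lemma Hom_Obj: "f \<in> Hom C x y \<Longrightarrow> x \<in> Obj C" "f \<in> Hom C x y \<Longrightarrow> y \<in> Obj C"
  using Dom_closed Cod_closed by (auto simp: Hom_def)

lemma small_Obj_if_small_Arr: "small U (Arr C) \<Longrightarrow> small U (Obj C)"
proof (rule small_subset[OF _ small_image])
  show "Obj C \<subseteq> Dom C ` Arr C"
  proof
    fix x assume "x \<in> Obj C"
    then have "Ide C x \<in> Arr C" "Dom C (Ide C x) = x" using HomD[OF Ide_closed] by auto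
    then show "x \<in> Dom C ` Arr C" by (metis imageI)
  qed
qed

text \<open>A presheaf on the opposite category is a covariant functor on \<open>C\<close>. The type
  of the elements doubles as the universe that bounds their number.\<close>

definition psh :: "('o, 'a, 'x set, 'x set_map) functor_data \<Rightarrow> bool" where
  "psh F \<longleftrightarrow> cat_functor C (set_category TYPE('x)) F"

text \<open>Absorbs the extensional encoding once and for all: a functor is given by its sets and
  its action on elements, and \<open>mk_map\<close> does the same for natural
  transformations.\<close>

definition mk_psh :: "('o \<Rightarrow> 'x set) \<Rightarrow> ('a \<Rightarrow> 'x \<Rightarrow> 'x) \<Rightarrow> ('o, 'a, 'x set, 'x set_map) functor_data" where
  "mk_psh A t = \<lparr>FObj = (\<lambda>x \<in> Obj C. A x),
     FArr = (\<lambda>f \<in> Arr C. (A (Dom C f), \<lambda>a \<in> A (Dom C f). t f a, A (Cod C f)))\<rparr>"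

definition mk_map :: "('o, 'a, 'x set, 'x set_map) functor_data \<Rightarrow> ('o \<Rightarrow> 'x \<Rightarrow> 'x) \<Rightarrow>
    ('o, 'a, 'x set, 'x set_map) functor_data \<Rightarrow>
    ('o, 'a, 'x set, 'x set_map) functor_data \<times> ('o \<Rightarrow> 'x set_map) \<times> ('o, 'a, 'x set, 'x set_map) functor_data" where
  "mk_map F h G = (F, \<lambda>x \<in> Obj C. (FObj F x, \<lambda>a \<in> FObj F x. h x a, FObj G x), G)"

lemma FObj_mk_psh [simp]: "x \<in> Obj C \<Longrightarrow> FObj (mk_psh A t) x = A x"
  by (simp add: mk_psh_def)

lemma act_mk_psh [simp]: "f \<in> Hom C x y \<Longrightarrow> a \<in> A x \<Longrightarrow> act (mk_psh A t) f a = t f a"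
  by (auto simp: mk_psh_def act_def Hom_def)

lemma app_mk_map [simp]: "x \<in> Obj C \<Longrightarrow> a \<in> FObj F x \<Longrightarrow> app (mk_map F h G) x a = h x a"
  by (simp add: mk_map_def app_def)

context
  fixes F :: "('o, 'a, 'x set, 'x set_map) functor_data"
  assumes F: "psh F"
begin

interpretation F: cat_functor C "set_category TYPE('x)" F
  using F unfolding psh_def .

lemma psh_FArr: "f \<in> Hom C x y \<Longrightarrow> FArr F f = (FObj F x, act F f, FObj F y) \<and> act F f \<in> FObj F x \<rightarrow>\<^sub>E FObj F y"
  using F.FArr_closed[of f x y] by (auto simp: Hom_set_category act_def)

lemma psh_small: "x \<in> Obj C \<Longrightarrow> small TYPE('x) (FObj F x)"
  using F.FObj_closed by auto

lemma act_closed: "f \<in> Hom C x y \<Longrightarrow> a \<in> FObj F x \<Longrightarrow> act F f a \<in> FObj F y"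
  using psh_FArr by blast

lemma act_Ide: "x \<in> Obj C \<Longrightarrow> a \<in> FObj F x \<Longrightarrow> act F (Ide C x) a = a"
  using F.FArr_Ide[of x] by (simp add: act_def)

lemma act_Comp: "f \<in> Hom C x y \<Longrightarrow> g \<in> Hom C y z \<Longrightarrow> a \<in> FObj F x \<Longrightarrow>
    act F (Comp C g f) a = act F g (act F f a)"
proof -
  assume fg: "f \<in> Hom C x y" "g \<in> Hom C y z" and a: "a \<in> FObj F x"
  have "fst (FArr F f) = FObj F x" using psh_FArr[OF fg(1)] by (metis fst_conv)
  then have "map_fun_of (FArr F (Comp C g f)) = (\<lambda>a \<in> FObj F x. act F g (act F f a))"
    using F.FArr_Comp[OF fg] by (simp add: act_def)
  then show ?thesis using a by (simp add: act_def)
qed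

end

lemma psh_mk_psh:
  fixes A :: "'o \<Rightarrow> 'x set"
  assumes "\<And>x. x \<in> Obj C \<Longrightarrow> small TYPE('x) (A x)"
    and "\<And>f x y a. f \<in> Hom C x y \<Longrightarrow> a \<in> A x \<Longrightarrow> t f a \<in> A y"
    and "\<And>x a. x \<in> Obj C \<Longrightarrow> a \<in> A x \<Longrightarrow> t (Ide C x) a = a"
    and "\<And>f g x y z a. f \<in> Hom C x y \<Longrightarrow> g \<in> Hom C y z \<Longrightarrow> a \<in> A x \<Longrightarrow> t (Comp C g f) a = t g (t f a)"
  shows "psh (mk_psh A t)"
  unfolding psh_def
proof (intro cat_functor.intro cat_functor_axioms.intro category_axioms category_set_category)
  show "FObj (mk_psh A t) \<in> Obj C \<rightarrow>\<^sub>E Obj (set_category TYPE('x))"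
    using assms(1) by (auto simp: mk_psh_def)
  show "FArr (mk_psh A t) \<in> extensional (Arr C)" by (simp add: mk_psh_def)
  show "FArr (mk_psh A t) f \<in> Hom (set_category TYPE('x)) (FObj (mk_psh A t) x) (FObj (mk_psh A t) y)"
    if "f \<in> Hom C x y" for f x y
    using that assms(1,2) Hom_Obj[OF that] by (auto simp: mk_psh_def Hom_set_category Hom_def)
  show "FArr (mk_psh A t) (Ide C x) = Ide (set_category TYPE('x)) (FObj (mk_psh A t) x)"
    if "x \<in> Obj C" for x
    using that assms(3) Ide_closed[OF that] by (auto simp: mk_psh_def Hom_def)
  show "FArr (mk_psh A t) (Comp C g f) = Comp (set_category TYPE('x)) (FArr (mk_psh A t) g) (FArr (mk_psh A t) f)"
    if "f \<in> Hom C x y" "g \<in> Hom C y z" for f g x y z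
    using that assms(2,4) Comp_closed[OF that] by (auto simp: mk_psh_def Hom_def)
qed

lemma functor_category_sel [simp]:
  "Obj (functor_category C D) = {F. cat_functor C D F}"
  "Dom (functor_category C D) = fst"
  "Cod (functor_category C D) = (\<lambda>m. snd (snd m))"
  by (auto simp: functor_category_def)

definition natural :: "('o, 'a, 'x set, 'x set_map) functor_data \<Rightarrow> ('o, 'a, 'x set, 'x set_map) functor_data \<Rightarrow>
    ('o \<Rightarrow> 'x \<Rightarrow> 'x) \<Rightarrow> bool" where
  "natural F G h \<longleftrightarrow> (\<forall>x\<in>Obj C. \<forall>a\<in>FObj F x. h x a \<in> FObj G x) \<and>
     (\<forall>x y. \<forall>f\<in>Hom C x y. \<forall>a\<in>FObj F x. h y (act F f a) = act G f (h x a))"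

abbreviation (input) Psh :: "'x itself \<Rightarrow> (('o, 'a, 'x set, 'x set_map) functor_data,
   ('o, 'a, 'x set, 'x set_map) functor_data \<times> ('o \<Rightarrow> 'x set_map) \<times> ('o, 'a, 'x set, 'x set_map) functor_data) category" where
  "Psh U \<equiv> functor_category C (set_category U)"

lemma mk_map_Psh:
  fixes F G :: "('o, 'a, 'x set, 'x set_map) functor_data"
  assumes "psh F" "psh G" "natural F G h"
  shows "mk_map F h G \<in> Hom (Psh TYPE('x)) F G"
proof -
  have "Comp (set_category TYPE('x)) (FArr G f) (FObj F (Dom C f), restrict (h (Dom C f)) (FObj F (Dom C f)), FObj G (Dom C f)) =
        Comp (set_category TYPE('x)) (FObj F (Cod C f), restrict (h (Cod C f)) (FObj F (Cod C f)), FObj G (Cod C f)) (FArr F f)"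
    if "f \<in> Arr C" for f
  proof -
    note f = HomI[OF that]
    have "fst (FArr F f) = FObj F (Dom C f)" "snd (snd (FArr G f)) = FObj G (Cod C f)"
      using psh_FArr[OF assms(1) f] psh_FArr[OF assms(2) f] by (metis fst_conv snd_conv)+
    moreover have "act G f (h (Dom C f) a) = h (Cod C f) (act F f a)" if "a \<in> FObj F (Dom C f)" for a
      using assms(3) f that by (simp add: natural_def)
    ultimately show ?thesis
      using act_closed[OF assms(1) f] by (auto simp: act_def intro!: restrict_ext)
  qed
  then show ?thesis
    using assms psh_small[OF assms(1)] psh_small[OF assms(2)]
    unfolding Hom_def
    by (auto simp: functor_category_def mk_map_def psh_def natural_def Dom_closed Cod_closed Hom_set_category
        simp del: set_category_sel(6))
qed

lemma Psh_Hom: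
  fixes F G :: "('o, 'a, 'x set, 'x set_map) functor_data"
  assumes "m \<in> Hom (Psh TYPE('x)) F G"
  shows "psh F" "psh G" "natural F G (app m)" "m = mk_map F (app m) G"
proof -
  obtain \<eta> where m: "m = (F, \<eta>, G)" and F: "psh F" and G: "psh G" and ext: "\<eta> \<in> extensional (Obj C)"
    and \<eta>: "\<And>x. x \<in> Obj C \<Longrightarrow> \<eta> x \<in> Hom (set_category TYPE('x)) (FObj F x) (FObj G x)"
    and nat: "\<And>f. f \<in> Arr C \<Longrightarrow> Comp (set_category TYPE('x)) (FArr G f) (\<eta> (Dom C f)) = Comp (set_category TYPE('x)) (\<eta> (Cod C f)) (FArr F f)"
    using HomD[OF assms] by (auto simp: functor_category_def psh_def simp del: set_category_sel)
  have e: "\<eta> x = (FObj F x, map_fun_of (\<eta> x), FObj G x) \<and> map_fun_of (\<eta> x) \<in> FObj F x \<rightarrow>\<^sub>E FObj G x" if "x \<in> Obj C" for x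
    using \<eta>[OF that] by (auto simp: Hom_set_category)
  show "psh F" "psh G" by fact+
  show "natural F G (app m)"
    unfolding natural_def
  proof (intro conjI ballI allI)
    show "app m x a \<in> FObj G x" if "x \<in> Obj C" "a \<in> FObj F x" for x a
      using e[OF that(1)] that(2) by (auto simp: m app_def)
    fix x y f a assume f: "f \<in> Hom C x y" and a: "a \<in> FObj F x"
    have *: "Comp (set_category TYPE('x)) (FArr G f) (\<eta> x) = Comp (set_category TYPE('x)) (\<eta> y) (FArr F f)"
      using nat[of f] f by (auto simp: Hom_def)
    have "fst (\<eta> x) = FObj F x" "fst (FArr F f) = FObj F x" using e[OF Hom_Obj(1)[OF f]] psh_FArr[OF F f] by (metis fst_conv)+
    then show "app m y (act F f a) = act G f (app m x a)"
      using * a by (auto simp: app_def act_def m fun_eq_iff) (metis)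
  qed
  show "m = mk_map F (app m) G"
    unfolding m mk_map_def
  proof (intro arg_cong2[where f=Pair] refl extensionalityI[OF ext] restrict_extensional)
    fix x assume x: "x \<in> Obj C"
    then show "\<eta> x = (\<lambda>x\<in>Obj C. (FObj F x, restrict (app (F, \<eta>, G) x) (FObj F x), FObj G x)) x"
      using e[OF x] by (auto simp: app_def PiE_def extensional_restrict)
  qed
qed

lemma Psh_map_eqI:
  fixes F G :: "('o, 'a, 'x set, 'x set_map) functor_data"
  assumes "m \<in> Hom (Psh TYPE('x)) F G" "n \<in> Hom (Psh TYPE('x)) F G"
    and "\<And>x a. x \<in> Obj C \<Longrightarrow> a \<in> FObj F x \<Longrightarrow> app m x a = app n x a"
  shows "m = n"
proof -
  have "m = mk_map F (app m) G" "n = mk_map F (app n) G" using Psh_Hom(4) assms by blast+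
  moreover have "mk_map F (app m) G = mk_map F (app n) G"
    using assms(3) by (auto simp: mk_map_def intro!: restrict_ext)
  ultimately show ?thesis by simp
qed

lemma natural_comp: "natural F G h \<Longrightarrow> natural G H k \<Longrightarrow> natural F H (\<lambda>x a. k x (h x a))"
  unfolding natural_def using Hom_Obj by simp

lemma Psh_Comp:
  fixes F G :: "('o, 'a, 'x set, 'x set_map) functor_data"
  assumes m: "m \<in> Hom (Psh TYPE('x)) F G" and n: "n \<in> Hom (Psh TYPE('x)) G H"
  shows "Comp (Psh TYPE('x)) n m = mk_map F (\<lambda>x a. app n x (app m x a)) H"
proof -
  have "Comp (Psh TYPE('x)) n m = Comp (Psh TYPE('x)) (mk_map G (app n) H) (mk_map F (app m) G)"
    by (rule arg_cong2[OF Psh_Hom(4)[OF n] Psh_Hom(4)[OF m]])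
  also have "Comp (Psh TYPE('x)) (mk_map G (app n) H) (mk_map F (app m) G) = mk_map F (\<lambda>x a. app n x (app m x a)) H"
    using Psh_Hom(3)[OF m] by (auto simp: functor_category_def mk_map_def natural_def intro!: restrict_ext)
  finally show ?thesis .
qed

lemma Psh_Ide:
  fixes F :: "('o, 'a, 'x set, 'x set_map) functor_data"
  shows "Ide (Psh TYPE('x)) F = mk_map F (\<lambda>x a. a) F"
  by (simp add: functor_category_def mk_map_def)

lemma category_Psh: "category (Psh TYPE('x))"
proof
  fix f :: "('o, 'a, 'x set, 'x set_map) functor_data \<times> ('o \<Rightarrow> 'x set_map) \<times> ('o, 'a, 'x set, 'x set_map) functor_data"
  assume "f \<in> Arr (Psh TYPE('x))"
  then show "Dom (Psh TYPE('x)) f \<in> Obj (Psh TYPE('x))" "Cod (Psh TYPE('x)) f \<in> Obj (Psh TYPE('x))"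
    by (auto simp: functor_category_def)
next
  fix F :: "('o, 'a, 'x set, 'x set_map) functor_data"
  assume "F \<in> Obj (Psh TYPE('x))"
  then show "Ide (Psh TYPE('x)) F \<in> Hom (Psh TYPE('x)) F F"
    unfolding Psh_Ide by (intro mk_map_Psh) (auto simp: psh_def natural_def)
next
  fix F G H f g assume fg: "f \<in> Hom (Psh TYPE('x)) F G" "g \<in> Hom (Psh TYPE('x)) G H"
  show c: "Comp (Psh TYPE('x)) g f \<in> Hom (Psh TYPE('x)) F H"
    unfolding Psh_Comp[OF fg] by (rule mk_map_Psh[OF Psh_Hom(1)[OF fg(1)] Psh_Hom(2)[OF fg(2)] natural_comp[OF Psh_Hom(3)[OF fg(1)] Psh_Hom(3)[OF fg(2)]]])
next
  fix F G f assume f: "f \<in> Hom (Psh TYPE('x)) F G"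
  have i: "mk_map F (\<lambda>x a. a) F \<in> Hom (Psh TYPE('x)) F F" if "psh F" for F
    using that by (intro mk_map_Psh) (auto simp: natural_def)
  have n: "app f x a \<in> FObj G x" if "x \<in> Obj C" "a \<in> FObj F x" for x a
    using Psh_Hom(3)[OF f] that by (auto simp: natural_def)
  have "mk_map F (\<lambda>x a. app f x (app (mk_map F (\<lambda>x a. a) F) x a)) G = mk_map F (app f) G"
    "mk_map F (\<lambda>x a. app (mk_map G (\<lambda>x a. a) G) x (app f x a)) G = mk_map F (app f) G"
    using n unfolding mk_map_def[of F _ G] by (auto intro!: restrict_ext)
  then show "Comp (Psh TYPE('x)) f (Ide (Psh TYPE('x)) F) = f" "Comp (Psh TYPE('x)) (Ide (Psh TYPE('x)) G) f = f"
    unfolding Psh_Ide Psh_Comp[OF i[OF Psh_Hom(1)[OF f]] f] Psh_Comp[OF f i[OF Psh_Hom(2)[OF f]]]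
    by (simp_all only: Psh_Hom(4)[OF f, symmetric])
next
  fix F G H K f g h
  assume f: "f \<in> Hom (Psh TYPE('x)) F G" and g: "g \<in> Hom (Psh TYPE('x)) G H" and h: "h \<in> Hom (Psh TYPE('x)) H K"
  have gf: "Comp (Psh TYPE('x)) g f \<in> Hom (Psh TYPE('x)) F H"
    unfolding Psh_Comp[OF f g] by (rule mk_map_Psh[OF Psh_Hom(1)[OF f] Psh_Hom(2)[OF g] natural_comp[OF Psh_Hom(3)[OF f] Psh_Hom(3)[OF g]]])
  have hg: "Comp (Psh TYPE('x)) h g \<in> Hom (Psh TYPE('x)) G K"
    unfolding Psh_Comp[OF g h] by (rule mk_map_Psh[OF Psh_Hom(1)[OF g] Psh_Hom(2)[OF h] natural_comp[OF Psh_Hom(3)[OF g] Psh_Hom(3)[OF h]]])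
  have n: "app f x a \<in> FObj G x" if "x \<in> Obj C" "a \<in> FObj F x" for x a
    using Psh_Hom(3)[OF f] that by (auto simp: natural_def)
  show "Comp (Psh TYPE('x)) h (Comp (Psh TYPE('x)) g f) = Comp (Psh TYPE('x)) (Comp (Psh TYPE('x)) h g) f"
    unfolding Psh_Comp[OF gf h] Psh_Comp[OF f hg] unfolding Psh_Comp[OF f g] Psh_Comp[OF g h]
    using n unfolding mk_map_def[of F _ K] by (auto intro!: restrict_ext)
qed

end

section \<open>Sheaves for the atomic topology\<close>

lemma (in category) presheaf_category_opposite:
  "presheaf_category (opposite C) = Psh TYPE('a)"
  by (simp add: presheaf_category_def opposite_opposite)

context category
begin

text \<open>The sheaf condition for the sieve generated by a single \<open>f\<close> from
  \<open>x\<close> to \<open>y\<close>. A matching family on this sieve amounts to an element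
  \<open>b\<close> over \<open>y\<close> with \<open>g b = h b\<close> whenever
  \<open>g f = h f\<close>; injectivity is uniqueness of the amalgamation and the second condition
  is its existence.\<close>

definition shf :: "('o, 'a, 'x set, 'x set_map) functor_data \<Rightarrow> bool" where
  "shf F \<longleftrightarrow> psh F \<and> (\<forall>x y. \<forall>f\<in>Hom C x y. inj_on (act F f) (FObj F x)) \<and>
     (\<forall>x y. \<forall>f\<in>Hom C x y. \<forall>b\<in>FObj F y.
        (\<forall>z. \<forall>g\<in>Hom C y z. \<forall>h\<in>Hom C y z. Comp C g f = Comp C h f \<longrightarrow> act F g b = act F h b) \<longrightarrow>
        b \<in> act F f ` FObj F x)"

lemma shf_psh: "shf F \<Longrightarrow> psh F"
  by (simp add: shf_def)

lemma shf_inj: "shf F \<Longrightarrow> f \<in> Hom C x y \<Longrightarrow> a \<in> FObj F x \<Longrightarrow> b \<in> FObj F x \<Longrightarrow> act F f a = act F f b \<Longrightarrow> a = b"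
  unfolding shf_def inj_on_def by blast

lemma shf_glue:
  assumes "shf F" "f \<in> Hom C x y" "b \<in> FObj F y"
    and "\<And>z g h. g \<in> Hom C y z \<Longrightarrow> h \<in> Hom C y z \<Longrightarrow> Comp C g f = Comp C h f \<Longrightarrow> act F g b = act F h b"
  obtains a where "a \<in> FObj F x" "act F f a = b"
  using assms unfolding shf_def by blast

text \<open>The Ore condition for arrows with a common source. It keeps non-empty sieves non-empty
  under pullback.\<close>

definition ore :: bool where
  "ore \<longleftrightarrow> (\<forall>x y z. \<forall>f\<in>Hom C x y. \<forall>g\<in>Hom C x z. \<exists>w. \<exists>h\<in>Hom C y w. \<exists>k\<in>Hom C z w. Comp C h f = Comp C k g)"

lemma oreE:
  assumes ore "f \<in> Hom C x y" "g \<in> Hom C x z"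
  obtains w h k where "h \<in> Hom C y w" "k \<in> Hom C z w" "Comp C h f = Comp C k g"
  using assms unfolding ore_def by blast

lemma is_sieve_opposite:
  "is_sieve (opposite C) x S \<longleftrightarrow> S \<subseteq> {f \<in> Arr C. Dom C f = x} \<and>
     (\<forall>f y z g. f \<in> S \<longrightarrow> f \<in> Hom C x y \<longrightarrow> g \<in> Hom C y z \<longrightarrow> Comp C g f \<in> S)"
  unfolding is_sieve_def by (fastforce simp: Hom_def)

lemma is_sieve_pullback:
  assumes "is_sieve (opposite C) x S" "f \<in> Hom C x y"
  shows "is_sieve (opposite C) y (pullback_sieve (opposite C) f S)"
  unfolding is_sieve_opposite pullback_sieve_def
proof (intro conjI allI impI)
  fix g y' z h
  assume g: "g \<in> {g \<in> Arr (opposite C). Cod (opposite C) g = Dom (opposite C) f \<and> Comp (opposite C) f g \<in> S}"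
    and g': "g \<in> Hom C y y'" and h: "h \<in> Hom C y' z"
  have "Comp C g f \<in> S" using g by simp
  then have "Comp C h (Comp C g f) \<in> S" using assms(1) Comp_closed[OF assms(2) g'] h unfolding is_sieve_opposite by blast
  then show "Comp C h g \<in> {g \<in> Arr (opposite C). Cod (opposite C) g = Dom (opposite C) f \<and> Comp (opposite C) f g \<in> S}"
    using Comp_assoc[OF assms(2) g' h] Comp_closed[OF g' h] assms(2) by (simp add: Hom_def)
qed (use assms in \<open>auto simp: Hom_def\<close>)

lemma sieve_hom: "is_sieve (opposite C) x S \<Longrightarrow> f \<in> S \<Longrightarrow> f \<in> Hom C x (Cod C f)"
  by (auto simp: is_sieve_opposite Hom_def)

lemma sieve_comp: "is_sieve (opposite C) x S \<Longrightarrow> f \<in> S \<Longrightarrow> f \<in> Hom C x y \<Longrightarrow> g \<in> Hom C y z \<Longrightarrow> Comp C g f \<in> S"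
  unfolding is_sieve_opposite by blast

text \<open>A member \<open>g\<close> of a sieve and the arrow \<open>f\<close> along which it is
  pulled back complete to a square, whose side opposite to \<open>g\<close> lies in the pulled back
  sieve. So the non-empty sieves already form a topology, and generating one from them adds
  nothing.\<close>

lemma atomic_topology_ore:
  assumes ore "x \<in> Obj C"
  shows "atomic_topology (opposite C) x = {S. is_sieve (opposite C) x S \<and> S \<noteq> {}}"
proof
  show "{S. is_sieve (opposite C) x S \<and> S \<noteq> {}} \<subseteq> atomic_topology (opposite C) x"
    using assms(2) unfolding atomic_topology_def generated_topology_def by auto
  let ?K = "\<lambda>x. {S. is_sieve (opposite C) x S \<and> S \<noteq> {}}"
  have "grothendieck_topology (opposite C) ?K"
    unfolding grothendieck_topology_def
  proof (intro conjI ballI allI impI)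
    fix x assume x: "x \<in> Obj (opposite C)"
    have "is_sieve (opposite C) x {f \<in> Arr C. Dom C f = x}"
      unfolding is_sieve_opposite using Comp_closed by (auto simp: Hom_def)
    moreover have "Ide C x \<in> {f \<in> Arr C. Dom C f = x}" using Ide_closed[of x] x by (auto simp: Hom_def)
    ultimately show "{f \<in> Arr (opposite C). Cod (opposite C) f = x} \<in> ?K x" by auto
  next
    fix f S assume f: "f \<in> Arr (opposite C)" and S: "S \<in> ?K (Cod (opposite C) f)"
    then obtain g where g: "g \<in> S" by auto
    have f': "f \<in> Hom C (Dom C f) (Cod C f)" using f by (simp add: HomI)
    have g': "g \<in> Hom C (Dom C f) (Cod C g)" using S g sieve_hom by auto
    from oreE[OF assms(1) f' g'] obtain w h k where hk: "h \<in> Hom C (Cod C f) w" "k \<in> Hom C (Cod C g) w" "Comp C h f = Comp C k g" .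
    have "Comp C k g \<in> S" using S g g' hk(2) sieve_comp by auto
    then have "h \<in> pullback_sieve (opposite C) f S" using hk by (auto simp: pullback_sieve_def Hom_def)
    then show "pullback_sieve (opposite C) f S \<in> ?K (Dom (opposite C) f)"
      using is_sieve_pullback[OF _ f', of S] S by auto
  next
    fix x S R assume "x \<in> Obj (opposite C)" "S \<in> ?K x"
      and R: "is_sieve (opposite C) x R \<and> (\<forall>f\<in>S. pullback_sieve (opposite C) f R \<in> ?K (Dom (opposite C) f))"
    then obtain f where "f \<in> S" by auto
    then have "pullback_sieve (opposite C) f R \<noteq> {}" using R by auto
    then show "R \<in> ?K x" using R by (auto simp: pullback_sieve_def)
  qed auto
  then show "atomic_topology (opposite C) x \<subseteq> ?K x"
    unfolding atomic_topology_def generated_topology_def by blast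
qed

lemma matching_opposite:
  fixes F :: "('o, 'a) presheaf"
  shows "matching_family (opposite C) F S s \<longleftrightarrow>
     (\<forall>f \<in> S. s f \<in> FObj F (Cod C f)) \<and>
     (\<forall>f \<in> S. \<forall>g \<in> Arr C. Dom C g = Cod C f \<longrightarrow> act F g (s f) = s (Comp C g f))"
  by (simp add: matching_family_def act_def)

lemma is_sheaf_psh: "is_sheaf (opposite C) J F \<Longrightarrow> psh F"
  by (auto simp: is_sheaf_def presheaf_category_opposite psh_def)

lemma principal_sieve:
  assumes "f \<in> Hom C x y"
  shows "is_sieve (opposite C) x {Comp C g f | g z. g \<in> Hom C y z}"
  unfolding is_sieve_opposite
proof (intro conjI allI impI)
  show "{Comp C g f |g z. g \<in> Hom C y z} \<subseteq> {f \<in> Arr C. Dom C f = x}"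
    using Comp_closed[OF assms] by (auto simp: Hom_def)
  fix k y' z h
  assume "k \<in> {Comp C g f |g z. g \<in> Hom C y z}" and k: "k \<in> Hom C x y'" and h: "h \<in> Hom C y' z"
  then obtain g z' where g: "g \<in> Hom C y z'" "k = Comp C g f" by blast
  then have "z' = y'" using k Comp_closed[OF assms g(1)] by (auto simp: Hom_def)
  then have "Comp C h k = Comp C (Comp C h g) f" "Comp C h g \<in> Hom C y z"
    using g h Comp_assoc[OF assms _ h] Comp_closed by auto
  then show "Comp C h k \<in> {Comp C g f |g z. g \<in> Hom C y z}" by blast
qed

lemma principal_sieve_self: assumes "f \<in> Hom C x y" shows "f \<in> {Comp C g f | g z. g \<in> Hom C y z}"
proof -
  have "f = Comp C (Ide C y) f" using Ide_Comp[OF assms] by simp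
  then show ?thesis using Ide_closed[OF Hom_Obj(2)[OF assms]] by blast
qed

text \<open>Both halves come from the sieve generated by \<open>f\<close>: an element over
  \<open>x\<close> restricts to a matching family on it, and so does an element over
  \<open>y\<close> on which all pairs equalized by \<open>f\<close> agree.\<close>

lemma shf_if_sheaf:
  fixes F :: "('o, 'a) presheaf"
  assumes sh: "is_sheaf (opposite C) J F"
    and J: "\<And>x S. x \<in> Obj C \<Longrightarrow> is_sieve (opposite C) x S \<Longrightarrow> S \<noteq> {} \<Longrightarrow> S \<in> J x"
  shows "shf F"
proof -
  have F: "psh F" by (rule is_sheaf_psh[OF sh])
  have ex: "\<exists>!a. a \<in> FObj F x \<and> (\<forall>f \<in> S. act F f a = s f)"
    if "x \<in> Obj C" "is_sieve (opposite C) x S" "S \<noteq> {}" "matching_family (opposite C) F S s" for x S s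
    using sh J[OF that(1-3)] that(1,4) by (auto simp: is_sheaf_def act_def)
  have inj: "a = b" if f: "f \<in> Hom C x y" and ab: "a \<in> FObj F x" "b \<in> FObj F x" "act F f a = act F f b" for f x y a b
  proof -
    let ?S = "{Comp C g f | g z. g \<in> Hom C y z}"
    note sv = principal_sieve[OF f]
    have "matching_family (opposite C) F ?S (\<lambda>h. act F h a)"
      unfolding matching_opposite
    proof (intro conjI ballI impI)
      fix h assume "h \<in> ?S"
      then have h: "h \<in> Hom C x (Cod C h)" by (rule sieve_hom[OF sv])
      show "act F h a \<in> FObj F (Cod C h)" by (rule act_closed[OF F h ab(1)])
      fix g assume "g \<in> Arr C" "Dom C g = Cod C h"
      then have "g \<in> Hom C (Cod C h) (Cod C g)" by (simp add: Hom_def)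
      then show "act F g (act F h a) = act F (Comp C g h) a" using act_Comp[OF F h _ ab(1)] by simp
    qed
    note ex[OF Hom_Obj(1)[OF f] sv _ this]
    moreover have "act F h b = act F h a" if "h \<in> ?S" for h
      using that act_Comp[OF F f _ ab(1)] act_Comp[OF F f _ ab(2)] ab(3) by auto
    ultimately show "a = b" using ab principal_sieve_self[OF f] by blast
  qed
  show ?thesis
    unfolding shf_def
  proof (intro conjI F allI ballI impI)
    fix x y f assume f: "f \<in> Hom C x y"
    show "inj_on (act F f) (FObj F x)" using inj[OF f] by (auto simp: inj_on_def)
    fix b assume b: "b \<in> FObj F y"
      and compat: "\<forall>z. \<forall>g\<in>Hom C y z. \<forall>h\<in>Hom C y z. Comp C g f = Comp C h f \<longrightarrow> act F g b = act F h b"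
    let ?S = "{Comp C g f | g z. g \<in> Hom C y z}"
    note sv = principal_sieve[OF f]
    \<comment> \<open>A member \<open>h\<close> of the sieve may factor through \<open>f\<close> in
      several ways. One factorization is chosen, and \<open>compat\<close> makes the value
      independent of the choice.\<close>
    define s where "s h = act F (SOME g. g \<in> Hom C y (Cod C h) \<and> h = Comp C g f) b" for h
    have s: "s (Comp C g f) = act F g b" if g: "g \<in> Hom C y z" for g z
    proof -
      have c: "Cod C (Comp C g f) = z" using Comp_closed[OF f g] by (simp add: Hom_def)
      let ?P = "\<lambda>k. k \<in> Hom C y (Cod C (Comp C g f)) \<and> Comp C g f = Comp C k f"
      have "?P (Eps ?P)" by (rule someI[of ?P g]) (use g c in auto)
      then show ?thesis using compat g unfolding s_def c by metis
    qed
    have "matching_family (opposite C) F ?S s"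
      unfolding matching_opposite
    proof (intro conjI ballI impI)
      fix h assume "h \<in> ?S"
      then obtain g z where g: "g \<in> Hom C y z" "h = Comp C g f" by blast
      then have z: "Cod C h = z" using Comp_closed[OF f g(1)] by (simp add: Hom_def)
      show "s h \<in> FObj F (Cod C h)" using g s act_closed[OF F g(1) b] z by simp
      fix k assume "k \<in> Arr C" "Dom C k = Cod C h"
      then have k: "k \<in> Hom C z (Cod C k)" using z by (simp add: Hom_def)
      show "act F k (s h) = s (Comp C k h)"
        using g s[OF g(1)] s[OF Comp_closed[OF g(1) k]] Comp_assoc[OF f g(1) k] act_Comp[OF F g(1) k b] by simp
    qed
    from ex[OF Hom_Obj(1)[OF f] sv _ this] obtain a where a: "a \<in> FObj F x" "\<forall>h\<in>?S. act F h a = s h"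
      using principal_sieve_self[OF f] by blast
    have "act F f a = s (Comp C (Ide C y) f)" using a principal_sieve_self[OF f] Ide_Comp[OF f] by auto
    also have "\<dots> = b" using s[OF Ide_closed[OF Hom_Obj(2)[OF f]]] act_Ide[OF F Hom_Obj(2)[OF f] b] by simp
    finally show "b \<in> act F f ` FObj F x" using a by blast
  qed
qed

text \<open>A single member \<open>f\<close> of the sieve determines the amalgamation. Its agreement
  with the family at another member \<open>k\<close> is tested after completing \<open>f\<close> and
  \<open>k\<close> to a square, where injectivity cancels the last arrow.\<close>

lemma sheaf_if_shf:
  fixes F :: "('o, 'a) presheaf"
  assumes sh: "shf F" and o: ore
    and J: "\<And>x S. x \<in> Obj C \<Longrightarrow> S \<in> J x \<Longrightarrow> is_sieve (opposite C) x S \<and> S \<noteq> {}"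
  shows "is_sheaf (opposite C) J F"
  unfolding is_sheaf_def
proof (intro conjI ballI allI impI)
  note F = shf_psh[OF sh]
  show "F \<in> Obj (presheaf_category (opposite C))" using F by (simp add: presheaf_category_opposite psh_def)
  fix x S s assume x: "x \<in> Obj (opposite C)" and S: "S \<in> J x" and mf: "matching_family (opposite C) F S s"
  have sv: "is_sieve (opposite C) x S" and "S \<noteq> {}" using J[OF _ S] x by auto
  then obtain f where f: "f \<in> S" by blast
  define y where "y = Cod C f"
  have f': "f \<in> Hom C x y" using sieve_hom[OF sv f] y_def by simp
  have s: "s k \<in> FObj F z" "g \<in> Hom C z w \<Longrightarrow> act F g (s k) = s (Comp C g k)"
    if "k \<in> S" "k \<in> Hom C x z" for g k z w using mf that unfolding matching_opposite by (auto simp: Hom_def)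
  obtain a where a: "a \<in> FObj F x" "act F f a = s f"
    by (rule shf_glue[OF sh f' s(1)[OF f f']]) (use s(2)[OF f f'] in auto)
  have "act F k a = s k" if k: "k \<in> S" for k
  proof -
    define z where "z = Cod C k"
    have k': "k \<in> Hom C x z" using sieve_hom[OF sv k] z_def by simp
    from oreE[OF o f' k'] obtain w g h where gh: "g \<in> Hom C y w" "h \<in> Hom C z w" "Comp C g f = Comp C h k" .
    have "act F h (act F k a) = act F g (act F f a)"
      using act_Comp[OF F f' gh(1) a(1)] act_Comp[OF F k' gh(2) a(1)] gh(3) by simp
    also have "\<dots> = act F h (s k)" using s(2)[OF f f' gh(1)] s(2)[OF k k' gh(2)] gh(3) a(2) by simp
    finally show ?thesis by (rule shf_inj[OF sh gh(2) act_closed[OF F k' a(1)] s(1)[OF k k']])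
  qed
  then show "\<exists>!a. a \<in> FObj F x \<and> (\<forall>f\<in>S. map_fun_of (FArr F f) a = s f)"
    using a f shf_inj[OF sh f'] by (auto simp: act_def intro!: ex1I[of _ a])
qed

lemma is_sheaf_atomic:
  assumes ore
  shows "is_sheaf (opposite C) (atomic_topology (opposite C)) = shf"
proof (intro ext iffI)
  fix F :: "('o, 'a) presheaf"
  note top = atomic_topology_ore[OF assms]
  show "shf F" if "is_sheaf (opposite C) (atomic_topology (opposite C)) F"
    by (rule shf_if_sheaf[OF that]) (simp add: top)
  show "is_sheaf (opposite C) (atomic_topology (opposite C)) F" if "shf F"
    by (rule sheaf_if_shf[OF that assms]) (simp add: top)
qed

end

section \<open>Completing a system of raw elements to a sheaf\<close>

locale atomic_site = category C + universe "TYPE('u)" for C :: "('o, 'u) category" +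
  assumes small_Arr: "small TYPE('u) (Arr C)" and Ore: ore
begin

lemma small_Obj: "sml (Obj C)"
  by (rule small_Obj_if_small_Arr[OF small_Arr])

text \<open>Says that \<open>S\<close> is the sheafification of the quotient of \<open>R\<close> by
  \<open>q\<close>: the map \<open>\<eta>\<close> is natural, has kernel \<open>q\<close> and is
  locally surjective. This form is kept instead of a universal property because it speaks about
  elements; the universal property follows in \<open>completion_extend\<close> and
  \<open>completion_unique\<close>.\<close>

definition completion_of :: "('o \<Rightarrow> 'r set) \<Rightarrow> ('u \<Rightarrow> 'r \<Rightarrow> 'r) \<Rightarrow> ('o \<Rightarrow> 'r \<Rightarrow> 'r \<Rightarrow> bool) \<Rightarrow> ('o, 'u) presheaf \<Rightarrow> ('o \<Rightarrow> 'r \<Rightarrow> 'u) \<Rightarrow> bool" where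
  "completion_of R t q S \<eta> \<longleftrightarrow> shf S \<and> (\<forall>x\<in>Obj C. \<forall>r\<in>R x. \<eta> x r \<in> FObj S x) \<and>
    (\<forall>x y. \<forall>f\<in>Hom C x y. \<forall>r\<in>R x. t f r \<in> R y \<and> \<eta> y (t f r) = act S f (\<eta> x r)) \<and>
    (\<forall>x\<in>Obj C. \<forall>r\<in>R x. \<forall>s\<in>R x. \<eta> x r = \<eta> x s \<longleftrightarrow> q x r s) \<and>
    (\<forall>x\<in>Obj C. \<forall>a\<in>FObj S x. \<exists>y. \<exists>f\<in>Hom C x y. \<exists>r\<in>R y. act S f a = \<eta> y r)"

lemma completion_ofD:
  assumes "completion_of R t q S \<eta>"
  shows "shf S" "x \<in> Obj C \<Longrightarrow> r \<in> R x \<Longrightarrow> \<eta> x r \<in> FObj S x"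
    "f \<in> Hom C x y \<Longrightarrow> r \<in> R x \<Longrightarrow> t f r \<in> R y" "f \<in> Hom C x y \<Longrightarrow> r \<in> R x \<Longrightarrow> \<eta> y (t f r) = act S f (\<eta> x r)"
    "x \<in> Obj C \<Longrightarrow> r \<in> R x \<Longrightarrow> s \<in> R x \<Longrightarrow> \<eta> x r = \<eta> x s \<longleftrightarrow> q x r s"
    "x \<in> Obj C \<Longrightarrow> a \<in> FObj S x \<Longrightarrow> \<exists>y. \<exists>f\<in>Hom C x y. \<exists>r\<in>R y. act S f a = \<eta> y r"
  using assms unfolding completion_of_def by blast+

text \<open>
  The value of the sheaf at \<open>x\<close> consists of the classes of pairs \<open>(f, r)\<close> with \<open>f : x \<rightarrow> y\<close> and \<open>r \<in> R y\<close>
  such that \<open>g f = h f\<close> implies \<open>q (t g r) (t h r)\<close>; these are the matching families on principal sieves.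
\<close>

proposition completion:
  fixes R :: "'o \<Rightarrow> 'r set" and t :: "'u \<Rightarrow> 'r \<Rightarrow> 'r" and q :: "'o \<Rightarrow> 'r \<Rightarrow> 'r \<Rightarrow> bool"
  assumes R_small: "\<And>x. x \<in> Obj C \<Longrightarrow> sml (R x)"
    and t_closed: "\<And>x y f r. f \<in> Hom C x y \<Longrightarrow> r \<in> R x \<Longrightarrow> t f r \<in> R y"
    and t_Ide: "\<And>x r. x \<in> Obj C \<Longrightarrow> r \<in> R x \<Longrightarrow> t (Ide C x) r = r"
    and t_Comp: "\<And>x y z f g r. f \<in> Hom C x y \<Longrightarrow> g \<in> Hom C y z \<Longrightarrow> r \<in> R x \<Longrightarrow> t (Comp C g f) r = t g (t f r)"
    and q_refl: "\<And>x r. x \<in> Obj C \<Longrightarrow> r \<in> R x \<Longrightarrow> q x r r"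
    and q_sym: "\<And>x r s. r \<in> R x \<Longrightarrow> s \<in> R x \<Longrightarrow> q x r s \<Longrightarrow> q x s r"
    and q_trans: "\<And>x r s u. x \<in> Obj C \<Longrightarrow> r \<in> R x \<Longrightarrow> s \<in> R x \<Longrightarrow> u \<in> R x \<Longrightarrow> q x r s \<Longrightarrow> q x s u \<Longrightarrow> q x r u"
    and q_act: "\<And>x y f r s. f \<in> Hom C x y \<Longrightarrow> r \<in> R x \<Longrightarrow> s \<in> R x \<Longrightarrow> q x r s \<Longrightarrow> q y (t f r) (t f s)"
    and q_sat: "\<And>x y f r s. f \<in> Hom C x y \<Longrightarrow> r \<in> R x \<Longrightarrow> s \<in> R x \<Longrightarrow> q y (t f r) (t f s) \<Longrightarrow> q x r s"
  obtains S :: "('o, 'u) presheaf" and \<eta> :: "'o \<Rightarrow> 'r \<Rightarrow> 'u" where "completion_of R t q S \<eta>"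
proof -
  define P where "P x = {(f, r). \<exists>y. f \<in> Hom C x y \<and> r \<in> R y \<and>
    (\<forall>z. \<forall>g\<in>Hom C y z. \<forall>h\<in>Hom C y z. Comp C g f = Comp C h f \<longrightarrow> q z (t g r) (t h r))}" for x
  \<comment> \<open>Sections defined on the sieves of \<open>f\<close> and \<open>f'\<close> are
    identified when they agree modulo \<open>q\<close> on some common refinement.\<close>
  define Q where "Q x = (\<lambda>(f, r) (f', r'). \<exists>y y' z. \<exists>g\<in>Hom C y z. \<exists>g'\<in>Hom C y' z. f \<in> Hom C x y \<and> f' \<in> Hom C x y' \<and> r \<in> R y \<and> r' \<in> R y' \<and>
    Comp C g f = Comp C g' f' \<and> q z (t g r) (t g' r'))" for x
  have P_D: "f \<in> Hom C x (Cod C f)" "r \<in> R (Cod C f)" 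
    "g \<in> Hom C (Cod C f) z \<Longrightarrow> h \<in> Hom C (Cod C f) z \<Longrightarrow> Comp C g f = Comp C h f \<Longrightarrow> q z (t g r) (t h r)"
    if "(f, r) \<in> P x" for x f r g h z
  proof -
    obtain y where y: "f \<in> Hom C x y" "r \<in> R y"
      "\<forall>z. \<forall>g\<in>Hom C y z. \<forall>h\<in>Hom C y z. Comp C g f = Comp C h f \<longrightarrow> q z (t g r) (t h r)"
      using \<open>(f, r) \<in> P x\<close> unfolding P_def by auto
    have "Cod C f = y" using HomD(3)[OF y(1)] .
    with y show "f \<in> Hom C x (Cod C f)" "r \<in> R (Cod C f)" 
      "g \<in> Hom C (Cod C f) z \<Longrightarrow> h \<in> Hom C (Cod C f) z \<Longrightarrow> Comp C g f = Comp C h f \<Longrightarrow> q z (t g r) (t h r)"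
      by auto
  qed
  have QI: "Q x (f, r) (f', r')" if "f \<in> Hom C x y" "f' \<in> Hom C x y'" "r \<in> R y" "r' \<in> R y'" "g \<in> Hom C y z" "g' \<in> Hom C y' z"
    "Comp C g f = Comp C g' f'" "q z (t g r) (t g' r')" for x y z f r y' f' r' g g'
    using that unfolding Q_def by blast
  have QE: thesis if "Q x (f, r) (f', r')" "\<And>y y' z g g'. f \<in> Hom C x y \<Longrightarrow> f' \<in> Hom C x y' \<Longrightarrow> r \<in> R y \<Longrightarrow> r' \<in> R y' \<Longrightarrow> g \<in> Hom C y z \<Longrightarrow>
     g' \<in> Hom C y' z \<Longrightarrow> Comp C g f = Comp C g' f' \<Longrightarrow> q z (t g r) (t g' r') \<Longrightarrow> thesis" for x f r f' r' thesis
    using that unfolding Q_def by blast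
  have QE2: thesis if "Q x (f, r) (f', r')" "f \<in> Hom C x y" "f' \<in> Hom C x y'" "\<And>z g g'. g \<in> Hom C y z \<Longrightarrow>
     g' \<in> Hom C y' z \<Longrightarrow> Comp C g f = Comp C g' f' \<Longrightarrow> q z (t g r) (t g' r') \<Longrightarrow> thesis" for x y y' f r f' r' thesis
    using that(1)
  proof (rule QE)
    fix w w' z g g' assume *: "f \<in> Hom C x w" "f' \<in> Hom C x w'" "g \<in> Hom C w z" "g' \<in> Hom C w' z"
      "Comp C g f = Comp C g' f'" "q z (t g r) (t g' r')"
    have "w = y" "w' = y'" using *(1,2) that(2,3) by (simp_all add: Hom_def)
    then show thesis using that(4)[of g z g'] * by simp
  qed
  have Q_sym: "Q x p' p" if "Q x p p'" for x p p'
  proof -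
    obtain f r f' r' where p: "p = (f, r)" "p' = (f', r')" by fastforce
    from that show ?thesis unfolding p
    proof (rule QE)
      fix y y' z g g'
      assume *: "f \<in> Hom C x y" "f' \<in> Hom C x y'" "r \<in> R y" "r' \<in> R y'" "g \<in> Hom C y z" "g' \<in> Hom C y' z"
        "Comp C g f = Comp C g' f'" "q z (t g r) (t g' r')"
      show "Q x (f', r') (f, r)"
        by (rule QI[OF *(2,1,4,3,6,5) *(7)[symmetric] q_sym[OF t_closed[OF *(5,3)] t_closed[OF *(6,4)] *(8)]])
    qed
  qed
  have Q_trans: "Q x p p''" if "Q x p p'" "Q x p' p''" for x p p' p''
  proof -
    obtain f r f' r' f'' r'' where p: "p = (f, r)" "p' = (f', r')" "p'' = (f'', r'')" by (metis surj_pair)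
    from that(1) obtain y y' z g g' where 1: "f \<in> Hom C x y" "f' \<in> Hom C x y'" "r \<in> R y" "r' \<in> R y'" "g \<in> Hom C y z"
     "g' \<in> Hom C y' z" "Comp C g f = Comp C g' f'" "q z (t g r) (t g' r')" unfolding p by (elim QE)
    from that(2) obtain w y'' v h h' where 2: "f' \<in> Hom C x w" "f'' \<in> Hom C x y''" "r' \<in> R w" "r'' \<in> R y''" "h \<in> Hom C w v"
     "h' \<in> Hom C y'' v" "Comp C h f' = Comp C h' f''" "q v (t h r') (t h' r'')" unfolding p by (elim QE)
    have [simp]: "w = y'" using 1(2) 2(1) by (simp add: Hom_def)
    note 2 = 2[unfolded this]
    \<comment> \<open>The middle arrow \<open>f'\<close> is refined by \<open>g'\<close> on one side
      and by \<open>h\<close> on the other. Completing this span gives a refinement on which all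
      three sections are compared.\<close>
    from oreE[OF Ore 1(6) 2(5)] obtain u a b where ab: "a \<in> Hom C z u" "b \<in> Hom C v u" "Comp C a g' = Comp C b h" .
    have e: "Comp C (Comp C a g) f = Comp C (Comp C b h') f''"
      using Comp_assoc[OF 1(1,5) ab(1)] Comp_assoc[OF 1(2,6) ab(1)] Comp_assoc[OF 2(1,5) ab(2)] Comp_assoc[OF 2(2,6) ab(2)]
        1(7) 2(7) ab(3) by simp
    have "q u (t a (t g r)) (t a (t g' r'))" using q_act[OF ab(1) _ _ 1(8)] 1 t_closed by blast
    moreover have "t a (t g' r') = t b (t h r')"
      using t_Comp[OF 1(6) ab(1) 1(4)] t_Comp[OF 2(5) ab(2) 2(3)] ab(3) by simp
    moreover have "q u (t b (t h r')) (t b (t h' r''))" using q_act[OF ab(2) _ _ 2(8)] 2 t_closed by blast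
    moreover have "t a (t g r) \<in> R u" "t b (t h r') \<in> R u" "t b (t h' r'') \<in> R u" using 1 2 ab t_closed by blast+
    ultimately have "q u (t a (t g r)) (t b (t h' r''))" using q_trans[OF Hom_Obj(2)[OF ab(1)]] by metis
    then have "q u (t (Comp C a g) r) (t (Comp C b h') r'')"
      using t_Comp[OF 1(5) ab(1) 1(3)] t_Comp[OF 2(6) ab(2) 2(4)] by simp
    then show ?thesis unfolding p
      by (rule QI[OF 1(1) 2(2) 1(3) 2(4) Comp_closed[OF 1(5) ab(1)] Comp_closed[OF 2(6) ab(2)] e])
  qed
  have Q_same: "Q x (f, r) (f, r)" if "f \<in> Hom C x y" "r \<in> R y" for x f r y
    using that Hom_Obj Ide_closed t_closed q_refl by (intro QI[of f x y f y r r "Ide C y" y "Ide C y"]) blast+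
  have P_small: "sml (P x)" if "x \<in> Obj C" for x
  proof -
    have "P x \<subseteq> (SIGMA f : Arr C. R (Cod C f))" unfolding P_def by (auto simp: Hom_def)
    then show ?thesis by (rule small_subset[OF _ small_Sigma[OF small_Arr]]) (auto intro: R_small Cod_closed)
  qed
  \<comment> \<open>The values of the sheaf must lie in \<open>'u\<close>, whereas the sections are
    pairs of another type; \<open>e x\<close> codes them.\<close>
  define e where "e x = (SOME e :: 'u \<times> 'r \<Rightarrow> 'u. inj_on e (P x))" for x
  have e: "inj_on (e x) (P x)" if "x \<in> Obj C" for x
    unfolding e_def by (rule small_embed[OF P_small[OF that]]) (rule someI[where P = "\<lambda>e. inj_on e (P x)"])
  \<comment> \<open>A class is named by the code of a representative. Equivalent sections have the
    same candidates, so \<open>SOME\<close> picks the same representative for both.\<close>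
  define k where "k x p = e x (SOME p'. p' \<in> P x \<and> Q x p p')" for x p
  have Q_self: "Q x p p" if "p \<in> P x" for p x
    using that Q_same[OF P_D(1,2)] by (cases p) auto
  have k_iff: "k x p = k x p' \<longleftrightarrow> Q x p p'" if x: "x \<in> Obj C" and p: "p \<in> P x" "p' \<in> P x" for x p p'
  proof
    have s: "(SOME p'. p' \<in> P x \<and> Q x p p') \<in> P x \<and> Q x p (SOME p'. p' \<in> P x \<and> Q x p p')" if "p \<in> P x" for p
      by (rule someI[of _ p]) (use Q_self that in auto)
    show "Q x p p'" if "k x p = k x p'"
    proof -
      have "(SOME p''. p'' \<in> P x \<and> Q x p p'') = (SOME p''. p'' \<in> P x \<and> Q x p' p'')"
        using that inj_onD[OF e[OF x]] s[OF p(1)] s[OF p(2)] unfolding k_def by blast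
      then show ?thesis using s[OF p(1)] s[OF p(2)] Q_sym Q_trans by metis
    qed
    show "k x p = k x p'" if "Q x p p'"
    proof -
      have "(\<lambda>p''. p'' \<in> P x \<and> Q x p p'') = (\<lambda>p''. p'' \<in> P x \<and> Q x p' p'')"
        using that Q_sym Q_trans by metis
      then show ?thesis unfolding k_def by simp
    qed
  qed
  \<comment> \<open>\<open>p'\<close> is a restriction of \<open>p\<close> along \<open>u\<close>.
    This is only a relation, because moving a section from \<open>x\<close> to \<open>x'\<close>
    requires the choice of an Ore square; \<open>G_ex\<close> and \<open>G_fun\<close> show that it
    is a function on classes.\<close>
  define G where "G x u p p' = (Q x p (Comp C (fst p') u, snd p'))" for x u p and p' :: "'u \<times> 'r"
  have G_ex: "\<exists>p'\<in>P x'. G x u p p'" if u: "u \<in> Hom C x x'" and p: "p \<in> P x" for x x' u p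
  proof -
    obtain f r where pp: "p = (f, r)" by fastforce
    note p = p[unfolded pp]
    define y where "y = Cod C f"
    note fr = P_D(1,2)[OF p, folded y_def]
    from oreE[OF Ore u fr(1)] obtain z w v where wv: "w \<in> Hom C x' z" "v \<in> Hom C y z" "Comp C w u = Comp C v f" .
    have "q d (t g (t v r)) (t h (t v r))" if g: "g \<in> Hom C z d" and h: "h \<in> Hom C z d" and eq: "Comp C g w = Comp C h w" for g h d
    proof -
      have "Comp C (Comp C g v) f = Comp C (Comp C h v) f"
        using Comp_assoc[OF u wv(1) g] Comp_assoc[OF u wv(1) h] Comp_assoc[OF fr(1) wv(2) g] Comp_assoc[OF fr(1) wv(2) h] eq wv(3) by simp
      then show ?thesis
        using P_D(3)[OF p, folded y_def, OF Comp_closed[OF wv(2) g] Comp_closed[OF wv(2) h]] t_Comp[OF wv(2) _ fr(2)] g h by simp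
    qed
    then have "(w, t v r) \<in> P x'" unfolding P_def using wv t_closed[OF wv(2) fr(2)] by blast
    moreover have "Comp C v f = Comp C (Ide C z) (Comp C w u)" using Ide_Comp[OF Comp_closed[OF u wv(1)]] wv(3) by simp
    then have "G x u p (w, t v r)" unfolding G_def pp fst_conv snd_conv
      using t_closed[OF wv(2) fr(2)] t_Ide q_refl Hom_Obj(2)[OF wv(1)]
      by (intro QI[OF fr(1) Comp_closed[OF u wv(1)] fr(2) _ wv(2) Ide_closed]) auto
    ultimately show ?thesis by blast
  qed
  have G_fun: "Q x' p' p2'" if u: "u \<in> Hom C x x'" and p: "p \<in> P x" "p2 \<in> P x" "Q x p p2" and p': "p' \<in> P x'" "p2' \<in> P x'"
    and G: "G x u p p'" "G x u p2 p2'" for x x' u p p2 p' p2'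
  proof -
    obtain f r w s w2 s2 where pp: "p = (f, r)" "p' = (w, s)" "p2' = (w2, s2)" by (metis surj_pair)
    have Q1: "Q x (f, r) (Comp C w u, s)" and Q2: "Q x (f, r) (Comp C w2 u, s2)"
      using G(1) Q_trans[OF p(3) G(2)[unfolded G_def]] unfolding G_def pp by simp_all
    define y where "y = Cod C f"
    note fr = P_D(1,2)[OF p(1)[unfolded pp], folded y_def]
    define y' where "y' = Cod C w"
    note ws = P_D(1,2)[OF p'(1)[unfolded pp], folded y'_def]
    define y2 where "y2 = Cod C w2"
    note ws2 = P_D(1,2)[OF p'(2)[unfolded pp], folded y2_def]
    note wu = Comp_closed[OF u ws(1)] note wu2 = Comp_closed[OF u ws2(1)]
    obtain z g g' where 1: "g \<in> Hom C y z" "g' \<in> Hom C y' z" "Comp C g f = Comp C g' (Comp C w u)" "q z (t g r) (t g' s)"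
      by (rule QE2[OF Q1 fr(1) wu])
    obtain v h h' where 2: "h \<in> Hom C y v" "h' \<in> Hom C y2 v" "Comp C h f = Comp C h' (Comp C w2 u)" "q v (t h r) (t h' s2)"
      by (rule QE2[OF Q2 fr(1) wu2])
    \<comment> \<open>The square is formed under \<open>x'\<close>. Precomposed with
      \<open>u\<close> it gives \<open>a g\<close> and \<open>b h\<close> the same composite with
      \<open>f\<close>, and the condition defining \<open>P x\<close> then compares the two
      refinements of \<open>r\<close>.\<close>
    from oreE[OF Ore Comp_closed[OF ws(1) 1(2)] Comp_closed[OF ws2(1) 2(2)]] obtain d a b
      where ab: "a \<in> Hom C z d" "b \<in> Hom C v d" "Comp C a (Comp C g' w) = Comp C b (Comp C h' w2)" .
    have "Comp C (Comp C a g) f = Comp C (Comp C b h) f"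
      using Comp_assoc[OF fr(1) 1(1) ab(1)] Comp_assoc[OF fr(1) 2(1) ab(2)] 1(3) 2(3) Comp_assoc[OF u ws(1) 1(2)] Comp_assoc[OF u ws2(1) 2(2)]
       Comp_assoc[OF u Comp_closed[OF ws(1) 1(2)] ab(1)] Comp_assoc[OF u Comp_closed[OF ws2(1) 2(2)] ab(2)] ab(3) by simp
    then have "q d (t (Comp C a g) r) (t (Comp C b h) r)"
      using P_D(3)[OF p(1)[unfolded pp], folded y_def, OF Comp_closed[OF 1(1) ab(1)] Comp_closed[OF 2(1) ab(2)]] by simp
    then have "q d (t a (t g r)) (t b (t h r))" using t_Comp[OF 1(1) ab(1) fr(2)] t_Comp[OF 2(1) ab(2) fr(2)] by simp
    moreover have "q d (t a (t g r)) (t a (t g' s))" using q_act[OF ab(1) _ _ 1(4)] 1 fr ws t_closed by blast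
    moreover have "q d (t b (t h r)) (t b (t h' s2))" using q_act[OF ab(2) _ _ 2(4)] 2 fr ws2 t_closed by blast
    moreover have m: "t a (t g r) \<in> R d" "t a (t g' s) \<in> R d" "t b (t h r) \<in> R d" "t b (t h' s2) \<in> R d" using 1 2 fr ws ws2 ab t_closed by blast+
    ultimately have "q d (t a (t g' s)) (t b (t h' s2))" by (meson q_sym q_trans[OF Hom_Obj(2)[OF ab(1)]])
    then have "q d (t (Comp C a g') s) (t (Comp C b h') s2)"
      using t_Comp[OF 1(2) ab(1) ws(2)] t_Comp[OF 2(2) ab(2) ws2(2)] by simp
    moreover have "Comp C (Comp C a g') w = Comp C (Comp C b h') w2"
      using Comp_assoc[OF ws(1) 1(2) ab(1)] Comp_assoc[OF ws2(1) 2(2) ab(2)] ab(3) by simp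
    ultimately show ?thesis unfolding pp
      by (intro QI[OF ws(1) ws2(1) ws(2) ws2(2) Comp_closed[OF 1(2) ab(1)] Comp_closed[OF 2(2) ab(2)]])
  qed
  \<comment> \<open>Only the code \<open>c\<close> of a class is given, so a section with this code
    and one of its restrictions are chosen; by \<open>G_fun\<close> the code of the result does not
    depend on them.\<close>
  define T where "T u c = k (Cod C u) (SOME p'. p' \<in> P (Cod C u) \<and> (\<exists>p\<in>P (Dom C u). k (Dom C u) p = c \<and> G (Dom C u) u p p'))" for u c
  have T: "T u (k x p) = k x' p'" if u: "u \<in> Hom C x x'" and p: "p \<in> P x" and p': "p' \<in> P x'" and G: "G x u p p'" for u x x' p p'
  proof -
    have D: "Dom C u = x" "Cod C u = x'" using u by (auto simp: Hom_def)
    let ?A = "\<lambda>p'. p' \<in> P x' \<and> (\<exists>p1\<in>P x. k x p1 = k x p \<and> G x u p1 p')"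
    have A: "?A (Eps ?A)" by (rule someI[of _ p']) (use p p' G in auto)
    then obtain p1 where p1: "p1 \<in> P x" "k x p1 = k x p" "G x u p1 (Eps ?A)" by blast
    have "Q x p1 p" using p1 p k_iff[OF Hom_Obj(1)[OF u]] by simp
    then have "Q x' (Eps ?A) p'" using G_fun[OF u p1(1) p _ _ p' p1(3) G] A by blast
    then show ?thesis unfolding T_def D using k_iff[OF Hom_Obj(2)[OF u] _ p'] A by simp
  qed
  define S where "S = mk_psh (\<lambda>x. k x ` P x) T"
  have T_closed: "T u c \<in> k x' ` P x'" if "u \<in> Hom C x x'" "c \<in> k x ` P x" for u x x' c
  proof -
    from that(2) obtain p where p: "p \<in> P x" "c = k x p" by blast
    from G_ex[OF that(1) p(1)] obtain p' where p': "p' \<in> P x'" "G x u p p'" by blast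
    show ?thesis using T[OF that(1) p(1) p'] p(2) p'(1) by blast
  qed
  have Spsh: "psh S"
    unfolding S_def
  proof (rule psh_mk_psh)
    show "T (Ide C x) c = c" if x: "x \<in> Obj C" and c: "c \<in> k x ` P x" for x c
    proof -
      from c obtain p where p: "p \<in> P x" "c = k x p" by blast
      have "G x (Ide C x) p p" using Q_self[OF p(1)] Comp_Ide[OF P_D(1)[of "fst p" "snd p" x]] p(1) unfolding G_def by simp
      then show ?thesis using T[OF Ide_closed[OF x] p(1) p(1)] p(2) by simp
    qed
    show "T (Comp C v u) c = T v (T u c)" if u: "u \<in> Hom C x y" and v: "v \<in> Hom C y z" and c: "c \<in> k x ` P x" for u v x y z c
    proof -
      from c obtain p where p: "p \<in> P x" "c = k x p" by blast
      from G_ex[OF u p(1)] obtain p' where p': "p' \<in> P y" "G x u p p'" by blast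
      from G_ex[OF v p'(1)] obtain p'' where p'': "p'' \<in> P z" "G y v p' p''" by blast
      obtain f' r' f'' r'' where pp: "p' = (f', r')" "p'' = (f'', r'')" by fastforce
      define w where "w = Cod C f'"
      note fr' = P_D(1,2)[OF p'(1)[unfolded pp], folded w_def]
      define w2 where "w2 = Cod C f''"
      note fr'' = P_D(1,2)[OF p''(1)[unfolded pp], folded w2_def]
      have Q1: "Q y (f', r') (Comp C f'' v, r'')" using p''(2) unfolding G_def pp by simp
      obtain d g h where gh: "g \<in> Hom C w d" "h \<in> Hom C w2 d" "Comp C g f' = Comp C h (Comp C f'' v)" "q d (t g r') (t h r'')"
        by (rule QE2[OF Q1 fr'(1) Comp_closed[OF v fr''(1)]])
      have "Comp C g (Comp C f' u) = Comp C h (Comp C (Comp C f'' v) u)"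
        using gh(3) Comp_assoc[OF u fr'(1) gh(1)] Comp_assoc[OF u Comp_closed[OF v fr''(1)] gh(2)] by simp
      then have "Q x (Comp C f' u, r') (Comp C (Comp C f'' v) u, r'')"
        by (intro QI[OF Comp_closed[OF u fr'(1)] Comp_closed[OF u Comp_closed[OF v fr''(1)]] fr'(2) fr''(2) gh(1,2)] gh(4))
      then have "G x (Comp C v u) p p''" using Q_trans p'(2) Comp_assoc[OF u v fr''(1)] unfolding G_def pp by simp
      then show ?thesis using T[OF Comp_closed[OF u v] p(1) p''(1)] T[OF u p(1) p'] T[OF v p'(1) p''] p(2) by simp
    qed
  qed (use small_image[OF P_small] T_closed in blast)+
  have S_Obj: "FObj S x = k x ` P x" if "x \<in> Obj C" for x using that by (simp add: S_def)
  have S_act: "act S u c = T u c" if "u \<in> Hom C x x'" "c \<in> k x ` P x" for u c x x'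
    unfolding S_def using that by (intro act_mk_psh) auto
  define \<eta> where "\<eta> x r = k x (Ide C x, r)" for x r
  have \<eta>P: "(Ide C x, r) \<in> P x" if x: "x \<in> Obj C" and r: "r \<in> R x" for x r
  proof -
    have "q z (t g r) (t h r)" if "g \<in> Hom C x z" "h \<in> Hom C x z" "Comp C g (Ide C x) = Comp C h (Ide C x)" for g h z
      using that Comp_Ide q_refl[OF Hom_Obj(2)[OF that(1)] t_closed[OF that(1) r]] by simp
    then show ?thesis unfolding P_def using Ide_closed[OF x] r by blast
  qed
  \<comment> \<open>Restricted along its own arrow \<open>f\<close>, the section
    \<open>(f, r)\<close> becomes the raw element \<open>r\<close>. Local surjectivity of
    \<open>\<eta>\<close> rests on this.\<close>
  have \<eta>_act: "T f (k x (f, r)) = \<eta> y r" if f: "f \<in> Hom C x y" and p: "(f, r) \<in> P x" for f x y r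
  proof -
    have r: "r \<in> R y" using P_D(2)[OF p] f by (simp add: Hom_def)
    have "G x f (f, r) (Ide C y, r)" unfolding G_def using Q_same[OF f r] Ide_Comp[OF f] by simp
    then show ?thesis unfolding \<eta>_def by (intro T[OF f p \<eta>P[OF Hom_Obj(2)[OF f] r]])
  qed
  have \<eta>_nat: "\<eta> y (t f r) = T f (\<eta> x r)" if f: "f \<in> Hom C x y" and r: "r \<in> R x" for f x y r
  proof -
    note x = Hom_Obj(1)[OF f] note y = Hom_Obj(2)[OF f]
    note tr = t_closed[OF f r]
    have "G x f (Ide C x, r) (Ide C y, t f r)" unfolding G_def fst_conv snd_conv Ide_Comp[OF f]
      using Comp_Ide[OF f] Ide_Comp[OF f] t_Ide[OF y tr] q_refl[OF y tr]
      by (intro QI[OF Ide_closed[OF x] f r tr f Ide_closed[OF y]]) auto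
    from T[OF f \<eta>P[OF x r] \<eta>P[OF y tr] this] show ?thesis unfolding \<eta>_def by simp
  qed
  have \<eta>_iff: "\<eta> x r = \<eta> x s \<longleftrightarrow> q x r s" if x: "x \<in> Obj C" and rs: "r \<in> R x" "s \<in> R x" for x r s
  proof -
    \<comment> \<open>Refinements \<open>g\<close> and \<open>g'\<close> of the identity that agree
      after it are equal, so \<open>Q\<close> compares \<open>t g r\<close> with
      \<open>t g s\<close> for a single \<open>g\<close>, and \<open>q_sat\<close> brings this back
      to \<open>x\<close>.\<close>
    have "Q x (Ide C x, r) (Ide C x, s) \<longleftrightarrow> q x r s"
    proof
      assume "Q x (Ide C x, r) (Ide C x, s)"
      then obtain z g g' where g: "g \<in> Hom C x z" "g' \<in> Hom C x z" "Comp C g (Ide C x) = Comp C g' (Ide C x)" "q z (t g r) (t g' s)"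
        by (rule QE2[OF _ Ide_closed[OF x] Ide_closed[OF x]])
      then have "g = g'" using Comp_Ide by metis
      then show "q x r s" using q_sat g rs by blast
    next
      assume "q x r s"
      then show "Q x (Ide C x, r) (Ide C x, s)"
        using t_Ide x rs Ide_closed[OF x] by (intro QI[of "Ide C x" x x "Ide C x" x r s "Ide C x" x "Ide C x"]) auto
    qed
    then show ?thesis unfolding \<eta>_def using k_iff[OF x \<eta>P[OF x rs(1)] \<eta>P[OF x rs(2)]] by simp
  qed
  have \<eta>_S: "\<eta> x r \<in> k x ` P x" if "x \<in> Obj C" "r \<in> R x" for x r
    unfolding \<eta>_def using \<eta>P[OF that] by blast
  have "shf S"
    unfolding shf_def
  proof (intro conjI Spsh allI ballI impI)
    fix x y u assume u: "u \<in> Hom C x y"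
    note x = Hom_Obj(1)[OF u] note y = Hom_Obj(2)[OF u]
    show "inj_on (act S u) (FObj S x)"
      unfolding S_Obj[OF x]
    proof (rule inj_onI)
      fix c d assume cd: "c \<in> k x ` P x" "d \<in> k x ` P x" "act S u c = act S u d"
      then obtain p r where p: "p \<in> P x" "c = k x p" "r \<in> P x" "d = k x r" by blast
      obtain p' where p': "p' \<in> P y" "G x u p p'" using G_ex[OF u p(1)] by blast
      obtain r' where r': "r' \<in> P y" "G x u r r'" using G_ex[OF u p(3)] by blast
      have "k y p' = k y r'" using cd S_act[OF u] p T[OF u p(1) p'] T[OF u p(3) r'] by simp
      then have Q1: "Q y p' r'" using k_iff[OF y p'(1) r'(1)] by simp
      obtain f1 r1 f2 r2 where pp: "p' = (f1, r1)" "r' = (f2, r2)" by fastforce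
      define w where "w = Cod C f1"
      note f1 = P_D(1,2)[OF p'(1)[unfolded pp], folded w_def]
      define w2 where "w2 = Cod C f2"
      note f2 = P_D(1,2)[OF r'(1)[unfolded pp], folded w2_def]
      obtain z g h where gh: "g \<in> Hom C w z" "h \<in> Hom C w2 z" "Comp C g f1 = Comp C h f2" "q z (t g r1) (t h r2)"
        by (rule QE2[OF Q1[unfolded pp] f1(1) f2(1)])
      have "Comp C g (Comp C f1 u) = Comp C h (Comp C f2 u)"
        using gh(3) Comp_assoc[OF u f1(1) gh(1)] Comp_assoc[OF u f2(1) gh(2)] by simp
      then have "Q x (Comp C f1 u, r1) (Comp C f2 u, r2)"
        by (intro QI[OF Comp_closed[OF u f1(1)] Comp_closed[OF u f2(1)] f1(2) f2(2) gh(1,2)] gh(4))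
      then have "Q x p r" using p'(2) r'(2) Q_trans Q_sym unfolding G_def pp fst_conv snd_conv by meson
      then show "c = d" using p k_iff[OF x p(1,3)] by simp
    qed
    fix c assume c: "c \<in> FObj S y" and compat: "\<forall>z. \<forall>g\<in>Hom C y z. \<forall>h\<in>Hom C y z. Comp C g u = Comp C h u \<longrightarrow> act S g c = act S h c"
    then obtain w r where wr: "(w, r) \<in> P y" "c = k y (w, r)" using S_Obj[OF y] by auto
    define v where "v = Cod C w"
    note w = P_D(1,2)[OF wr(1), folded v_def]
    note v = Hom_Obj(2)[OF w(1)]
    have cP: "c \<in> k y ` P y" using c S_Obj[OF y] by simp
    have ext: "act S (Comp C g w) c = \<eta> z (t g r)" if g: "g \<in> Hom C v z" for g z
    proof -
      have "act S (Comp C g w) c = act S g (act S w c)" using act_Comp[OF Spsh w(1) g c] .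
      also have "act S w c = \<eta> v r" using S_act[OF w(1) cP] \<eta>_act[OF w(1) wr(1)] wr(2) by simp
      also have "act S g (\<eta> v r) = \<eta> z (t g r)" using S_act[OF g \<eta>_S[OF v w(2)]] \<eta>_nat[OF g w(2)] by simp
      finally show ?thesis .
    qed
    \<comment> \<open>Compatibility of \<open>c\<close> says exactly that \<open>r\<close> is still
      a section on the sieve of the longer arrow \<open>Comp C w u\<close>. The class of that
      section over \<open>x\<close> is the amalgamation.\<close>
    have "q z (t g r) (t h r)" if g: "g \<in> Hom C v z" and h: "h \<in> Hom C v z" and eq: "Comp C g (Comp C w u) = Comp C h (Comp C w u)" for g h z
    proof -
      have "act S (Comp C g w) c = act S (Comp C h w) c"
        using compat Comp_closed[OF w(1) g] Comp_closed[OF w(1) h] Comp_assoc[OF u w(1) g] Comp_assoc[OF u w(1) h] eq by metis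
      then show ?thesis using ext[OF g] ext[OF h] \<eta>_iff[OF Hom_Obj(2)[OF g] t_closed[OF g w(2)] t_closed[OF h w(2)]] by simp
    qed
    then have wu: "(Comp C w u, r) \<in> P x" unfolding P_def using Comp_closed[OF u w(1)] w(2) by blast
    have "G x u (Comp C w u, r) (w, r)" unfolding G_def using Q_self[OF wu] by simp
    then have "T u (k x (Comp C w u, r)) = c" using T[OF u wu wr(1)] wr(2) by simp
    then have "act S u (k x (Comp C w u, r)) = c" using S_act[OF u] wu by auto
    then show "c \<in> act S u ` FObj S x" using wu S_Obj[OF x] by blast
  qed
  moreover have "\<exists>y. \<exists>f\<in>Hom C x y. \<exists>r\<in>R y. act S f a = \<eta> y r" if x: "x \<in> Obj C" and a: "a \<in> FObj S x" for x a
  proof -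
    have a': "a \<in> k x ` P x" using a S_Obj[OF x] by simp
    then obtain f r where fr: "(f, r) \<in> P x" "a = k x (f, r)" by auto
    note f = P_D(1,2)[OF fr(1)]
    have "act S f a = \<eta> (Cod C f) r" using S_act[OF f(1) a'] \<eta>_act[OF f(1) fr(1)] fr(2) by simp
    then show ?thesis using f by blast
  qed
  moreover have "\<eta> y (t f r) = act S f (\<eta> x r)" if f: "f \<in> Hom C x y" and r: "r \<in> R x" for x y f r
    using \<eta>_nat[OF f r] S_act[OF f \<eta>_S[OF Hom_Obj(1)[OF f] r]] by simp
  ultimately show thesis
    using that[of S \<eta>] \<eta>_S \<eta>_iff S_Obj t_closed unfolding completion_of_def by auto
qed

end

section \<open>Sheafification of representable presheaves\<close>

lemma Obj_full_subcategory [simp]: "x \<in> Obj (full_subcategory K P) \<longleftrightarrow> x \<in> Obj K \<and> P x"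
  by (simp add: full_subcategory_def)

lemma Comp_full_subcategory [simp]: "Comp (full_subcategory K P) = Comp K"
  by (simp add: full_subcategory_def)

lemma Ide_full_subcategory [simp]: "Ide (full_subcategory K P) = Ide K"
  by (simp add: full_subcategory_def)

lemma Hom_full_subcategory: "m \<in> Hom (full_subcategory K P) x y \<longleftrightarrow> m \<in> Hom K x y \<and> P x \<and> P y"
  by (auto simp: full_subcategory_def Hom_def)

lemma category_full_subcategory: assumes "category K" shows "category (full_subcategory K P)"
proof -
  interpret category K by fact
  show ?thesis
  proof
    show "\<And>f. f \<in> Arr (full_subcategory K P) \<Longrightarrow> Dom (full_subcategory K P) f \<in> Obj (full_subcategory K P)"
      "\<And>f. f \<in> Arr (full_subcategory K P) \<Longrightarrow> Cod (full_subcategory K P) f \<in> Obj (full_subcategory K P)"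
      by (auto simp: full_subcategory_def Dom_closed Cod_closed)
  qed (auto simp: Hom_full_subcategory Ide_closed Comp_closed Comp_Ide Ide_Comp Comp_assoc)
qed

text \<open>Used while the Ore condition is still open and the covering sieves have no explicit
  description. The axioms pass to intersections, and the family of all sieves is one of the
  topologies intersected, so that members are sieves.\<close>

lemma generated_topology_is_topology:
  assumes "category C" and "\<And>x. x \<in> Obj C \<Longrightarrow> K x \<subseteq> {S. is_sieve (opposite C) x S}"
  shows "grothendieck_topology (opposite C) (generated_topology (opposite C) K)"
proof -
  interpret category C by fact
  let ?all = "\<lambda>x. {S. is_sieve (opposite C) x S}"
  have all: "grothendieck_topology (opposite C) ?all"
    unfolding grothendieck_topology_def
  proof (intro conjI ballI allI impI)
    fix x assume x: "x \<in> Obj (opposite C)"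
    have "is_sieve (opposite C) x {f \<in> Arr C. Dom C f = x}"
      unfolding is_sieve_opposite using Comp_closed by (auto simp: Hom_def)
    then show "{f \<in> Arr (opposite C). Cod (opposite C) f = x} \<in> ?all x" by auto
  next
    fix f S assume f: "f \<in> Arr (opposite C)" and S: "S \<in> ?all (Cod (opposite C) f)"
    have "f \<in> Hom C (Dom C f) (Cod C f)" using f by (simp add: HomI)
    then show "pullback_sieve (opposite C) f S \<in> ?all (Dom (opposite C) f)"
      using is_sieve_pullback S by simp
  qed auto
  let ?T = "{J. grothendieck_topology (opposite C) J \<and> (\<forall>y \<in> Obj (opposite C). K y \<subseteq> J y)}"
  have allT: "?all \<in> ?T" using all assms(2) by auto
  have mem: "S \<in> generated_topology (opposite C) K x \<longleftrightarrow> (\<forall>J\<in>?T. S \<in> J x)" for S x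
    unfolding generated_topology_def by blast
  show ?thesis
    unfolding grothendieck_topology_def Ball_def[of "generated_topology (opposite C) K _"]
    unfolding mem
  proof (intro conjI ballI allI impI)
    fix x S assume "x \<in> Obj (opposite C)" and S: "\<forall>J\<in>?T. S \<in> J x"
    show "is_sieve (opposite C) x S" using bspec[OF S allT] by simp
  next
    fix x J assume "x \<in> Obj (opposite C)" "J \<in> ?T"
    then show "{f \<in> Arr (opposite C). Cod (opposite C) f = x} \<in> J x"
      unfolding grothendieck_topology_def by blast
  next
    fix f S J assume "f \<in> Arr (opposite C)" "\<forall>J\<in>?T. S \<in> J (Cod (opposite C) f)" "J \<in> ?T"
    then have "grothendieck_topology (opposite C) J" "S \<in> J (Cod (opposite C) f)" by blast+
    then show "pullback_sieve (opposite C) f S \<in> J (Dom (opposite C) f)"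
      unfolding grothendieck_topology_def using \<open>f \<in> _\<close> by blast
  next
    fix x S R J assume x: "x \<in> Obj (opposite C)" and S: "\<forall>J\<in>?T. S \<in> J x"
      and R: "is_sieve (opposite C) x R \<and> (\<forall>f\<in>S. \<forall>J\<in>?T. pullback_sieve (opposite C) f R \<in> J (Dom (opposite C) f))"
      and J: "J \<in> ?T"
    have tr: "\<forall>x \<in> Obj (opposite C). \<forall>S \<in> J x. \<forall>R. is_sieve (opposite C) x R \<and>
        (\<forall>f \<in> S. pullback_sieve (opposite C) f R \<in> J (Dom (opposite C) f)) \<longrightarrow> R \<in> J x"
      using J unfolding grothendieck_topology_def by blast
    have "S \<in> J x" "\<forall>f\<in>S. pullback_sieve (opposite C) f R \<in> J (Dom (opposite C) f)" using S R J by blast+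
    with tr x R show "R \<in> J x" by blast
  qed
qed

context category
begin

definition yon :: "'o \<Rightarrow> ('o, 'a) presheaf" where
  "yon n = mk_psh (\<lambda>x. Hom C n x) (Comp C)"

lemma yoneda_FObj: "n \<in> Obj C \<Longrightarrow> FObj (yoneda (opposite C)) n = yon n"
  by (auto simp: yoneda_def yon_def mk_psh_def Let_def intro!: restrict_ext)

lemma yoneda_FArr: assumes "f \<in> Hom C n m"
  shows "FArr (yoneda (opposite C)) f = mk_map (yon m) (\<lambda>z g. Comp C g f) (yon n)"
proof -
  have *: "f \<in> Arr C" "Dom C f = n" "Cod C f = m" using assms by (auto simp: Hom_def)
  have "(\<lambda>z\<in>Obj C. (Hom C m z, \<lambda>g\<in>Hom C m z. Comp C g f, Hom C n z)) =
    (\<lambda>x\<in>Obj C. (FObj (yon m) x, \<lambda>a\<in>FObj (yon m) x. Comp C a f, FObj (yon n) x))"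
    by (rule restrict_ext) (simp add: yon_def)
  then show ?thesis
    using * yoneda_FObj[of n] yoneda_FObj[of m] Hom_Obj[OF assms]
    by (auto simp: yoneda_def mk_map_def Let_def)
qed

lemma yon_Obj [simp]: "x \<in> Obj C \<Longrightarrow> FObj (yon n) x = Hom C n x"
  by (simp add: yon_def)

lemma yon_act: "g \<in> Hom C n x \<Longrightarrow> f \<in> Hom C x y \<Longrightarrow> act (yon n) f g = Comp C f g"
  unfolding yon_def by (rule act_mk_psh)

lemma psh_yon: assumes "small TYPE('a) (Arr C)" shows "psh (yon n)"
  unfolding yon_def
proof (rule psh_mk_psh)
  show "small TYPE('a) (Hom C n x)" for x by (rule small_subset[OF _ assms]) (auto simp: Hom_def)
qed (auto simp: Comp_closed Ide_Comp Comp_assoc)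

lemma yon_map:
  assumes "\<phi> \<in> Hom (Psh TYPE('a)) (yon n) F" "g \<in> Hom C n x"
  shows "app \<phi> x g = act F g (app \<phi> n (Ide C n))"
proof -
  note n = Hom_Obj(1)[OF assms(2)]
  have "app \<phi> x (act (yon n) g (Ide C n)) = act F g (app \<phi> n (Ide C n))"
    using Psh_Hom(3)[OF assms(1)] assms(2) Ide_closed[OF n] n unfolding natural_def by simp
  then show ?thesis using yon_act[OF Ide_closed[OF n] assms(2)] Comp_Ide[OF assms(2)] by simp
qed

lemma yon_map_exists:
  assumes "psh F" "n \<in> Obj C" "a \<in> FObj F n" "psh (yon n)"
  shows "mk_map (yon n) (\<lambda>x g. act F g a) F \<in> Hom (Psh TYPE('a)) (yon n) F"
proof (rule mk_map_Psh[OF assms(4,1)])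
  show "natural (yon n) F (\<lambda>x g. act F g a)"
    unfolding natural_def using act_closed[OF assms(1) _ assms(3)] act_Comp[OF assms(1) _ _ assms(3)] Hom_Obj
    by (auto simp: yon_act)
qed

text \<open>If some span has no cocone, the empty sieve covers an object, and the initial sheaf is the
  sheafification of its representable presheaf, which is then not an atom.\<close>

lemma ore_if_not_initial:
  fixes J defines "J \<equiv> atomic_topology (opposite C)"
  assumes sm: "small TYPE('a) (Arr C)" and un: "universe TYPE('a)"
    and atom: "\<And>n. n \<in> Obj C \<Longrightarrow> \<not> is_initial (sheaf_category (opposite C) J) (fst (sheafify (opposite C) J (yon n)))"
  shows ore
proof (rule ccontr)
  interpret universe "TYPE('a)" by (rule un)
  let ?Sh = "sheaf_category (opposite C) J"
  have top: "grothendieck_topology (opposite C) J"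
    unfolding J_def atomic_topology_def by (rule generated_topology_is_topology[OF category_axioms]) auto
  have sieve: "is_sieve (opposite C) x S" if "x \<in> Obj C" "S \<in> J x" for x S
    using top that unfolding grothendieck_topology_def by simp
  have pull: "pullback_sieve (opposite C) f S \<in> J y" if "f \<in> Hom C x y" "S \<in> J x" for f x y S
    using top that unfolding grothendieck_topology_def by (auto simp: Hom_def)
  have trans: "R \<in> J x" if "x \<in> Obj C" "S \<in> J x" "is_sieve (opposite C) x R"
    "\<And>f. f \<in> S \<Longrightarrow> pullback_sieve (opposite C) f R \<in> J (Cod C f)" for x S R
  proof -
    have "\<forall>x \<in> Obj (opposite C). \<forall>S \<in> J x. \<forall>R. is_sieve (opposite C) x R \<and>
        (\<forall>f \<in> S. pullback_sieve (opposite C) f R \<in> J (Dom (opposite C) f)) \<longrightarrow> R \<in> J x"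
      using top unfolding grothendieck_topology_def by (elim conjE)
    then show ?thesis using that by simp
  qed
  have empty_pull: "pullback_sieve (opposite C) f {} = {}" for f by (simp add: pullback_sieve_def)
  have empty_sieve: "is_sieve (opposite C) x {}" for x by (simp add: is_sieve_def)
  have empty_J: "{} \<in> J y" if "f \<in> Hom C x y" "{} \<in> J x" for f x y
    using pull[OF that] by (simp add: empty_pull)
  assume "\<not> ore"
  then obtain x n z f g where f: "f \<in> Hom C x n" and g: "g \<in> Hom C x z"
    and no: "\<And>w h k. h \<in> Hom C n w \<Longrightarrow> k \<in> Hom C z w \<Longrightarrow> Comp C h f \<noteq> Comp C k g"
    unfolding ore_def by blast
  \<comment> \<open>The sieve generated by one leg of the span. Its pullback along the other leg
    consists of the cocones of the span, hence is empty, and stability makes the empty sieve cover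
    \<open>n\<close>.\<close>
  let ?S = "{Comp C k g | k w. k \<in> Hom C z w}"
  have "?S \<in> {S. is_sieve (opposite C) x S \<and> S \<noteq> {}}"
    using principal_sieve[OF g] principal_sieve_self[OF g] by blast
  then have "?S \<in> J x"
    using Hom_Obj(1)[OF f] unfolding J_def atomic_topology_def generated_topology_def opposite_sel by blast
  from pull[OF f this] have "pullback_sieve (opposite C) f ?S \<in> J n" .
  moreover have "pullback_sieve (opposite C) f ?S = {}"
  proof -
    have False if h: "h \<in> Arr C" "Dom C h = Cod C f" "Comp C h f = Comp C k g" "k \<in> Hom C z w" for h k w
    proof -
      have h': "h \<in> Hom C n (Cod C h)" using h f by (auto simp: Hom_def)
      have "w = Cod C h" using h(3) Comp_closed[OF f h'] Comp_closed[OF g h(4)] by (auto simp: Hom_def)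
      then show False using no[OF h'] h by auto
    qed
    then show ?thesis by (auto simp: pullback_sieve_def)
  qed
  ultimately have Jn: "{} \<in> J n" by simp
  note n = Hom_Obj(2)[OF f]
  note yon = psh_yon[OF sm, of n]
  have sheafD: "\<exists>!a. a \<in> FObj F x" if "F \<in> Obj ?Sh" "x \<in> Obj C" "{} \<in> J x" for F x
  proof -
    have "\<forall>s. matching_family (opposite C) F {} s \<longrightarrow> (\<exists>!a. a \<in> FObj F x \<and> (\<forall>f\<in>{}. map_fun_of (FArr F f) a = s f))"
      using that unfolding sheaf_category_def is_sheaf_def Obj_full_subcategory opposite_sel by blast
    then show ?thesis by (simp add: matching_family_def)
  qed
  have Sh_psh: "psh F" if "F \<in> Obj ?Sh" for F
    using that is_sheaf_psh unfolding sheaf_category_def by auto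
  have Sh_Hom: "m \<in> Hom ?Sh F G \<longleftrightarrow> m \<in> Hom (Psh TYPE('a)) F G \<and> F \<in> Obj ?Sh \<and> G \<in> Obj ?Sh" for m F G
    unfolding sheaf_category_def Hom_full_subcategory presheaf_category_opposite
    by (auto simp: psh_def[symmetric] is_sheaf_psh)
  have ShC: "Comp ?Sh = Comp (Psh TYPE('a))" unfolding sheaf_category_def presheaf_category_opposite by simp
  obtain c :: 'a where True by blast
  \<comment> \<open>The initial sheaf: a sheaf has exactly one element over an object covered by the
    empty sieve, and over the other objects nothing is forced.\<close>
  define I where "I = mk_psh (\<lambda>x. if {} \<in> J x then {c} else {}) (\<lambda>_ _. c)"
  have I_psh: "psh I"
    unfolding I_def by (rule psh_mk_psh) (auto intro: small_countable empty_J split: if_splits)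
  have I_Obj: "a \<in> FObj I x \<longleftrightarrow> a = c \<and> {} \<in> J x" if "x \<in> Obj C" for x a
    using that unfolding I_def by auto
  have I_act: "act I f a = c" if "f \<in> Hom C x y" "a \<in> FObj I x" for f x y a
    unfolding I_def using that I_Obj Hom_Obj(1)[OF that(1)] unfolding I_def by (subst act_mk_psh[OF that(1)]) auto
  have "is_sheaf (opposite C) J I"
    unfolding is_sheaf_def presheaf_category_opposite
  proof (intro conjI ballI allI impI)
    show "I \<in> Obj (Psh TYPE('a))" using I_psh by (simp add: psh_def)
    fix x S s assume "x \<in> Obj (opposite C)" and S: "S \<in> J x" and s: "matching_family (opposite C) I S s"
    then have x: "x \<in> Obj C" by simp
    note sv = sieve[OF x S]
    have s': "s f = c \<and> {} \<in> J (Cod C f)" if "f \<in> S" for f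
      using s that I_Obj[OF Hom_Obj(2)[OF sieve_hom[OF sv that]]] unfolding matching_opposite by blast
    then have "{} \<in> J x" by (intro trans[OF x S empty_sieve]) (simp add: empty_pull)
    then show "\<exists>!a. a \<in> FObj I x \<and> (\<forall>f\<in>S. map_fun_of (FArr I f) a = s f)"
      using I_Obj[OF x] s' I_act[OF sieve_hom[OF sv]] by (auto simp: act_def[symmetric])
  qed
  then have I_Sh: "I \<in> Obj ?Sh" using I_psh unfolding sheaf_category_def presheaf_category_opposite by (simp add: psh_def)
  define \<eta> where "\<eta> = mk_map (yon n) (\<lambda>_ _. c) I"
  have \<eta>: "\<eta> \<in> Hom (Psh TYPE('a)) (yon n) I"
    unfolding \<eta>_def
    by (rule mk_map_Psh[OF yon I_psh]) (use I_Obj I_act empty_J[OF _ Jn] Hom_Obj in \<open>auto simp: natural_def\<close>)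
  have I_ex: "\<exists>m. m \<in> Hom ?Sh I F" if F: "F \<in> Obj ?Sh" for F
  proof -
    have "natural I F (\<lambda>x _. THE a. a \<in> FObj F x)"
      unfolding natural_def
    proof (intro conjI ballI allI)
      fix x a assume x: "x \<in> Obj C" and "a \<in> FObj I x"
      then have "{} \<in> J x" using I_Obj by blast
      from theI'[OF sheafD[OF F x this]] show "(THE a. a \<in> FObj F x) \<in> FObj F x" .
    next
      fix x y f a assume f: "f \<in> Hom C x y" and "a \<in> FObj I x"
      then have x: "{} \<in> J x" using I_Obj Hom_Obj by blast
      have "act F f (THE a. a \<in> FObj F x) \<in> FObj F y"
        by (rule act_closed[OF Sh_psh[OF F] f theI'[OF sheafD[OF F Hom_Obj(1)[OF f] x]]])
      from the1_equality[OF sheafD[OF F Hom_Obj(2)[OF f] empty_J[OF f x]] this]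
      show "(THE a. a \<in> FObj F y) = act F f (THE a. a \<in> FObj F x)" .
    qed
    from mk_map_Psh[OF I_psh Sh_psh[OF F] this] show ?thesis using F I_Sh Sh_Hom by blast
  qed
  \<comment> \<open>Where the empty sieve covers, the target has only one element, so maps from a
    presheaf supported on such objects cannot differ.\<close>
  have unique: "m = m'" if "m \<in> Hom (Psh TYPE('a)) G F" "m' \<in> Hom (Psh TYPE('a)) G F" "F \<in> Obj ?Sh"
    "\<And>x a. x \<in> Obj C \<Longrightarrow> a \<in> FObj G x \<Longrightarrow> {} \<in> J x" for m m' F G
  proof (rule Psh_map_eqI[OF that(1,2)])
    fix x a assume xa: "x \<in> Obj C" "a \<in> FObj G x"
    then have "app m x a \<in> FObj F x" "app m' x a \<in> FObj F x"
      using Psh_Hom(3)[OF that(1)] Psh_Hom(3)[OF that(2)] by (auto simp: natural_def)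
    then show "app m x a = app m' x a" using sheafD[OF that(3) xa(1) that(4)[OF xa]] by blast
  qed
  have yonJ: "{} \<in> J x" if "x \<in> Obj C" "a \<in> FObj (yon n) x" for x a
    using that empty_J[OF _ Jn] by simp
  have comp: "Comp (Psh TYPE('a)) g \<eta>' \<in> Hom (Psh TYPE('a)) (yon n) F"
    if "\<eta>' \<in> Hom (Psh TYPE('a)) (yon n) S" "g \<in> Hom ?Sh S F" for g F S \<eta>'
    using category.Comp_closed[OF category_Psh that(1)] that(2) Sh_Hom by blast
  have "is_sheafification (opposite C) J (yon n) I \<eta>"
    unfolding is_sheafification_def presheaf_category_opposite
  proof (intro conjI ballI I_Sh \<eta>)
    fix F f assume F: "F \<in> Obj ?Sh" and f: "f \<in> Hom (Psh TYPE('a)) (yon n) F"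
    obtain m where m: "m \<in> Hom ?Sh I F" using I_ex[OF F] by blast
    have "Comp (Psh TYPE('a)) m \<eta> = f" by (rule unique[OF comp[OF \<eta> m] f F yonJ])
    moreover have "g = m" if "g \<in> Hom ?Sh I F" for g
      using that m Sh_Hom unique[of g I F m] F I_Obj by blast
    ultimately show "\<exists>!g. g \<in> Hom ?Sh I F \<and> Comp (Psh TYPE('a)) g \<eta> = f" using m by blast
  qed
  then have "(\<lambda>(S, \<eta>). is_sheafification (opposite C) J (yon n) S \<eta>) (I, \<eta>)" by simp
  then have "case sheafify (opposite C) J (yon n) of (S, \<eta>) \<Rightarrow> is_sheafification (opposite C) J (yon n) S \<eta>"
    unfolding sheafify_def by (rule someI)
  then obtain S \<eta>' where S: "sheafify (opposite C) J (yon n) = (S, \<eta>')" "is_sheafification (opposite C) J (yon n) S \<eta>'"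
    by (cases "sheafify (opposite C) J (yon n)") auto
  \<comment> \<open>The sheafification \<open>S\<close> chosen by \<open>sheafify\<close> may differ
    from \<open>I\<close>. Its universal property turns maps from \<open>S\<close> to
    \<open>F\<close> into maps from \<open>yon n\<close> to \<open>F\<close>, and of these there is
    exactly one.\<close>
  have S_Sh: "S \<in> Obj ?Sh" and \<eta>': "\<eta>' \<in> Hom (Psh TYPE('a)) (yon n) S"
    and S_univ: "\<And>F f. F \<in> Obj ?Sh \<Longrightarrow> f \<in> Hom (Psh TYPE('a)) (yon n) F \<Longrightarrow>
        \<exists>!g. g \<in> Hom ?Sh S F \<and> Comp (Psh TYPE('a)) g \<eta>' = f"
    using S(2) unfolding is_sheafification_def presheaf_category_opposite by auto
  have "is_initial ?Sh S"
    unfolding is_initial_def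
  proof (intro conjI S_Sh ballI)
    fix F assume F: "F \<in> Obj ?Sh"
    obtain m where "m \<in> Hom ?Sh I F" using I_ex[OF F] by blast
    note f = comp[OF \<eta> this]
    have "Comp (Psh TYPE('a)) g \<eta>' = Comp (Psh TYPE('a)) m \<eta>" if "g \<in> Hom ?Sh S F" for g
      by (rule unique[OF comp[OF \<eta>' that] f F yonJ])
    then show "\<exists>!g. g \<in> Hom ?Sh S F" using S_univ[OF F f] by metis
  qed
  then show False using atom[OF n] S(1) by simp
qed

end

section \<open>Universal property of completions, and the canonical functor by elements\<close>

context atomic_site
begin

text \<open>Every element of \<open>S\<close> becomes a raw element along some arrow, where
  \<open>g\<close> and \<open>h\<close> agree, and the action of that arrow on the sheaf
  \<open>F\<close> is injective.\<close>

lemma completion_unique: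
  assumes "completion_of R t q S \<eta>" "shf F" "natural S F g" "natural S F h"
    and eq: "\<And>x r. x \<in> Obj C \<Longrightarrow> r \<in> R x \<Longrightarrow> g x (\<eta> x r) = h x (\<eta> x r)"
    and "x \<in> Obj C" "a \<in> FObj S x"
  shows "g x a = h x a"
proof -
  obtain y f r where f: "f \<in> Hom C x y" "r \<in> R y" "act S f a = \<eta> y r" using completion_ofD(6)[OF assms(1,6,7)] by blast
  have "act F f (g x a) = g y (act S f a)" "act F f (h x a) = h y (act S f a)" using assms(3,4,7) f unfolding natural_def by metis+
  moreover have "g x a \<in> FObj F x" "h x a \<in> FObj F x" using assms(3,4,6,7) unfolding natural_def by auto
  ultimately show ?thesis using shf_inj[OF assms(2) f(1)] eq[OF Hom_Obj(2)[OF f(1)] f(2)] f(3) by simp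
qed

text \<open>An element \<open>a\<close> of \<open>S\<close> becomes a raw element \<open>r\<close>
  along some \<open>f\<close>. Two arrows with the same composite with \<open>f\<close> send
  \<open>r\<close> to elements congruent under \<open>q\<close>, hence with the same
  \<open>\<phi>\<close>; so \<open>\<phi>\<close> of \<open>r\<close> descends along
  \<open>f\<close> to an element of the sheaf \<open>F\<close>.\<close>

lemma completion_extend:
  assumes comp: "completion_of R t q S \<eta>" and F: "shf F"
    and \<phi>: "\<And>x r. x \<in> Obj C \<Longrightarrow> r \<in> R x \<Longrightarrow> \<phi> x r \<in> FObj F x"
    and \<phi>_nat: "\<And>x y f r. f \<in> Hom C x y \<Longrightarrow> r \<in> R x \<Longrightarrow> \<phi> y (t f r) = act F f (\<phi> x r)"
    and \<phi>_q: "\<And>x r s. x \<in> Obj C \<Longrightarrow> r \<in> R x \<Longrightarrow> s \<in> R x \<Longrightarrow> q x r s \<Longrightarrow> \<phi> x r = \<phi> x s"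
  obtains g where "natural S F g" "\<And>x r. x \<in> Obj C \<Longrightarrow> r \<in> R x \<Longrightarrow> g x (\<eta> x r) = \<phi> x r"
proof -
  note D = completion_ofD[OF comp]
  note S = shf_psh[OF D(1)] and Fp = shf_psh[OF F]
  \<comment> \<open>\<open>b\<close> qualifies as the value at \<open>a\<close> if it restricts
    correctly along every arrow that makes \<open>a\<close> raw, not just along a chosen one. This
    makes naturality of the resulting map a matter of uniqueness.\<close>
  define A where "A x a b \<longleftrightarrow> b \<in> FObj F x \<and> (\<forall>y. \<forall>f\<in>Hom C x y. \<forall>r\<in>R y. act S f a = \<eta> y r \<longrightarrow> act F f b = \<phi> y r)" for x a b
  have \<eta>\<phi>: "\<phi> x r = \<phi> x s" if "x \<in> Obj C" "r \<in> R x" "s \<in> R x" "\<eta> x r = \<eta> x s" for x r s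
    using \<phi>_q D(5) that by blast
  have ex: "\<exists>b. A x a b" if x: "x \<in> Obj C" and a: "a \<in> FObj S x" for x a
  proof -
    obtain y f r where f: "f \<in> Hom C x y" "r \<in> R y" "act S f a = \<eta> y r" using D(6)[OF x a] by blast
    note y = Hom_Obj(2)[OF f(1)]
    have tr: "\<eta> z (t g r) = act S (Comp C g f) a" if "g \<in> Hom C y z" for g z
      using act_Comp[OF S f(1) that a] f(3) D(4)[OF that f(2)] by simp
    have "act F g (\<phi> y r) = act F h (\<phi> y r)" if gh: "g \<in> Hom C y z" "h \<in> Hom C y z" "Comp C g f = Comp C h f" for g h z
      using \<eta>\<phi>[OF Hom_Obj(2)[OF gh(1)] D(3)[OF gh(1) f(2)] D(3)[OF gh(2) f(2)]] tr gh
        \<phi>_nat[OF gh(1) f(2)] \<phi>_nat[OF gh(2) f(2)] by simp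
    then obtain b where b: "b \<in> FObj F x" "act F f b = \<phi> y r"
      by (rule shf_glue[OF F f(1) \<phi>[OF y f(2)]])
    have "act F f' b = \<phi> y' r'" if f': "f' \<in> Hom C x y'" "r' \<in> R y'" "act S f' a = \<eta> y' r'" for f' y' r'
    proof -
      from oreE[OF Ore f(1) f'(1)] obtain w g h where gh: "g \<in> Hom C y w" "h \<in> Hom C y' w" "Comp C g f = Comp C h f'" .
      have "\<eta> w (t h r') = act S (Comp C h f') a"
        using act_Comp[OF S f'(1) gh(2) a] f'(3) D(4)[OF gh(2) f'(2)] by simp
      then have "\<phi> w (t g r) = \<phi> w (t h r')"
        using \<eta>\<phi>[OF Hom_Obj(2)[OF gh(1)] D(3)[OF gh(1) f(2)] D(3)[OF gh(2) f'(2)]] tr[OF gh(1)] gh(3) by simp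
      then have "act F h (act F f' b) = act F h (\<phi> y' r')"
        using act_Comp[OF Fp f(1) gh(1) b(1)] act_Comp[OF Fp f'(1) gh(2) b(1)] gh(3) b(2)
          \<phi>_nat[OF gh(1) f(2)] \<phi>_nat[OF gh(2) f'(2)] by simp
      then show ?thesis
        by (rule shf_inj[OF F gh(2) act_closed[OF Fp f'(1) b(1)] \<phi>[OF Hom_Obj(2)[OF f'(1)] f'(2)]])
    qed
    then show ?thesis using b unfolding A_def by blast
  qed
  have uniq: "b = b'" if x: "x \<in> Obj C" and a: "a \<in> FObj S x" and b: "A x a b" "A x a b'" for x a b b'
  proof -
    obtain y f r where f: "f \<in> Hom C x y" "r \<in> R y" "act S f a = \<eta> y r" using D(6)[OF x a] by blast
    then have "act F f b = act F f b'" "b \<in> FObj F x" "b' \<in> FObj F x" using b unfolding A_def by auto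
    then show ?thesis using shf_inj[OF F f(1)] by blast
  qed
  define g where "g x a = (SOME b. A x a b)" for x a
  have g: "A x a (g x a)" if "x \<in> Obj C" "a \<in> FObj S x" for x a
    unfolding g_def using ex[OF that] by (rule someI_ex)
  have "natural S F g"
    unfolding natural_def
  proof (intro conjI ballI allI)
    show "g x a \<in> FObj F x" if "x \<in> Obj C" "a \<in> FObj S x" for x a using g[OF that] unfolding A_def by blast
    fix x y u a assume u: "u \<in> Hom C x y" and a: "a \<in> FObj S x"
    note gx = g[OF Hom_Obj(1)[OF u] a]
    have gF: "g x a \<in> FObj F x" using gx unfolding A_def by blast
    have "A y (act S u a) (act F u (g x a))"
      unfolding A_def
    proof (intro conjI allI ballI impI)
      show "act F u (g x a) \<in> FObj F y" by (rule act_closed[OF Fp u gF])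
      fix z f r assume f: "f \<in> Hom C y z" "r \<in> R z" "act S f (act S u a) = \<eta> z r"
      then show "act F f (act F u (g x a)) = \<phi> z r"
        using gx act_Comp[OF S u f(1) a] act_Comp[OF Fp u f(1) gF] Comp_closed[OF u f(1)] unfolding A_def by metis
    qed
    then show "g y (act S u a) = act F u (g x a)"
      using uniq[OF Hom_Obj(2)[OF u] act_closed[OF S u a] g[OF Hom_Obj(2)[OF u] act_closed[OF S u a]]] by blast
  qed
  moreover have "g x (\<eta> x r) = \<phi> x r" if x: "x \<in> Obj C" and r: "r \<in> R x" for x r
    using g[OF x D(2)[OF x r]] act_Ide[OF S x D(2)[OF x r]] r Ide_closed[OF x] act_Ide[OF Fp x] unfolding A_def by metis
  ultimately show thesis using that by blast
qed

text \<open>\<open>sheafify\<close> is a mere choice, so existence has to be secured before the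
  canonical functor can be described.\<close>

lemma sheafification_yon_exists:
  assumes n: "n \<in> Obj C"
  shows "\<exists>S \<eta>. is_sheafification (opposite C) (atomic_topology (opposite C)) (yon n) S \<eta>"
proof -
  \<comment> \<open>Two arrows out of \<open>n\<close> are identified when they act alike in all
    sheaves. Injectivity of the actions makes this congruence saturated, and every map from
    \<open>yon n\<close> to a sheaf respects it by the Yoneda lemma.\<close>
  define q where "q x f g \<longleftrightarrow> (\<forall>F :: ('o, 'u) presheaf. \<forall>a\<in>FObj F n. shf F \<longrightarrow> act F f a = act F g a)" for x :: 'o and f g
  obtain S \<eta> where comp: "completion_of (Hom C n) (Comp C) q S \<eta>"
  proof (rule completion[of "Hom C n" "Comp C" q])
    note found = that
    show "sml (Hom C n x)" for x by (rule small_subset[OF _ small_Arr]) (auto simp: Hom_def)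
    show "q y (Comp C f r) (Comp C f s)" if "f \<in> Hom C x y" "r \<in> Hom C n x" "s \<in> Hom C n x" "q x r s" for x y f r s
      unfolding q_def
    proof (intro allI ballI impI)
      fix F :: "('o, 'u) presheaf" and a assume a: "a \<in> FObj F n" and F: "shf F"
      show "act F (Comp C f r) a = act F (Comp C f s) a"
        using that(4) a F act_Comp[OF shf_psh[OF F] that(2,1) a] act_Comp[OF shf_psh[OF F] that(3,1) a]
        unfolding q_def by simp
    qed
    show "q x r s" if f: "f \<in> Hom C x y" and rs: "r \<in> Hom C n x" "s \<in> Hom C n x" and q: "q y (Comp C f r) (Comp C f s)" for x y f r s
      unfolding q_def
    proof (intro allI ballI impI)
      fix F :: "('o, 'u) presheaf" and a assume a: "a \<in> FObj F n" and F: "shf F"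
      note Fp = shf_psh[OF F]
      have "act F f (act F r a) = act F f (act F s a)"
        using q a F act_Comp[OF Fp rs(1) f a] act_Comp[OF Fp rs(2) f a] unfolding q_def by metis
      then show "act F r a = act F s a"
        by (rule shf_inj[OF F f act_closed[OF Fp rs(1) a] act_closed[OF Fp rs(2) a]])
    qed
    show thesis if "completion_of (Hom C n) (Comp C) q S \<eta>" for S \<eta> by (rule found[OF that])
  qed (auto simp: q_def Comp_closed Ide_Comp Comp_assoc)
  note D = completion_ofD[OF comp]
  note yon = psh_yon[OF small_Arr, of n]
  let ?\<eta> = "mk_map (yon n) \<eta> S"
  have \<eta>: "?\<eta> \<in> Hom (Psh TYPE('u)) (yon n) S"
    by (rule mk_map_Psh[OF yon shf_psh[OF D(1)]]) (use D(2,4) Hom_Obj in \<open>auto simp: natural_def yon_act\<close>)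
  have "is_sheafification (opposite C) (atomic_topology (opposite C)) (yon n) S ?\<eta>"
    unfolding is_sheafification_def sheaf_category_def presheaf_category_opposite is_sheaf_atomic[OF Ore]
  proof (intro conjI ballI \<eta>)
    show "S \<in> Obj (full_subcategory (Psh TYPE('u)) shf)" using D(1) shf_psh by (auto simp: psh_def)
    fix F f assume "F \<in> Obj (full_subcategory (Psh TYPE('u)) shf)" and f: "f \<in> Hom (Psh TYPE('u)) (yon n) F"
    then have F: "shf F" by simp
    have a: "app f n (Ide C n) \<in> FObj F n" using Psh_Hom(3)[OF f] n Ide_closed[OF n] by (simp add: natural_def)
    have fn: "natural (yon n) F (app f)" using Psh_Hom(3)[OF f] .
    obtain g where g: "natural S F g" "\<And>x r. x \<in> Obj C \<Longrightarrow> r \<in> Hom C n x \<Longrightarrow> g x (\<eta> x r) = app f x r"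
    proof (rule completion_extend[OF comp F, of "app f"])
      show "app f x r \<in> FObj F x" if "x \<in> Obj C" "r \<in> Hom C n x" for x r using fn that by (simp add: natural_def)
      show "app f y (Comp C h r) = act F h (app f x r)" if "h \<in> Hom C x y" "r \<in> Hom C n x" for x y h r
      proof -
        have "r \<in> FObj (yon n) x" using that(2) Hom_Obj(1)[OF that(1)] by simp
        then have "app f y (act (yon n) h r) = act F h (app f x r)" using fn that(1) unfolding natural_def by blast
        then show ?thesis using yon_act[OF that(2,1)] by simp
      qed
      show "app f x r = app f x s" if "x \<in> Obj C" "r \<in> Hom C n x" "s \<in> Hom C n x" "q x r s" for x r s
        using yon_map[OF f that(2)] yon_map[OF f that(3)] that(4) F a unfolding q_def by simp
      fix g assume "natural S F g" "\<And>x r. x \<in> Obj C \<Longrightarrow> r \<in> Hom C n x \<Longrightarrow> g x (\<eta> x r) = app f x r"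
      then show thesis by (rule that)
    qed
    let ?g = "mk_map S g F"
    have gH: "?g \<in> Hom (Psh TYPE('u)) S F" by (rule mk_map_Psh[OF shf_psh[OF D(1)] shf_psh[OF F] g(1)])
    have comp_app: "app (Comp (Psh TYPE('u)) m ?\<eta>) x r = app m x (\<eta> x r)" if "m \<in> Hom (Psh TYPE('u)) S F" "x \<in> Obj C" "r \<in> Hom C n x" for m x r
      using that by (simp add: Psh_Comp[OF \<eta>])
    have "Comp (Psh TYPE('u)) ?g ?\<eta> = f"
      by (rule Psh_map_eqI[OF category.Comp_closed[OF category_Psh \<eta> gH] f]) (use comp_app[OF gH] g(2) D(2) in simp)
    moreover have "m = ?g" if m: "m \<in> Hom (Psh TYPE('u)) S F" and e: "Comp (Psh TYPE('u)) m ?\<eta> = f" for m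
    proof (rule Psh_map_eqI[OF m gH])
      fix x a assume xa: "x \<in> Obj C" "a \<in> FObj S x"
      have "app m x a = g x a"
      proof (rule completion_unique[OF comp F Psh_Hom(3)[OF m] g(1) _ xa])
        show "app m x (\<eta> x r) = g x (\<eta> x r)" if "x \<in> Obj C" "r \<in> Hom C n x" for x r
          using g(2)[OF that] comp_app[OF m that] e by simp
      qed
      then show "app m x a = app ?g x a" using xa by simp
    qed
    ultimately show "\<exists>!g. g \<in> Hom (full_subcategory (Psh TYPE('u)) shf) S F \<and> Comp (Psh TYPE('u)) g ?\<eta> = f"
      unfolding Hom_full_subcategory using gH D(1) F by blast
  qed
  then show ?thesis by blast
qed

definition Sh :: "(('o, 'u) presheaf, ('o, 'u) presheaf_map) category" where
  "Sh = full_subcategory (Psh TYPE('u)) shf"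

lemma sheaf_category_Sh: "sheaf_category (opposite C) (atomic_topology (opposite C)) = Sh"
  unfolding sheaf_category_def Sh_def presheaf_category_opposite is_sheaf_atomic[OF Ore] ..

lemma Sh_Obj [simp]: "F \<in> Obj Sh \<longleftrightarrow> shf F"
  using shf_psh by (auto simp: Sh_def psh_def)

lemma Sh_Hom: "m \<in> Hom Sh F G \<longleftrightarrow> m \<in> Hom (Psh TYPE('u)) F G \<and> shf F \<and> shf G"
  by (simp add: Sh_def Hom_full_subcategory)

lemma Sh_map: "shf F \<Longrightarrow> shf G \<Longrightarrow> natural F G h \<Longrightarrow> mk_map F h G \<in> Hom Sh F G"
  unfolding Sh_Hom by (intro conjI mk_map_Psh shf_psh)

lemma Sh_HomD:
  assumes "m \<in> Hom Sh F G"
  shows "shf F" "shf G" "natural F G (app m)" "m = mk_map F (app m) G"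
  using assms Psh_Hom Sh_Hom by blast+

lemma category_Sh: "category Sh"
  unfolding Sh_def by (rule category_full_subcategory[OF category_Psh])

lemma Sh_map_eqI:
  assumes "m \<in> Hom Sh F G" "n \<in> Hom Sh F G"
    and "\<And>x a. x \<in> Obj C \<Longrightarrow> a \<in> FObj F x \<Longrightarrow> app m x a = app n x a"
  shows "m = n"
  using Psh_map_eqI assms Sh_Hom by blast

lemma Sh_app_Comp:
  assumes "m \<in> Hom Sh F G" "n \<in> Hom Sh G H" "x \<in> Obj C" "a \<in> FObj F x"
  shows "app (Comp Sh n m) x a = app n x (app m x a)"
  using Psh_Comp[of m F G n H] assms unfolding Sh_Hom by (simp add: Sh_def)

lemma Sh_app_Ide: "x \<in> Obj C \<Longrightarrow> a \<in> FObj F x \<Longrightarrow> app (Ide Sh F) x a = a"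
  unfolding Sh_def by (simp add: Psh_Ide)

lemma Sh_app_closed: "m \<in> Hom Sh F G \<Longrightarrow> x \<in> Obj C \<Longrightarrow> a \<in> FObj F x \<Longrightarrow> app m x a \<in> FObj G x"
  using Sh_HomD(3) by (auto simp: natural_def)

lemma Sh_app_act: "m \<in> Hom Sh F G \<Longrightarrow> f \<in> Hom C x y \<Longrightarrow> a \<in> FObj F x \<Longrightarrow> app m y (act F f a) = act G f (app m x a)"
  using Sh_HomD(3) by (auto simp: natural_def)

context
  fixes J X defines "J \<equiv> atomic_topology (opposite C)"
  defines "X \<equiv> canonical_functor (opposite C) J"
begin

text \<open>The image of the identity under the unit of the sheafification: the universal element of
  the sheaf \<open>FObj X n\<close>.\<close>

definition unit_of :: "'o \<Rightarrow> 'u" where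
  "unit_of n = app (snd (sheafify (opposite C) J (yon n))) n (Ide C n)"

lemma canonical_sheafification:
  assumes n: "n \<in> Obj C"
  shows "is_sheafification (opposite C) J (yon n) (FObj X n) (snd (sheafify (opposite C) J (yon n)))"
proof -
  have "FObj X n = fst (sheafify (opposite C) J (yon n))"
    using n psh_yon[OF small_Arr, of n]
    by (simp add: X_def canonical_functor_def functor_comp_def sheafification_def Let_def yoneda_FObj presheaf_category_opposite psh_def)
  moreover have "case sheafify (opposite C) J (yon n) of (S, \<eta>) \<Rightarrow> is_sheafification (opposite C) J (yon n) S \<eta>"
  proof -
    obtain S \<eta> where "is_sheafification (opposite C) J (yon n) S \<eta>"
      using sheafification_yon_exists[OF n] unfolding J_def by blast
    then have "(\<lambda>(S, \<eta>). is_sheafification (opposite C) J (yon n) S \<eta>) (S, \<eta>)" by simp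
    then show ?thesis unfolding sheafify_def by (rule someI)
  qed
  ultimately show ?thesis by (simp add: case_prod_beta)
qed

lemma canonical_shf: "n \<in> Obj C \<Longrightarrow> shf (FObj X n)"
  using canonical_sheafification[of n] unfolding is_sheafification_def J_def sheaf_category_Sh by simp

lemma eta_Hom: "n \<in> Obj C \<Longrightarrow> snd (sheafify (opposite C) J (yon n)) \<in> Hom (Psh TYPE('u)) (yon n) (FObj X n)"
  using canonical_sheafification[of n] unfolding is_sheafification_def J_def sheaf_category_Sh presheaf_category_opposite by simp

lemma unit_of_closed: "n \<in> Obj C \<Longrightarrow> unit_of n \<in> FObj (FObj X n) n"
  using Psh_Hom(3)[OF eta_Hom] Ide_closed unfolding unit_of_def natural_def by simp

text \<open>The Yoneda lemma followed by the universal property of sheafification: elements of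
  \<open>F\<close> over \<open>n\<close> are the same as maps from \<open>FObj X n\<close> to
  \<open>F\<close>, through their value at the universal element.\<close>

lemma canonical_universal:
  assumes n: "n \<in> Obj C" and F: "shf F" and a: "a \<in> FObj F n"
  shows "\<exists>!m. m \<in> Hom Sh (FObj X n) F \<and> app m n (unit_of n) = a"
proof -
  define \<eta> where "\<eta> = snd (sheafify (opposite C) J (yon n))"
  note yon = psh_yon[OF small_Arr, of n]
  have \<eta>: "\<eta> \<in> Hom (Psh TYPE('u)) (yon n) (FObj X n)" unfolding \<eta>_def by (rule eta_Hom[OF n])
  define f where "f = mk_map (yon n) (\<lambda>x g. act F g a) F"
  have f: "f \<in> Hom (Psh TYPE('u)) (yon n) F"
    unfolding f_def by (rule yon_map_exists[OF shf_psh[OF F] n a yon])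
  have univ: "\<exists>!g. g \<in> Hom Sh (FObj X n) F \<and> Comp (Psh TYPE('u)) g \<eta> = f"
    using canonical_sheafification[OF n] F f
    unfolding is_sheafification_def J_def[symmetric] sheaf_category_Sh[folded J_def] presheaf_category_opposite \<eta>_def by simp
  have "Comp (Psh TYPE('u)) g \<eta> = f \<longleftrightarrow> app g n (unit_of n) = a" if "g \<in> Hom Sh (FObj X n) F" for g
  proof -
    have g: "g \<in> Hom (Psh TYPE('u)) (FObj X n) F" using that Sh_Hom by blast
    note ge = category.Comp_closed[OF category_Psh \<eta> g]
    have i: "Ide C n \<in> Hom C n n" by (rule Ide_closed[OF n])
    have u: "app (Comp (Psh TYPE('u)) g \<eta>) n (Ide C n) = app g n (unit_of n)"
      unfolding Psh_Comp[OF \<eta> g] using n i by (simp add: unit_of_def \<eta>_def)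
    have fi: "app f n (Ide C n) = a" unfolding f_def using n i act_Ide[OF shf_psh[OF F] n a] by simp
    show ?thesis
    proof
      show "app g n (unit_of n) = a" if "Comp (Psh TYPE('u)) g \<eta> = f" using u fi that by simp
      show "Comp (Psh TYPE('u)) g \<eta> = f" if "app g n (unit_of n) = a"
        by (rule Psh_map_eqI[OF ge f]) (use that yon_map[OF ge] yon_map[OF f] u fi in simp)
    qed
  qed
  then show ?thesis using univ by metis
qed

text \<open>The naturality square of the unit, which defines the sheafified map, is evaluated at the
  identity of \<open>m\<close>. In terms of universal elements this makes composition with
  \<open>FArr X f\<close> the action of \<open>f\<close>.\<close>

lemma canonical_FArr:
  assumes X: "cat_functor (opposite C) Sh X" and f: "f \<in> Hom C n m"
  shows "FArr X f \<in> Hom Sh (FObj X m) (FObj X n)" "app (FArr X f) m (unit_of m) = act (FObj X n) f (unit_of n)"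
proof -
  interpret X: cat_functor "opposite C" Sh X by fact
  show H: "FArr X f \<in> Hom Sh (FObj X m) (FObj X n)" using X.FArr_closed[of f m n] f by simp
  note n = Hom_Obj(1)[OF f] and m = Hom_Obj(2)[OF f]
  let ?\<eta> = "\<lambda>n. snd (sheafify (opposite C) J (yon n))"
  let ?y = "mk_map (yon m) (\<lambda>z g. Comp C g f) (yon n)"
  have yn: "psh (yon n)" "psh (yon m)" using psh_yon[OF small_Arr] by blast+
  have y: "?y \<in> Hom (Psh TYPE('u)) (yon m) (yon n)"
  proof (rule mk_map_Psh[OF yn(2,1)])
    show "natural (yon m) (yon n) (\<lambda>z g. Comp C g f)"
      unfolding natural_def
    proof (intro conjI ballI allI)
      show "Comp C a f \<in> FObj (yon n) x" if "x \<in> Obj C" "a \<in> FObj (yon m) x" for x a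
        using that Comp_closed[OF f] by simp
      fix x z h a assume h: "h \<in> Hom C x z" and "a \<in> FObj (yon m) x"
      then have a: "a \<in> Hom C m x" using Hom_Obj(1)[OF h] by simp
      show "Comp C (act (yon m) h a) f = act (yon n) h (Comp C a f)"
        using yon_act[OF a h] yon_act[OF Comp_closed[OF f a] h] Comp_assoc[OF f a h] by simp
    qed
  qed
  have \<eta>y: "Comp (Psh TYPE('u)) (?\<eta> n) ?y \<in> Hom (Psh TYPE('u)) (yon m) (FObj X n)"
    by (rule category.Comp_closed[OF category_Psh y eta_Hom[OF n]])
  have fst_sh: "fst (sheafify (opposite C) J (yon k)) = FObj X k" if "k \<in> Obj C" for k
    using that psh_yon[OF small_Arr, of k]
    by (simp add: X_def canonical_functor_def functor_comp_def sheafification_def Let_def yoneda_FObj presheaf_category_opposite psh_def)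
  have univ: "\<exists>!g. g \<in> Hom Sh (FObj X m) (FObj X n) \<and> Comp (Psh TYPE('u)) g (?\<eta> m) = Comp (Psh TYPE('u)) (?\<eta> n) ?y"
    using canonical_sheafification[OF m] canonical_shf[OF n] \<eta>y
    unfolding is_sheafification_def sheaf_category_Sh[folded J_def] presheaf_category_opposite by simp
  have yD: "?y \<in> Arr (Psh TYPE('u))" "fst ?y = yon m" "snd (snd ?y) = yon n" using HomD[OF y] by auto
  have fA: "f \<in> Arr C" using f by (simp add: Hom_def)
  have "FArr X f = FArr (sheafification (opposite C) J) (FArr (yoneda (opposite C)) f)"
    using fA by (simp add: X_def canonical_functor_def functor_comp_def)
  also have "\<dots> = FArr (sheafification (opposite C) J) ?y" by (simp only: yoneda_FArr[OF f])
  also have "\<dots> = (THE g. g \<in> Hom Sh (FObj X m) (FObj X n) \<and> Comp (Psh TYPE('u)) g (?\<eta> m) = Comp (Psh TYPE('u)) (?\<eta> n) ?y)"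
    using yD by (simp add: sheafification_def Let_def presheaf_category_opposite sheaf_category_Sh[folded J_def] fst_sh m n)
  finally have e: "Comp (Psh TYPE('u)) (FArr X f) (?\<eta> m) = Comp (Psh TYPE('u)) (?\<eta> n) ?y"
    using theI'[OF univ] by simp
  have H': "FArr X f \<in> Hom (Psh TYPE('u)) (FObj X m) (FObj X n)" using H Sh_Hom by blast
  have i: "Ide C m \<in> Hom C m m" by (rule Ide_closed[OF m])
  have "app (Comp (Psh TYPE('u)) (FArr X f) (?\<eta> m)) m (Ide C m) = app (FArr X f) m (unit_of m)"
    unfolding Psh_Comp[OF eta_Hom[OF m] H'] using m i by (simp add: unit_of_def)
  moreover have "app (Comp (Psh TYPE('u)) (?\<eta> n) ?y) m (Ide C m) = app (?\<eta> n) m f"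
    unfolding Psh_Comp[OF y eta_Hom[OF n]] using m i Ide_Comp[OF f] by simp
  moreover have "app (?\<eta> n) m f = act (FObj X n) f (unit_of n)"
    unfolding unit_of_def by (rule yon_map[OF eta_Hom[OF n] f])
  ultimately show "app (FArr X f) m (unit_of m) = act (FObj X n) f (unit_of n)" using e by simp
qed

text \<open>Elements of \<open>F\<close> over \<open>a\<close> and \<open>b\<close> are maps out of
  the corresponding sheaves, and agreement over \<open>d\<close> means that they agree after the two
  maps out of \<open>FObj X d\<close>. A pushout in the opposite category stays a pushout in the
  topos, so the two maps factor jointly, and the factorization is an element over
  \<open>w\<close>.\<close>

lemma sheaves_preserve_pullbacks:
  assumes po: "has_pushouts (opposite C)" "preserves_pushouts (opposite C) Sh X"
    and u: "u \<in> Hom C a d" and v: "v \<in> Hom C b d"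
  shows "\<exists>w. \<exists>p\<in>Hom C w a. \<exists>q\<in>Hom C w b. Comp C u p = Comp C v q \<and>
    (\<forall>F :: ('o, 'u) presheaf. \<forall>\<alpha>\<in>FObj F a. \<forall>\<beta>\<in>FObj F b. shf F \<longrightarrow> act F u \<alpha> = act F v \<beta> \<longrightarrow>
       (\<exists>\<gamma>\<in>FObj F w. act F p \<gamma> = \<alpha> \<and> act F q \<gamma> = \<beta>))"
proof -
  have X: "cat_functor (opposite C) Sh X" using po(2) unfolding preserves_pushouts_def by blast
  obtain p q where pq: "is_pushout (opposite C) u v p q"
  proof -
    have "\<exists>p q. is_pushout (opposite C) u v p q"
      using po(1) HomD[OF u] HomD[OF v] unfolding has_pushouts_def by simp
    then show thesis using that by blast
  qed
  define w where "w = Dom C p"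
  have p: "p \<in> Hom C w a" and q: "q \<in> Hom C w b" and eq: "Comp C u p = Comp C v q"
    using pq u v unfolding is_pushout_def w_def by (auto simp: Hom_def)
  note ob = Hom_Obj[OF u] Hom_Obj[OF v] Hom_Obj[OF p]
  note Xa = canonical_FArr[OF X]
  have XO: "Dom Sh (FArr X f) = FObj X m" "Cod Sh (FArr X f) = FObj X n" if "f \<in> Hom C n m" for f n m
    using Xa(1)[OF that] by (auto simp: Hom_def)
  have po': "is_pushout Sh (FArr X u) (FArr X v) (FArr X p) (FArr X q)"
    using po(2) pq unfolding preserves_pushouts_def by blast
  have univ: "\<exists>!h. h \<in> Hom Sh (FObj X w) F \<and> Comp Sh h (FArr X p) = r \<and> Comp Sh h (FArr X q) = s"
    if "shf F" "r \<in> Hom Sh (FObj X a) F" "s \<in> Hom Sh (FObj X b) F" "Comp Sh r (FArr X u) = Comp Sh s (FArr X v)" for F r s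
    using po' that unfolding is_pushout_def XO[OF u] XO[OF v] XO[OF p] XO[OF q] by simp
  have val: "app (Comp Sh r (FArr X f)) m (unit_of m) = act F f (app r n (unit_of n))"
    if "f \<in> Hom C n m" "r \<in> Hom Sh (FObj X n) F" for f n m r F
    using Sh_app_Comp[OF Xa(1)[OF that(1)] that(2) Hom_Obj(2)[OF that(1)] unit_of_closed] Xa(2)[OF that(1)]
      Sh_app_act[OF that(2,1) unit_of_closed] Hom_Obj[OF that(1)] by simp
  have "\<exists>\<gamma>\<in>FObj F w. act F p \<gamma> = \<alpha> \<and> act F q \<gamma> = \<beta>"
    if F: "shf F" and \<alpha>: "\<alpha> \<in> FObj F a" and \<beta>: "\<beta> \<in> FObj F b" and e: "act F u \<alpha> = act F v \<beta>" for F :: "('o, 'u) presheaf" and \<alpha> \<beta>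
  proof -
    obtain r where r: "r \<in> Hom Sh (FObj X a) F" "app r a (unit_of a) = \<alpha>" using canonical_universal[OF ob(1) F \<alpha>] by blast
    obtain s where s: "s \<in> Hom Sh (FObj X b) F" "app s b (unit_of b) = \<beta>" using canonical_universal[OF ob(3) F \<beta>] by blast
    note ru = category.Comp_closed[OF category_Sh Xa(1)[OF u] r(1)]
    note sv = category.Comp_closed[OF category_Sh Xa(1)[OF v] s(1)]
    have "act F u \<alpha> \<in> FObj F d" by (rule act_closed[OF shf_psh[OF F] u \<alpha>])
    from canonical_universal[OF ob(2) F this] have "Comp Sh r (FArr X u) = Comp Sh s (FArr X v)"
      using ru sv val[OF u r(1)] val[OF v s(1)] r(2) s(2) e by metis
    then obtain h where h: "h \<in> Hom Sh (FObj X w) F" "Comp Sh h (FArr X p) = r" "Comp Sh h (FArr X q) = s"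
      using univ[OF F r(1) s(1)] by blast
    have "app h w (unit_of w) \<in> FObj F w" by (rule Sh_app_closed[OF h(1) ob(5) unit_of_closed[OF ob(5)]])
    moreover have "act F p (app h w (unit_of w)) = \<alpha>" "act F q (app h w (unit_of w)) = \<beta>"
      using val[OF p h(1)] val[OF q h(1)] h r s by simp_all
    ultimately show ?thesis by blast
  qed
  then show ?thesis using p q eq by blast
qed

end
end

section \<open>Elements of minimal support\<close>

text \<open>A family of subgroups without maximal member would, by dependent choice, contain a
  strictly ascending sequence.\<close>

lemma noetherian_group_maximal:
  assumes "noetherian_group G" "\<H> \<noteq> {}" "\<And>H. H \<in> \<H> \<Longrightarrow> subgroup H G"
  obtains M where "M \<in> \<H>" "\<And>H. H \<in> \<H> \<Longrightarrow> M \<subseteq> H \<Longrightarrow> H = M"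
proof (rule ccontr)
  assume no: "\<not> thesis"
  note max = that
  have step: "\<exists>H. H \<in> \<H> \<and> M \<subset> H" if "M \<in> \<H>" for M using no max[OF that] by blast
  have "\<exists>H. H \<in> \<H>" using assms(2) by blast
  then have "\<exists>f :: nat \<Rightarrow> 'a set. \<forall>n. f n \<in> \<H> \<and> f n \<subset> f (Suc n)"
    using step by (rule dependent_nat_choice[where P = "\<lambda>_ H. H \<in> \<H>" and Q = "\<lambda>_ H H'. H \<subset> H'"])
  then obtain f :: "nat \<Rightarrow> 'a set" where "\<forall>n. f n \<in> \<H> \<and> f n \<subset> f (Suc n)" by (rule exE)
  then have f: "f n \<in> \<H>" "f n \<subset> f (Suc n)" for n by simp_all
  have "\<forall>i. subgroup (f i) G \<and> f i \<subseteq> f (Suc i)" using assms(3)[OF f(1)] psubset_imp_subset[OF f(2)] by simp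
  then obtain i where i: "\<forall>j\<ge>i. f j = f i"
    using assms(1) unfolding noetherian_group_def by meson
  have "f (Suc i) = f i" by (rule i[rule_format]) simp
  then show False using f(2)[of i] by simp
qed

context category
begin

lemma is_iso_opposite: "is_iso (opposite C) f \<Longrightarrow> is_iso C f"
  by (auto simp: is_iso_def)

text \<open>Otherwise dependent choice would produce an endless chain of non-isomorphisms. The
  predicate \<open>Q\<close> is left open because it is applied to elements of a functor and also to
  germs in a filtered colimit, where no functor is at hand yet.\<close>

lemma well_founded_support:
  assumes wf: "well_founded C" and "Q x0 m0" "m0 \<in> Hom C x0 y"
  obtains w m where "m \<in> Hom C w y" "Q w m"
    "\<And>v k. k \<in> Hom C v w \<Longrightarrow> Q v (Comp C m k) \<Longrightarrow> is_iso C k"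
proof (rule ccontr)
  assume no: "\<not> thesis"
  note found = that
  \<comment> \<open>The third component stores the arrow leading back to the previous triple; in the
    initial triple it is arbitrary, which is why the chain is read off from the successors.\<close>
  let ?P = "\<lambda>(x, m, k). m \<in> Hom C x y \<and> Q x m"
  let ?S = "\<lambda>(x, m, k) (x', m', k'). k' \<in> Hom C x' x \<and> \<not> is_iso C k'"
  have step: "\<exists>t'. ?P t' \<and> ?S t t'" if "?P t" for t
  proof -
    obtain x m k0 where t: "t = (x, m, k0)" by (metis surj_pair)
    then have m: "m \<in> Hom C x y" "Q x m" using that by auto
    then obtain v k where "k \<in> Hom C v x" "Q v (Comp C m k)" "\<not> is_iso C k" using no found[OF m] by blast
    then show ?thesis unfolding t using Comp_closed[OF _ m(1)] by (intro exI[of _ "(v, Comp C m k, k)"]) auto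
  qed
  have "\<exists>t. ?P t" using assms(2,3) by auto
  then have "\<exists>T. \<forall>n. ?P (T n) \<and> ?S (T n) (T (Suc n))"
    using step by (rule dependent_nat_choice[where P = "\<lambda>_. ?P" and Q = "\<lambda>_. ?S"])
  then obtain T where "\<forall>n. ?P (T n) \<and> ?S (T n) (T (Suc n))" by (rule exE)
  then have T: "?P (T n)" "?S (T n) (T (Suc n))" for n by simp_all
  define x where "x n = fst (T n)" for n
  define k where "k n = snd (snd (T (Suc n)))" for n
  have k: "k n \<in> Hom C (x (Suc n)) (x n)" "\<not> is_iso C (k n)" for n
    using T(2)[of n] unfolding x_def k_def by (auto simp: case_prod_beta)
  have "\<forall>i. x i \<in> Obj (opposite C) \<and> k i \<in> Hom (opposite C) (x i) (x (Suc i))"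
    using k(1) Hom_Obj(2)[OF k(1)] by auto
  then obtain i where i: "\<forall>j>i. is_iso (opposite C) (chain_comp (opposite C) x k i (j - i))"
    using wf unfolding well_founded_def co_well_founded_def by blast
  have "chain_comp (opposite C) x k i (Suc i - i) = k i"
    using Ide_Comp[OF k(1)[of i]] by simp
  then show False using i[rule_format, of "Suc i"] k(2)[of i] is_iso_opposite by auto
qed

lemma is_isoE:
  assumes "is_iso C f" "f \<in> Hom C x y"
  obtains g where "g \<in> Hom C y x" "Comp C g f = Ide C x" "Comp C f g = Ide C y"
  using assms unfolding is_iso_def by (auto simp: Hom_def)

lemma is_iso_inverse:
  assumes "f \<in> Hom C x y" "g \<in> Hom C y x" "Comp C g f = Ide C x" "Comp C f g = Ide C y"
  shows "is_iso C g"
  using assms unfolding is_iso_def by (auto simp: Hom_def)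

lemma is_iso_Comp:
  assumes "f \<in> Hom C x y" "g \<in> Hom C y z" "is_iso C f" "is_iso C g"
  shows "is_iso C (Comp C g f)"
proof -
  obtain f' where f': "f' \<in> Hom C y x" "Comp C f' f = Ide C x" "Comp C f f' = Ide C y" by (rule is_isoE[OF assms(3,1)])
  obtain g' where g': "g' \<in> Hom C z y" "Comp C g' g = Ide C y" "Comp C g g' = Ide C z" by (rule is_isoE[OF assms(4,2)])
  note gf = Comp_closed[OF assms(1,2)] and fg = Comp_closed[OF g'(1) f'(1)]
  have "Comp C (Comp C f' g') (Comp C g f) = Comp C f' (Comp C g' (Comp C g f))"
    using Comp_assoc[OF gf g'(1) f'(1)] by simp
  also have "\<dots> = Ide C x" using Comp_assoc[OF assms(1,2) g'(1)] g'(2) Ide_Comp[OF assms(1)] f'(2) by simp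
  finally have 1: "Comp C (Comp C f' g') (Comp C g f) = Ide C x" .
  have "Comp C (Comp C g f) (Comp C f' g') = Comp C g (Comp C f (Comp C f' g'))"
    using Comp_assoc[OF fg assms(1,2)] by simp
  also have "\<dots> = Ide C z" using Comp_assoc[OF g'(1) f'(1) assms(1)] f'(3) Ide_Comp[OF g'(1)] g'(3) by simp
  finally have 2: "Comp C (Comp C g f) (Comp C f' g') = Ide C z" .
  show ?thesis unfolding is_iso_def using gf fg 1 2 by (auto simp: Hom_def)
qed

definition minimal :: "('o, 'a, 'x set, 'x set_map) functor_data \<Rightarrow> 'o \<Rightarrow> 'x \<Rightarrow> bool" where
  "minimal F n c \<longleftrightarrow> n \<in> Obj C \<and> c \<in> FObj F n \<and>
     (\<forall>w. \<forall>k\<in>Hom C w n. c \<in> act F k ` FObj F w \<longrightarrow> is_iso C k)"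

lemma minimal_support:
  assumes "well_founded C" "psh F" "y \<in> Obj C" "b \<in> FObj F y"
  obtains w m c where "m \<in> Hom C w y" "minimal F w c" "act F m c = b"
proof -
  let ?Q = "\<lambda>w m. b \<in> act F m ` FObj F w"
  have "?Q y (Ide C y)" using act_Ide[OF assms(2-4)] assms(4) by force
  then obtain w m where m: "m \<in> Hom C w y" "b \<in> act F m ` FObj F w"
    and iso: "\<And>v k. k \<in> Hom C v w \<Longrightarrow> ?Q v (Comp C m k) \<Longrightarrow> is_iso C k"
    using well_founded_support[OF assms(1), of ?Q, OF _ Ide_closed[OF assms(3)]] by metis
  then obtain c where c: "c \<in> FObj F w" "act F m c = b" by blast
  have "is_iso C k" if k: "k \<in> Hom C v w" and ck: "c \<in> act F k ` FObj F v" for v k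
  proof (rule iso[OF k])
    from ck obtain d where d: "d \<in> FObj F v" "c = act F k d" by blast
    then have "b = act F (Comp C m k) d" using act_Comp[OF assms(2) k m(1) d(1)] c(2) by simp
    then show "?Q v (Comp C m k)" using d(1) by blast
  qed
  then have "minimal F w c" unfolding minimal_def using c(1) Hom_Obj(1)[OF m(1)] by blast
  then show thesis using that m(1) c(2) by blast
qed

definition stabilizer :: "('o, 'a, 'x set, 'x set_map) functor_data \<Rightarrow> 'o \<Rightarrow> 'x \<Rightarrow> 'a set" where
  "stabilizer F n c = {h \<in> Hom C n n. is_iso C h \<and> act F h c = c}"

lemma subgroup_stabilizer:
  assumes G: "group (Aut C n)" and F: "psh F" and n: "n \<in> Obj C" and c: "c \<in> FObj F n"
  shows "subgroup (stabilizer F n c) (Aut C n)"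
proof -
  have act_inv: "act F (inv\<^bsub>Aut C n\<^esub> h) c = c" if "h \<in> carrier (Aut C n)" "act F h c = c" for h
  proof -
    have "inv\<^bsub>Aut C n\<^esub> h \<in> carrier (Aut C n)" "inv\<^bsub>Aut C n\<^esub> h \<otimes>\<^bsub>Aut C n\<^esub> h = \<one>\<^bsub>Aut C n\<^esub>"
      using group.inv_closed[OF G] group.l_inv[OF G] that by auto
    then have "inv\<^bsub>Aut C n\<^esub> h \<in> Hom C n n" "Comp C (inv\<^bsub>Aut C n\<^esub> h) h = Ide C n" by (simp_all add: Aut_def)
    then show ?thesis using that act_Comp[OF F _ _ c, of h n "inv\<^bsub>Aut C n\<^esub> h" n] act_Ide[OF F n c]
      by (simp add: Aut_def)
  qed
  show ?thesis
  proof (rule subgroup.intro)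
    show "stabilizer F n c \<subseteq> carrier (Aut C n)" by (auto simp: stabilizer_def Aut_def)
    show "x \<otimes>\<^bsub>Aut C n\<^esub> y \<in> stabilizer F n c" if "x \<in> stabilizer F n c" "y \<in> stabilizer F n c" for x y
      using that is_iso_Comp[of y n n x n] Comp_closed[of y n n x n] act_Comp[OF F _ _ c, of y n x n]
      by (auto simp: stabilizer_def Aut_def)
    show "\<one>\<^bsub>Aut C n\<^esub> \<in> stabilizer F n c"
      using group.is_monoid[OF G] monoid.one_closed[of "Aut C n"] act_Ide[OF F n c] by (auto simp: stabilizer_def Aut_def)
    show "inv\<^bsub>Aut C n\<^esub> x \<in> stabilizer F n c" if "x \<in> stabilizer F n c" for x
    proof -
      have x: "x \<in> carrier (Aut C n)" "act F x c = c" using that by (auto simp: stabilizer_def Aut_def)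
      then show ?thesis using group.inv_closed[OF G x(1)] act_inv[OF x] unfolding stabilizer_def by (auto simp: Aut_def)
    qed
  qed
qed

section \<open>Orbits of minimal elements and the subsheaves they generate\<close>

definition orbits :: "('o, 'a, 'x set, 'x set_map) functor_data \<Rightarrow> ('o \<times> 'x) set \<Rightarrow> 'o \<Rightarrow> 'x set" where
  "orbits F E x = {act F f c | n f c. (n, c) \<in> E \<and> f \<in> Hom C n x}"

definition orbit_sheaf :: "('o, 'a, 'x set, 'x set_map) functor_data \<Rightarrow> ('o \<times> 'x) set \<Rightarrow> ('o, 'a, 'x set, 'x set_map) functor_data" where
  "orbit_sheaf F E = mk_psh (orbits F E) (act F)"

end

text \<open>The conclusion of \<open>sheaves_preserve_pullbacks\<close> is taken as an assumption,
  so that from here on only elements of sheaves occur and no longer the canonical functor.\<close>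

locale noetherian_site = atomic_site C for C :: "('o, 'u) category" +
  assumes pullback: "\<And>u v a b d. u \<in> Hom C a d \<Longrightarrow> v \<in> Hom C b d \<Longrightarrow>
      \<exists>w. \<exists>p\<in>Hom C w a. \<exists>q\<in>Hom C w b. Comp C u p = Comp C v q \<and>
      (\<forall>F :: ('o, 'u) presheaf. \<forall>\<alpha>\<in>FObj F a. \<forall>\<beta>\<in>FObj F b. shf F \<longrightarrow> act F u \<alpha> = act F v \<beta> \<longrightarrow>
         (\<exists>\<gamma>\<in>FObj F w. act F p \<gamma> = \<alpha> \<and> act F q \<gamma> = \<beta>))"
    and wf: "well_founded C"
    and noetherian: "\<And>n. n \<in> Obj C \<Longrightarrow> noetherian_group (Aut C n)"
begin

text \<open>Over the object \<open>w\<close> supplied by \<open>pullback\<close>, both elements are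
  induced by one \<open>\<gamma>\<close>. Minimality makes the projections \<open>p\<close> and
  \<open>q\<close> isomorphisms, and \<open>h\<close> is \<open>q\<close> after the inverse of
  \<open>p\<close>.\<close>

lemma minimal_meet:
  fixes F :: "('o, 'u) presheaf"
  assumes F: "shf F" and c: "minimal F n c" and c': "minimal F n' c'"
    and f: "f \<in> Hom C n z" and g: "g \<in> Hom C n' z" and eq: "act F f c = act F g c'"
  obtains h where "h \<in> Hom C n n'" "is_iso C h" "act F h c = c'" "f = Comp C g h"
proof -
  note Fp = shf_psh[OF F]
  have cF: "c \<in> FObj F n" "c' \<in> FObj F n'" using c c' by (auto simp: minimal_def)
  obtain w p q \<gamma> where p: "p \<in> Hom C w n" and q: "q \<in> Hom C w n'" and pq: "Comp C f p = Comp C g q"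
    and \<gamma>: "\<gamma> \<in> FObj F w" "act F p \<gamma> = c" "act F q \<gamma> = c'"
    using pullback[OF f g] cF F eq by blast
  have "is_iso C p" "is_iso C q" using c c' p q \<gamma> unfolding minimal_def by blast+
  obtain p' where p': "p' \<in> Hom C n w" "Comp C p' p = Ide C w" "Comp C p p' = Ide C n"
    using is_isoE[OF \<open>is_iso C p\<close> p] .
  have ip': "is_iso C p'" by (rule is_iso_inverse[OF p p'])
  have "act F p' c = \<gamma>" using act_Comp[OF Fp p p'(1) \<gamma>(1)] p'(2) act_Ide[OF Fp Hom_Obj(1)[OF p] \<gamma>(1)] \<gamma>(2) by simp
  then have "act F (Comp C q p') c = c'" using act_Comp[OF Fp p'(1) q cF(1)] \<gamma>(3) by simp
  moreover have "Comp C g (Comp C q p') = f"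
    using Comp_assoc[OF p'(1) q g] Comp_assoc[OF p'(1) p f] pq p'(3) Comp_Ide[OF f] by simp
  ultimately show thesis
    using that[of "Comp C q p'"] Comp_closed[OF p'(1) q] is_iso_Comp[OF p'(1) q ip' \<open>is_iso C q\<close>] by simp
qed

context
  fixes F :: "('o, 'u) presheaf" and E
  assumes F: "shf F" and E: "\<And>n c. (n, c) \<in> E \<Longrightarrow> minimal F n c"
begin

lemma orbits_subset: "orbits F E x \<subseteq> FObj F x"
  using act_closed[OF shf_psh[OF F]] E unfolding orbits_def minimal_def by blast

lemma orbits_act: assumes "f \<in> Hom C x y" "b \<in> orbits F E x" shows "act F f b \<in> orbits F E y"
proof -
  obtain n g c where g: "b = act F g c" "(n, c) \<in> E" "g \<in> Hom C n x" using assms(2) unfolding orbits_def by blast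
  then have "c \<in> FObj F n" using E by (simp add: minimal_def)
  then have "act F f b = act F (Comp C f g) c" using act_Comp[OF shf_psh[OF F] g(3) assms(1)] g(1) by simp
  then show ?thesis unfolding orbits_def using g(2) Comp_closed[OF g(3) assms(1)] by blast
qed

text \<open>Write \<open>b\<close> as the image of a minimal \<open>d\<close>. Over \<open>y\<close>
  the images of \<open>d\<close> and of a generator \<open>c\<close> coincide, so
  \<open>minimal_meet\<close> exhibits \<open>d\<close> as a translate of \<open>c\<close>.
  Saturation is what makes a union of orbits a subsheaf rather than just a subfunctor.\<close>

lemma orbits_saturated:
  assumes f: "f \<in> Hom C x y" and b: "b \<in> FObj F x" and fb: "act F f b \<in> orbits F E y"
  shows "b \<in> orbits F E x"
proof -
  note Fp = shf_psh[OF F]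
  obtain n g c where g: "act F f b = act F g c" "(n, c) \<in> E" "g \<in> Hom C n y" using fb unfolding orbits_def by blast
  obtain w m d where m: "m \<in> Hom C w x" "minimal F w d" "act F m d = b"
    using minimal_support[OF wf Fp Hom_Obj(1)[OF f] b] .
  have d: "d \<in> FObj F w" and c: "c \<in> FObj F n" using m(2) E[OF g(2)] by (auto simp: minimal_def)
  have "act F g c = act F (Comp C f m) d" using g(1) m(3) act_Comp[OF Fp m(1) f d] by simp
  then obtain h where h: "h \<in> Hom C n w" "act F h c = d"
    using minimal_meet[OF F E[OF g(2)] m(2) g(3) Comp_closed[OF m(1) f]] by blast
  then have "b = act F (Comp C m h) c" using act_Comp[OF Fp h(1) m(1) c] m(3) by simp
  then show ?thesis unfolding orbits_def using g(2) Comp_closed[OF h(1) m(1)] by blast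
qed

lemma orbit_sheaf_Obj [simp]: "x \<in> Obj C \<Longrightarrow> FObj (orbit_sheaf F E) x = orbits F E x"
  by (simp add: orbit_sheaf_def)

lemma orbit_sheaf_act: "f \<in> Hom C x y \<Longrightarrow> a \<in> orbits F E x \<Longrightarrow> act (orbit_sheaf F E) f a = act F f a"
  unfolding orbit_sheaf_def by (rule act_mk_psh)

text \<open>Injectivity is inherited from \<open>F\<close>. An amalgamation is formed in
  \<open>F\<close> and remains in the orbits by \<open>orbits_saturated\<close>.\<close>

lemma shf_orbit_sheaf: "shf (orbit_sheaf F E)"
  unfolding shf_def
proof (intro conjI allI ballI impI)
  note Fp = shf_psh[OF F]
  show "psh (orbit_sheaf F E)"
    unfolding orbit_sheaf_def
  proof (rule psh_mk_psh)
    show "sml (orbits F E x)" if "x \<in> Obj C" for x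
      by (rule small_subset[OF orbits_subset psh_small[OF Fp that]])
    show "act F (Ide C x) a = a" if "x \<in> Obj C" "a \<in> orbits F E x" for x a
      using act_Ide[OF Fp that(1)] that(2) orbits_subset by blast
    show "act F (Comp C g f) a = act F g (act F f a)" if "f \<in> Hom C x y" "g \<in> Hom C y z" "a \<in> orbits F E x" for f g x y z a
      using act_Comp[OF Fp that(1,2)] that(3) orbits_subset by blast
  qed (rule orbits_act)
  fix x y f assume f: "f \<in> Hom C x y"
  note x = Hom_Obj(1)[OF f] and y = Hom_Obj(2)[OF f]
  show "inj_on (act (orbit_sheaf F E) f) (FObj (orbit_sheaf F E) x)"
  proof (rule inj_onI)
    fix a b assume ab: "a \<in> FObj (orbit_sheaf F E) x" "b \<in> FObj (orbit_sheaf F E) x" "act (orbit_sheaf F E) f a = act (orbit_sheaf F E) f b"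
    then have o: "a \<in> orbits F E x" "b \<in> orbits F E x" using x by auto
    then have "act F f a = act F f b" using ab(3) orbit_sheaf_act[OF f] by simp
    then show "a = b" using shf_inj[OF F f] o orbits_subset by blast
  qed
  fix b assume "b \<in> FObj (orbit_sheaf F E) y" and compat: "\<forall>z. \<forall>g\<in>Hom C y z. \<forall>h\<in>Hom C y z.
    Comp C g f = Comp C h f \<longrightarrow> act (orbit_sheaf F E) g b = act (orbit_sheaf F E) h b"
  then have b: "b \<in> orbits F E y" using y by simp
  then have bF: "b \<in> FObj F y" using orbits_subset by blast
  obtain a where a: "a \<in> FObj F x" "act F f a = b"
  proof (rule shf_glue[OF F f bF])
    show "act F g b = act F h b" if "g \<in> Hom C y z" "h \<in> Hom C y z" "Comp C g f = Comp C h f" for z g h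
      using compat that orbit_sheaf_act[OF _ b] by metis
  qed
  then have "a \<in> orbits F E x" using orbits_saturated[OF f a(1)] b by simp
  then show "b \<in> act (orbit_sheaf F E) f ` FObj (orbit_sheaf F E) x"
    using a(2) orbit_sheaf_act[OF f] x by (metis imageI orbit_sheaf_Obj)
qed

lemma orbit_sheaf_minimal:
  assumes "(n, c) \<in> E" shows "minimal (orbit_sheaf F E) n c"
proof -
  note min = E[OF assms]
  then have n: "n \<in> Obj C" and c: "c \<in> FObj F n" by (auto simp: minimal_def)
  have "c = act F (Ide C n) c" using act_Ide[OF shf_psh[OF F] n c] by simp
  then have cE: "c \<in> orbits F E n" unfolding orbits_def using assms Ide_closed[OF n] by blast
  have "is_iso C k" if k: "k \<in> Hom C w n" and "c \<in> act (orbit_sheaf F E) k ` FObj (orbit_sheaf F E) w" for w k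
  proof -
    have "c \<in> act F k ` FObj F w" using that(2) orbit_sheaf_act[OF k] orbit_sheaf_Obj[OF Hom_Obj(1)[OF k]] orbits_subset by fastforce
    then show ?thesis using min k unfolding minimal_def by blast
  qed
  then show ?thesis unfolding minimal_def using n cE by simp
qed

lemma orbit_sheaf_inclusion: "natural (orbit_sheaf F E) F (\<lambda>x a. a)"
  unfolding natural_def using orbits_subset orbit_sheaf_act Hom_Obj by auto

end
end

section \<open>Colimits of sheaves\<close>

lemma filteredD:
  assumes "filtered J"
  shows "category J" "Obj J \<noteq> {}"
    "i \<in> Obj J \<Longrightarrow> j \<in> Obj J \<Longrightarrow> \<exists>k. \<exists>u\<in>Hom J i k. \<exists>v\<in>Hom J j k. True"
    "u \<in> Hom J i j \<Longrightarrow> v \<in> Hom J i j \<Longrightarrow> \<exists>k. \<exists>w\<in>Hom J j k. Comp J w u = Comp J w v"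
proof -
  show c: "category J" "Obj J \<noteq> {}" using assms by (auto simp: filtered_def)
  show "\<exists>k. \<exists>u\<in>Hom J i k. \<exists>v\<in>Hom J j k. True" if "i \<in> Obj J" "j \<in> Obj J"
    using assms that unfolding filtered_def by blast
  show "\<exists>k. \<exists>w\<in>Hom J j k. Comp J w u = Comp J w v" if "u \<in> Hom J i j" "v \<in> Hom J i j"
    using assms that category.Hom_Obj[OF c(1) that(1)] unfolding filtered_def by blast
qed

lemma filtered_span:
  assumes J: "filtered J" and u: "u \<in> Hom J i k" and v: "v \<in> Hom J i l"
  obtains w x y where "x \<in> Hom J k w" "y \<in> Hom J l w" "Comp J x u = Comp J y v"
proof -
  interpret J: category J by (rule filteredD(1)[OF J])
  obtain z a b where ab: "a \<in> Hom J k z" "b \<in> Hom J l z" using filteredD(3)[OF J J.Hom_Obj(2)[OF u] J.Hom_Obj(2)[OF v]] by blast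
  obtain w e where e: "e \<in> Hom J z w" "Comp J e (Comp J a u) = Comp J e (Comp J b v)"
    using filteredD(4)[OF J J.Comp_closed[OF u ab(1)] J.Comp_closed[OF v ab(2)]] by blast
  then have "Comp J (Comp J e a) u = Comp J (Comp J e b) v"
    using J.Comp_assoc[OF u ab(1) e(1)] J.Comp_assoc[OF v ab(2) e(1)] by simp
  then show thesis using that J.Comp_closed[OF ab(1) e(1)] J.Comp_closed[OF ab(2) e(1)] by blast
qed

text \<open>An identification made by \<open>\<iota>\<close> is already made at some stage, and
  \<open>\<tau>\<close> does not change along the diagram. The families of sets are arbitrary, so
  that the lemma covers both values of sheaves and Hom-sets.\<close>

lemma filtered_glue:
  assumes J: "filtered J"
    and tr_closed: "\<And>i k u a. u \<in> Hom J i k \<Longrightarrow> a \<in> A i \<Longrightarrow> tr u a \<in> A k"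
    and \<iota>: "\<And>i k u a. u \<in> Hom J i k \<Longrightarrow> a \<in> A i \<Longrightarrow> \<iota> k (tr u a) = \<iota> i a"
    and \<tau>: "\<And>i k u a. u \<in> Hom J i k \<Longrightarrow> a \<in> A i \<Longrightarrow> \<tau> k (tr u a) = \<tau> i a"
    and inj: "\<And>i a b. i \<in> Obj J \<Longrightarrow> a \<in> A i \<Longrightarrow> b \<in> A i \<Longrightarrow> \<iota> i a = \<iota> i b \<Longrightarrow> \<exists>k. \<exists>u\<in>Hom J i k. tr u a = tr u b"
    and ij: "i \<in> Obj J" "j \<in> Obj J" and ab: "a \<in> A i" "b \<in> A j" "\<iota> i a = \<iota> j b"
  shows "\<tau> i a = \<tau> j b"
proof -
  interpret J: category J by (rule filteredD(1)[OF J])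
  obtain k u v where uv: "u \<in> Hom J i k" "v \<in> Hom J j k" using filteredD(3)[OF J ij] by blast
  have "\<iota> k (tr u a) = \<iota> k (tr v b)" using \<iota>[OF uv(1) ab(1)] \<iota>[OF uv(2) ab(2)] ab(3) by simp
  then obtain l w where w: "w \<in> Hom J k l" "tr w (tr u a) = tr w (tr v b)"
    using inj[OF J.Hom_Obj(2)[OF uv(1)] tr_closed[OF uv(1) ab(1)] tr_closed[OF uv(2) ab(2)]] by blast
  have "\<tau> i a = \<tau> l (tr w (tr u a))" using \<tau>[OF uv(1) ab(1)] \<tau>[OF w(1) tr_closed[OF uv(1) ab(1)]] by simp
  also have "\<dots> = \<tau> j b" using \<tau>[OF uv(2) ab(2)] \<tau>[OF w(1) tr_closed[OF uv(2) ab(2)]] w(2) by simp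
  finally show ?thesis .
qed

lemma cocone_Comp:
  assumes "category J" "cocone J K D c \<iota>" "u \<in> Hom J i k"
  shows "Comp K (\<iota> k) (FArr D u) = \<iota> i"
  using assms by (auto simp: cocone_def Hom_def)

lemma cocone_Hom: "cocone J K D c \<iota> \<Longrightarrow> i \<in> Obj J \<Longrightarrow> \<iota> i \<in> Hom K (FObj D i) c"
  by (simp add: cocone_def)

lemma cat_functor_hom_functor:
  fixes K :: "('o, 'a) category"
  assumes "category K" and p: "p \<in> Obj K" and sm: "\<And>x. x \<in> Obj K \<Longrightarrow> small U (Hom K p x)"
  shows "cat_functor K (set_category U) (hom_functor K p)"
proof -
  interpret K: category K by fact
  show ?thesis
  proof (intro cat_functor.intro cat_functor_axioms.intro K.category_axioms category_set_category)
    show "FObj (hom_functor K p) \<in> Obj K \<rightarrow>\<^sub>E Obj (set_category U)" using sm by (simp add: hom_functor_def)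
    show "FArr (hom_functor K p) \<in> extensional (Arr K)" by (simp add: hom_functor_def)
    show "FArr (hom_functor K p) f \<in> Hom (set_category U) (FObj (hom_functor K p) x) (FObj (hom_functor K p) y)"
      if f: "f \<in> Hom K x y" for f x y
      using K.Hom_Obj[OF f] HomD[OF f] f sm K.Comp_closed[OF _ f]
      by (auto simp: hom_functor_def Hom_set_category)
    show "FArr (hom_functor K p) (Ide K x) = Ide (set_category U) (FObj (hom_functor K p) x)"
      if x: "x \<in> Obj K" for x
      using x HomD[OF K.Ide_closed[OF x]] K.Ide_Comp by (auto simp: hom_functor_def)
    show "FArr (hom_functor K p) (Comp K g f) = Comp (set_category U) (FArr (hom_functor K p) g) (FArr (hom_functor K p) f)"
      if f: "f \<in> Hom K x y" and g: "g \<in> Hom K y z" for f g x y z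
      using HomD[OF f] HomD[OF g] HomD[OF K.Comp_closed[OF f g]] K.Comp_closed[OF _ f] K.Comp_assoc[OF _ f g]
      by (auto simp: hom_functor_def intro!: restrict_ext)
  qed
qed

text \<open>\<open>surj\<close> and \<open>inj\<close> are the elementwise description of a filtered
  colimit of sets, here of the sets \<open>Hom K p (FObj D i)\<close>. A competing cocone defines a
  function on \<open>Hom K p c\<close>, well defined by \<open>filtered_glue\<close>.\<close>

lemma hom_functor_preserves_colimitI:
  fixes K :: "('o, 'a) category"
  assumes J: "filtered J" and H: "cat_functor K (set_category U) (hom_functor K p)"
    and D: "cat_functor J K D" and cc: "cocone J K D c \<iota>"
    and surj: "\<And>m. m \<in> Hom K p c \<Longrightarrow> \<exists>i\<in>Obj J. \<exists>\<phi>\<in>Hom K p (FObj D i). m = Comp K (\<iota> i) \<phi>"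
    and inj: "\<And>i \<phi> \<psi>. i \<in> Obj J \<Longrightarrow> \<phi> \<in> Hom K p (FObj D i) \<Longrightarrow> \<psi> \<in> Hom K p (FObj D i) \<Longrightarrow>
       Comp K (\<iota> i) \<phi> = Comp K (\<iota> i) \<psi> \<Longrightarrow> \<exists>k. \<exists>u\<in>Hom J i k. Comp K (FArr D u) \<phi> = Comp K (FArr D u) \<psi>"
  shows "is_colimit J (set_category U) (functor_comp J (hom_functor K p) D)
          (FObj (hom_functor K p) c) (\<lambda>i. FArr (hom_functor K p) (\<iota> i))"
proof -
  interpret J: category J by (rule filteredD(1)[OF J])
  interpret D: cat_functor J K D by fact
  interpret H: cat_functor K "set_category U" "hom_functor K p" by fact
  let ?H = "hom_functor K p" and ?S = "set_category U" and ?G = "functor_comp J (hom_functor K p) D"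
  have c: "c \<in> Obj K" using cc by (simp add: cocone_def)
  have DO: "FObj D i \<in> Obj K" if "i \<in> Obj J" for i using D.FObj_closed that by auto
  have HO: "FObj ?H x = Hom K p x" if "x \<in> Obj K" for x using that by (simp add: hom_functor_def)
  have Hc: "small U (Hom K p c)" using PiE_mem[OF H.FObj_closed c] HO[OF c] by simp
  have GO: "FObj ?G i = Hom K p (FObj D i)" if "i \<in> Obj J" for i using that HO[OF DO[OF that]] by (simp add: functor_comp_def)
  have HA: "FArr ?H m = (Hom K p x, \<lambda>g\<in>Hom K p x. Comp K m g, Hom K p y)" if "m \<in> Hom K x y" for m x y
    using HomD[OF that] by (simp add: hom_functor_def)
  have cone: "cocone J ?S ?G (FObj ?H c) (\<lambda>i. FArr ?H (\<iota> i))"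
    unfolding cocone_def
  proof (intro conjI ballI)
    show "FObj ?H c \<in> Obj ?S" using Hc HO[OF c] by simp
    show "FArr ?H (\<iota> i) \<in> Hom ?S (FObj ?G i) (FObj ?H c)" if i: "i \<in> Obj J" for i
      using H.FArr_closed[OF cocone_Hom[OF cc i]] i by (simp add: functor_comp_def)
    fix u assume uA: "u \<in> Arr J"
    note u = HomI[OF uA]
    have "FArr ?H (Comp K (\<iota> (Cod J u)) (FArr D u)) = Comp ?S (FArr ?H (\<iota> (Cod J u))) (FArr ?H (FArr D u))"
      by (rule H.FArr_Comp[OF D.FArr_closed[OF u] cocone_Hom[OF cc J.Hom_Obj(2)[OF u]]])
    then show "Comp ?S (FArr ?H (\<iota> (Cod J u))) (FArr ?G u) = FArr ?H (\<iota> (Dom J u))"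
      using cocone_Comp[OF J.category_axioms cc u] uA by (simp add: functor_comp_def)
  qed
  have "\<exists>!h. h \<in> Hom ?S (FObj ?H c) d \<and> (\<forall>i\<in>Obj J. Comp ?S h (FArr ?H (\<iota> i)) = \<tau> i)"
    if \<tau>: "cocone J ?S ?G d \<tau>" for d \<tau>
  proof -
    define t where "t i = map_fun_of (\<tau> i)" for i
    have d: "small U d" using \<tau> by (simp add: cocone_def)
    have t: "\<tau> i = (Hom K p (FObj D i), t i, d) \<and> t i \<in> Hom K p (FObj D i) \<rightarrow>\<^sub>E d" if "i \<in> Obj J" for i
      using cocone_Hom[OF \<tau> that] GO[OF that] by (auto simp: Hom_set_category t_def)
    have t_tr: "t k (Comp K (FArr D u) \<phi>) = t i \<phi>" if u: "u \<in> Hom J i k" and \<phi>: "\<phi> \<in> Hom K p (FObj D i)" for u i k \<phi>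
    proof -
      have "Comp ?S (\<tau> k) (FArr ?G u) = \<tau> i" by (rule cocone_Comp[OF J.category_axioms \<tau> u])
      moreover have "FArr ?G u = FArr ?H (FArr D u)" using u by (simp add: functor_comp_def Hom_def)
      ultimately have "(\<lambda>g\<in>Hom K p (FObj D i). t k (Comp K (FArr D u) g)) = t i"
        using t[OF J.Hom_Obj(1)[OF u]] t[OF J.Hom_Obj(2)[OF u]] HA[OF D.FArr_closed[OF u]] by (auto cong: restrict_cong)
      then show ?thesis using \<phi> by (metis restrict_apply')
    qed
    have \<iota>_tr: "Comp K (\<iota> k) (Comp K (FArr D u) \<phi>) = Comp K (\<iota> i) \<phi>" if u: "u \<in> Hom J i k" and \<phi>: "\<phi> \<in> Hom K p (FObj D i)" for u i k \<phi>
      using D.cod.Comp_assoc[OF \<phi> D.FArr_closed[OF u] cocone_Hom[OF cc J.Hom_Obj(2)[OF u]]] cocone_Comp[OF J.category_axioms cc u] by simp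
    have glue: "t i \<phi> = t j \<psi>" if "i \<in> Obj J" "j \<in> Obj J" "\<phi> \<in> Hom K p (FObj D i)" "\<psi> \<in> Hom K p (FObj D j)"
      "Comp K (\<iota> i) \<phi> = Comp K (\<iota> j) \<psi>" for i j \<phi> \<psi>
    proof (rule filtered_glue[OF J, where A = "\<lambda>i. Hom K p (FObj D i)" and tr = "\<lambda>u. Comp K (FArr D u)" and \<iota> = "\<lambda>i. Comp K (\<iota> i)" and \<tau> = t])
      show "Comp K (FArr D u) a \<in> Hom K p (FObj D k)" if "u \<in> Hom J i k" "a \<in> Hom K p (FObj D i)" for i k u a
        by (rule D.cod.Comp_closed[OF that(2) D.FArr_closed[OF that(1)]])
    qed (use that \<iota>_tr t_tr inj in auto)
    define h where "h m = (SOME e. \<exists>i\<in>Obj J. \<exists>\<phi>\<in>Hom K p (FObj D i). m = Comp K (\<iota> i) \<phi> \<and> e = t i \<phi>)" for m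
    have h: "h (Comp K (\<iota> i) \<phi>) = t i \<phi>" if i: "i \<in> Obj J" and \<phi>: "\<phi> \<in> Hom K p (FObj D i)" for i \<phi>
    proof -
      have "\<exists>j\<in>Obj J. \<exists>\<psi>\<in>Hom K p (FObj D j). Comp K (\<iota> i) \<phi> = Comp K (\<iota> j) \<psi> \<and> h (Comp K (\<iota> i) \<phi>) = t j \<psi>"
        unfolding h_def by (rule someI[of _ "t i \<phi>"]) (use i \<phi> in blast)
      then show ?thesis using glue[OF i _ \<phi>] by metis
    qed
    have h_d: "h m \<in> d" if m: "m \<in> Hom K p c" for m
    proof -
      obtain i \<phi> where i: "i \<in> Obj J" "\<phi> \<in> Hom K p (FObj D i)" "m = Comp K (\<iota> i) \<phi>" using surj[OF m] by blast
      then show ?thesis using h t[OF i(1)] by auto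
    qed
    let ?h = "(Hom K p c, \<lambda>m\<in>Hom K p c. h m, d)"
    have \<iota>A: "FArr ?H (\<iota> i) = (Hom K p (FObj D i), \<lambda>g\<in>Hom K p (FObj D i). Comp K (\<iota> i) g, Hom K p c)" if "i \<in> Obj J" for i
      by (rule HA[OF cocone_Hom[OF cc that]])
    have \<iota>c: "Comp K (\<iota> i) \<phi> \<in> Hom K p c" if "i \<in> Obj J" "\<phi> \<in> Hom K p (FObj D i)" for i \<phi>
      by (rule D.cod.Comp_closed[OF that(2) cocone_Hom[OF cc that(1)]])
    have hH: "?h \<in> Hom ?S (FObj ?H c) d" using HO[OF c] Hc d h_d by (simp add: Hom_set_category)
    have "Comp ?S ?h (FArr ?H (\<iota> i)) = \<tau> i" if i: "i \<in> Obj J" for i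
    proof -
      have "(\<lambda>g\<in>Hom K p (FObj D i). restrict h (Hom K p c) (restrict (Comp K (\<iota> i)) (Hom K p (FObj D i)) g)) = t i"
        using t[OF i] h[OF i] \<iota>c[OF i] by (intro extensionalityI[of _ "Hom K p (FObj D i)"]) (auto simp: PiE_def)
      then show ?thesis using t[OF i] \<iota>A[OF i] by simp
    qed
    moreover have "h' = ?h" if h': "h' \<in> Hom ?S (FObj ?H c) d" "\<forall>i\<in>Obj J. Comp ?S h' (FArr ?H (\<iota> i)) = \<tau> i" for h'
    proof -
      obtain k where k: "h' = (Hom K p c, k, d)" "k \<in> Hom K p c \<rightarrow>\<^sub>E d" using h'(1) HO[OF c] by (auto simp: Hom_set_category)
      have "k m = h m" if m: "m \<in> Hom K p c" for m
      proof -
        obtain i \<phi> where i: "i \<in> Obj J" "\<phi> \<in> Hom K p (FObj D i)" "m = Comp K (\<iota> i) \<phi>" using surj[OF m] by blast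
        have "map_fun_of (Comp ?S h' (FArr ?H (\<iota> i))) \<phi> = t i \<phi>" using h'(2) i(1) unfolding t_def by simp
        then show ?thesis using i k(1) \<iota>A[OF i(1)] h by simp
      qed
      then have "k = (\<lambda>m\<in>Hom K p c. h m)" using k(2) by (intro extensionalityI[of _ "Hom K p c"]) (auto simp: PiE_def)
      then show ?thesis using k(1) by simp
    qed
    ultimately show ?thesis using hH by blast
  qed
  then show ?thesis unfolding is_colimit_def using cone by blast
qed

context atomic_site
begin

text \<open>The elementwise criterion for filtered colimits, applied over each object. That the
  pointwise colimit is a sheaf is not claimed here; it is contained in the assumption that
  \<open>F\<close> carries a cocone in \<open>Sh\<close>.\<close>

lemma filtered_colimit_ShI:
  assumes J: "filtered J" and D: "cat_functor J Sh D" and cc: "cocone J Sh D F \<iota>"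
    and surj: "\<And>x b. x \<in> Obj C \<Longrightarrow> b \<in> FObj F x \<Longrightarrow> \<exists>i\<in>Obj J. \<exists>a\<in>FObj (FObj D i) x. b = app (\<iota> i) x a"
    and inj: "\<And>x i a b. x \<in> Obj C \<Longrightarrow> i \<in> Obj J \<Longrightarrow> a \<in> FObj (FObj D i) x \<Longrightarrow> b \<in> FObj (FObj D i) x \<Longrightarrow>
       app (\<iota> i) x a = app (\<iota> i) x b \<Longrightarrow> \<exists>k. \<exists>u\<in>Hom J i k. app (FArr D u) x a = app (FArr D u) x b"
  shows "is_colimit J Sh D F \<iota>"
proof -
  interpret J: category J by (rule filteredD(1)[OF J])
  interpret D: cat_functor J Sh D by fact
  have F: "shf F" using cc by (simp add: cocone_def)
  have D_Sh: "shf (FObj D i)" if "i \<in> Obj J" for i using D.FObj_closed that by auto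
  have cone_tr: "app (\<tau> k) x (app (FArr D u) x a) = app (\<tau> i) x a"
    if "cocone J Sh D G \<tau>" "u \<in> Hom J i k" "x \<in> Obj C" "a \<in> FObj (FObj D i) x" for G \<tau> u i k x a
    using Sh_app_Comp[OF D.FArr_closed[OF that(2)] cocone_Hom[OF that(1) J.Hom_Obj(2)[OF that(2)]] that(3,4)]
      cocone_Comp[OF J.category_axioms that(1,2)] by simp
  have "\<exists>!h. h \<in> Hom Sh F G \<and> (\<forall>i\<in>Obj J. Comp Sh h (\<iota> i) = \<tau> i)" if \<tau>: "cocone J Sh D G \<tau>" for G \<tau>
  proof -
    have G: "shf G" using \<tau> by (simp add: cocone_def)
    have glue: "app (\<tau> i) x a = app (\<tau> j) x b" if x: "x \<in> Obj C" and "i \<in> Obj J" "j \<in> Obj J"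
      "a \<in> FObj (FObj D i) x" "b \<in> FObj (FObj D j) x" "app (\<iota> i) x a = app (\<iota> j) x b" for x i j a b
    proof (rule filtered_glue[OF J, where A = "\<lambda>i. FObj (FObj D i) x" and tr = "\<lambda>u. app (FArr D u) x" and \<iota> = "\<lambda>i. app (\<iota> i) x" and \<tau> = "\<lambda>i. app (\<tau> i) x"])
      show "app (FArr D u) x a \<in> FObj (FObj D k) x" if "u \<in> Hom J i k" "a \<in> FObj (FObj D i) x" for i k u a
        by (rule Sh_app_closed[OF D.FArr_closed[OF that(1)] x that(2)])
    qed (use that cone_tr[OF cc _ x] cone_tr[OF \<tau> _ x] inj[OF x] in auto)
    define h where "h x b = (SOME e. \<exists>i\<in>Obj J. \<exists>a\<in>FObj (FObj D i) x. b = app (\<iota> i) x a \<and> e = app (\<tau> i) x a)" for x b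
    have h: "h x (app (\<iota> i) x a) = app (\<tau> i) x a" if x: "x \<in> Obj C" and i: "i \<in> Obj J" and a: "a \<in> FObj (FObj D i) x" for x i a
    proof -
      have "\<exists>j\<in>Obj J. \<exists>b\<in>FObj (FObj D j) x. app (\<iota> i) x a = app (\<iota> j) x b \<and> h x (app (\<iota> i) x a) = app (\<tau> j) x b"
        unfolding h_def by (rule someI[of _ "app (\<tau> i) x a"]) (use i a in blast)
      then show ?thesis using glue[OF x i _ a] by metis
    qed
    have "natural F G h"
      unfolding natural_def
    proof (intro conjI ballI allI)
      show "h x b \<in> FObj G x" if x: "x \<in> Obj C" and b: "b \<in> FObj F x" for x b
      proof -
        obtain i a where i: "i \<in> Obj J" "a \<in> FObj (FObj D i) x" "b = app (\<iota> i) x a" using surj[OF x b] by blast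
        then show ?thesis using h[OF x i(1,2)] Sh_app_closed[OF cocone_Hom[OF \<tau> i(1)] x i(2)] by simp
      qed
      fix x y f b assume f: "f \<in> Hom C x y" and b: "b \<in> FObj F x"
      note x = Hom_Obj(1)[OF f] and y = Hom_Obj(2)[OF f]
      obtain i a where i: "i \<in> Obj J" "a \<in> FObj (FObj D i) x" "b = app (\<iota> i) x a" using surj[OF x b] by blast
      note fa = act_closed[OF shf_psh[OF D_Sh[OF i(1)]] f i(2)]
      have "h y (act F f b) = h y (app (\<iota> i) y (act (FObj D i) f a))"
        using Sh_app_act[OF cocone_Hom[OF cc i(1)] f i(2)] i(3) by simp
      also have "\<dots> = act G f (h x b)"
        using h[OF y i(1) fa] h[OF x i(1,2)] Sh_app_act[OF cocone_Hom[OF \<tau> i(1)] f i(2)] i(3) by simp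
      finally show "h y (act F f b) = act G f (h x b)" .
    qed
    note hH = Sh_map[OF F G this]
    have "Comp Sh (mk_map F h G) (\<iota> i) = \<tau> i" if i: "i \<in> Obj J" for i
    proof (rule Sh_map_eqI[OF category.Comp_closed[OF category_Sh cocone_Hom[OF cc i] hH] cocone_Hom[OF \<tau> i]])
      fix x a assume "x \<in> Obj C" "a \<in> FObj (FObj D i) x"
      then show "app (Comp Sh (mk_map F h G) (\<iota> i)) x a = app (\<tau> i) x a"
        using Sh_app_Comp[OF cocone_Hom[OF cc i] hH] Sh_app_closed[OF cocone_Hom[OF cc i]] h i by simp
    qed
    moreover have "h1 = h2" if "h1 \<in> Hom Sh F G" "h2 \<in> Hom Sh F G" "\<forall>i\<in>Obj J. Comp Sh h1 (\<iota> i) = \<tau> i" "\<forall>i\<in>Obj J. Comp Sh h2 (\<iota> i) = \<tau> i" for h1 h2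
    proof (rule Sh_map_eqI[OF that(1,2)])
      fix x b assume x: "x \<in> Obj C" and b: "b \<in> FObj F x"
      obtain i a where i: "i \<in> Obj J" "a \<in> FObj (FObj D i) x" "b = app (\<iota> i) x a" using surj[OF x b] by blast
      then show "app h1 x b = app h2 x b"
        using Sh_app_Comp[OF cocone_Hom[OF cc i(1)] that(1) x i(2)] Sh_app_Comp[OF cocone_Hom[OF cc i(1)] that(2) x i(2)] that(3,4) by simp
    qed
    ultimately show ?thesis using hH by blast
  qed
  then show ?thesis unfolding is_colimit_def using cc by blast
qed

text \<open>Raw input for \<open>completion\<close>: the disjoint union of the values at all stages,
  not yet divided by anything. The congruence is supplied by the application, through all cocones
  for general colimits and through germs for filtered ones.\<close>

definition elements :: "('i, 'j, ('o, 'u) presheaf, 'm) functor_data \<Rightarrow> ('i, 'j) category \<Rightarrow> 'o \<Rightarrow> ('i \<times> 'u) set" where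
  "elements D J x = (SIGMA i : Obj J. FObj (FObj D i) x)"

definition elements_act :: "('i, 'j, ('o, 'u) presheaf, 'm) functor_data \<Rightarrow> 'u \<Rightarrow> 'i \<times> 'u \<Rightarrow> 'i \<times> 'u" where
  "elements_act D f = (\<lambda>(i, a). (i, act (FObj D i) f a))"

lemma elements_raw:
  assumes D: "cat_functor J Sh D" and sm: "sml (Arr J)"
  shows "x \<in> Obj C \<Longrightarrow> sml (elements D J x)"
    and "f \<in> Hom C x y \<Longrightarrow> r \<in> elements D J x \<Longrightarrow> elements_act D f r \<in> elements D J y"
    and "x \<in> Obj C \<Longrightarrow> r \<in> elements D J x \<Longrightarrow> elements_act D (Ide C x) r = r"
    and "f \<in> Hom C x y \<Longrightarrow> g \<in> Hom C y z \<Longrightarrow> r \<in> elements D J x \<Longrightarrow>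
      elements_act D (Comp C g f) r = elements_act D g (elements_act D f r)"
proof -
  interpret D: cat_functor J Sh D by fact
  have P: "psh (FObj D i)" if "i \<in> Obj J" for i
    using PiE_mem[OF D.FObj_closed that] by (intro shf_psh) simp
  show "sml (elements D J x)" if "x \<in> Obj C"
    unfolding elements_def by (rule small_Sigma[OF D.dom.small_Obj_if_small_Arr[OF sm] psh_small[OF P that]])
  show "elements_act D f r \<in> elements D J y" if "f \<in> Hom C x y" "r \<in> elements D J x"
    using that act_closed[OF P] by (auto simp: elements_def elements_act_def)
  show "elements_act D (Ide C x) r = r" if "x \<in> Obj C" "r \<in> elements D J x"
    using that act_Ide[OF P] by (auto simp: elements_def elements_act_def)
  show "elements_act D (Comp C g f) r = elements_act D g (elements_act D f r)"
    if "f \<in> Hom C x y" "g \<in> Hom C y z" "r \<in> elements D J x"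
    using that act_Comp[OF P] by (auto simp: elements_def elements_act_def)
qed

text \<open>The hypothesis on \<open>q\<close> says that the diagram moves a raw element only within
  its class, which is the cocone equation; naturality of the legs is naturality of
  \<open>\<eta>\<close>.\<close>

lemma completion_cocone:
  assumes D: "cat_functor J Sh D" and comp: "completion_of (elements D J) (elements_act D) q S \<eta>"
    and q: "\<And>i k u x a. u \<in> Hom J i k \<Longrightarrow> x \<in> Obj C \<Longrightarrow> a \<in> FObj (FObj D i) x \<Longrightarrow>
      q x (k, app (FArr D u) x a) (i, a)"
  shows "cocone J Sh D S (\<lambda>i. mk_map (FObj D i) (\<lambda>x a. \<eta> x (i, a)) S)"
proof -
  interpret D: cat_functor J Sh D by fact
  note C = completion_ofD[OF comp]
  let ?\<iota> = "\<lambda>i. mk_map (FObj D i) (\<lambda>x a. \<eta> x (i, a)) S"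
  have el: "(i, a) \<in> elements D J x \<longleftrightarrow> i \<in> Obj J \<and> a \<in> FObj (FObj D i) x" for i a x by (simp add: elements_def)
  have \<iota>: "?\<iota> i \<in> Hom Sh (FObj D i) S" if i: "i \<in> Obj J" for i
  proof (rule Sh_map[OF _ C(1)])
    show "shf (FObj D i)" using PiE_mem[OF D.FObj_closed i] by simp
    show "natural (FObj D i) S (\<lambda>x a. \<eta> x (i, a))"
      unfolding natural_def
    proof (intro conjI ballI allI)
      show "\<eta> x (i, a) \<in> FObj S x" if "x \<in> Obj C" "a \<in> FObj (FObj D i) x" for x a using C(2) that i el by simp
      show "\<eta> y (i, act (FObj D i) f a) = act S f (\<eta> x (i, a))" if "f \<in> Hom C x y" "a \<in> FObj (FObj D i) x" for x y f a
        using C(4)[OF that(1), of "(i, a)"] that i el by (simp add: elements_act_def)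
    qed
  qed
  show ?thesis
    unfolding cocone_def
  proof (intro conjI ballI \<iota>)
    show "S \<in> Obj Sh" using C(1) by simp
    fix u assume "u \<in> Arr J"
    note u = HomI[OF this]
    note Du = D.FArr_closed[OF u] and i = D.dom.Hom_Obj(1)[OF u] and k = D.dom.Hom_Obj(2)[OF u]
    show "Comp Sh (?\<iota> (Cod J u)) (FArr D u) = ?\<iota> (Dom J u)"
    proof (rule Sh_map_eqI[OF category.Comp_closed[OF category_Sh Du \<iota>[OF k]] \<iota>[OF i]])
      fix x a assume x: "x \<in> Obj C" and a: "a \<in> FObj (FObj D (Dom J u)) x"
      note Dua = Sh_app_closed[OF Du x a]
      have "\<eta> x (Cod J u, app (FArr D u) x a) = \<eta> x (Dom J u, a)"
        using C(5)[OF x, of "(Cod J u, app (FArr D u) x a)" "(Dom J u, a)"] q[OF u x a] el a Dua i k by simp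
      then show "app (Comp Sh (?\<iota> (Cod J u)) (FArr D u)) x a = app (?\<iota> (Dom J u)) x a"
        using Sh_app_Comp[OF Du \<iota>[OF k] x a] x a Dua by simp
    qed
  qed
qed

text \<open>Elements are identified as soon as every cocone does so, which makes the universal property
  immediate.\<close>

theorem cocomplete_Sh: "cocomplete TYPE('u) Sh"
  unfolding cocomplete_def
proof (intro allI impI, elim conjE)
  fix J :: "('u, 'u) category" and D
  assume "small_category TYPE('u) J" and D: "cat_functor J Sh D"
  then have sm: "sml (Arr J)" by (simp add: small_category_def)
  interpret D: cat_functor J Sh D by fact
  have D_Sh: "shf (FObj D i)" if "i \<in> Obj J" for i using D.FObj_closed that by auto
  define val where "val = (\<lambda>(\<tau> :: 'u \<Rightarrow> ('o, 'u) presheaf_map) x (i, a). app (\<tau> i) x a)"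
  define q where "q x r s \<longleftrightarrow> (\<forall>F \<tau>. cocone J Sh D F \<tau> \<longrightarrow> val \<tau> x r = val \<tau> x s)" for x r s
  note raw = elements_raw[OF D sm]
  have val_closed: "val \<tau> x r \<in> FObj F x" if "cocone J Sh D F \<tau>" "x \<in> Obj C" "r \<in> elements D J x" for F \<tau> x r
    using that Sh_app_closed[OF cocone_Hom[OF that(1)]] by (auto simp: val_def elements_def)
  have val_act: "val \<tau> y (elements_act D f r) = act F f (val \<tau> x r)" if "cocone J Sh D F \<tau>" "f \<in> Hom C x y" "r \<in> elements D J x" for F \<tau> x y f r
    using that Sh_app_act[OF cocone_Hom[OF that(1)] that(2)] by (auto simp: val_def elements_def elements_act_def)
  have cone_Sh: "shf F" if "cocone J Sh D F \<tau>" for F \<tau> using that by (simp add: cocone_def)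
  obtain S \<eta> where comp: "completion_of (elements D J) (elements_act D) q S \<eta>"
  proof (rule completion[of "elements D J" "elements_act D" q, OF raw])
    note found = that
    show "q y (elements_act D f r) (elements_act D f s)"
      if "f \<in> Hom C x y" "r \<in> elements D J x" "s \<in> elements D J x" "q x r s" for x y f r s
      unfolding q_def
    proof (intro allI impI)
      fix F \<tau> assume "cocone J Sh D F \<tau>"
      from val_act[OF this that(1,2)] val_act[OF this that(1,3)] this
      show "val \<tau> y (elements_act D f r) = val \<tau> y (elements_act D f s)"
        using that(4) unfolding q_def by simp
    qed
    \<comment> \<open>Cocones take values in sheaves, where the action of \<open>f\<close> is
      injective; hence the congruence is saturated.\<close>
    show "q x r s" if "f \<in> Hom C x y" "r \<in> elements D J x" "s \<in> elements D J x"
      "q y (elements_act D f r) (elements_act D f s)" for x y f r s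
      unfolding q_def
    proof (intro allI impI)
      fix F \<tau> assume c: "cocone J Sh D F \<tau>"
      have "act F f (val \<tau> x r) = act F f (val \<tau> x s)"
        using val_act[OF c that(1,2)] val_act[OF c that(1,3)] that(4) c unfolding q_def by simp
      then show "val \<tau> x r = val \<tau> x s"
        by (rule shf_inj[OF cone_Sh[OF c] that(1) val_closed[OF c Hom_Obj(1)[OF that(1)] that(2)] val_closed[OF c Hom_Obj(1)[OF that(1)] that(3)]])
    qed
    show thesis if "completion_of (elements D J) (elements_act D) q S \<eta>" for S \<eta> by (rule found[OF that])
  qed (auto simp: q_def)
  note C = completion_ofD[OF comp]
  define \<iota> where "\<iota> i = mk_map (FObj D i) (\<lambda>x a. \<eta> x (i, a)) S" for i
  have el: "(i, a) \<in> elements D J x \<longleftrightarrow> i \<in> Obj J \<and> a \<in> FObj (FObj D i) x" for i a x by (simp add: elements_def)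
  have \<iota>_app: "app (\<iota> i) x a = \<eta> x (i, a)" if "x \<in> Obj C" "a \<in> FObj (FObj D i) x" for i x a
    using that unfolding \<iota>_def by simp
  have cone: "cocone J Sh D S \<iota>"
    unfolding \<iota>_def
  proof (rule completion_cocone[OF D comp])
    fix i k u x a assume u: "u \<in> Hom J i k" and x: "x \<in> Obj C" and a: "a \<in> FObj (FObj D i) x"
    show "q x (k, app (FArr D u) x a) (i, a)"
      unfolding q_def val_def
    proof (intro allI impI, unfold prod.case)
      fix F \<tau> assume c: "cocone J Sh D F \<tau>"
      show "app (\<tau> k) x (app (FArr D u) x a) = app (\<tau> i) x a"
        using Sh_app_Comp[OF D.FArr_closed[OF u] cocone_Hom[OF c D.dom.Hom_Obj(2)[OF u]] x a]
          cocone_Comp[OF D.dom.category_axioms c u] by simp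
    qed
  qed
  note \<iota> = cocone_Hom[OF cone]
  have "\<exists>!h. h \<in> Hom Sh S F \<and> (\<forall>i\<in>Obj J. Comp Sh h (\<iota> i) = \<tau> i)" if \<tau>: "cocone J Sh D F \<tau>" for F \<tau>
  proof -
    note F = cone_Sh[OF \<tau>]
    obtain g where g: "natural S F g" "\<And>x r. x \<in> Obj C \<Longrightarrow> r \<in> elements D J x \<Longrightarrow> g x (\<eta> x r) = val \<tau> x r"
    proof (rule completion_extend[OF comp F, of "val \<tau>"])
      show "val \<tau> x r = val \<tau> x s" if "q x r s" for x r s using that \<tau> unfolding q_def by blast
      fix g assume "natural S F g" "\<And>x r. x \<in> Obj C \<Longrightarrow> r \<in> elements D J x \<Longrightarrow> g x (\<eta> x r) = val \<tau> x r"
      then show thesis by (rule that)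
    qed (use val_closed[OF \<tau>] val_act[OF \<tau>] in auto)
    note gH = Sh_map[OF C(1) F g(1)]
    have app_\<iota>: "app (Comp Sh m (\<iota> i)) x a = app m x (\<eta> x (i, a))"
      if "m \<in> Hom Sh S F" "i \<in> Obj J" "x \<in> Obj C" "a \<in> FObj (FObj D i) x" for m i x a
      using Sh_app_Comp[OF \<iota>[OF that(2)] that(1,3,4)] \<iota>_app[OF that(3,4)] by simp
    have "Comp Sh (mk_map S g F) (\<iota> i) = \<tau> i" if i: "i \<in> Obj J" for i
    proof (rule Sh_map_eqI[OF category.Comp_closed[OF category_Sh \<iota>[OF i] gH] cocone_Hom[OF \<tau> i]])
      fix x a assume xa: "x \<in> Obj C" "a \<in> FObj (FObj D i) x"
      then show "app (Comp Sh (mk_map S g F) (\<iota> i)) x a = app (\<tau> i) x a"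
        using app_\<iota>[OF gH i xa] g(2)[of x "(i, a)"] C(2)[of x "(i, a)"] i el by (simp add: val_def)
    qed
    moreover have "h1 = h2" if h: "h1 \<in> Hom Sh S F" "h2 \<in> Hom Sh S F"
      "\<forall>i\<in>Obj J. Comp Sh h1 (\<iota> i) = \<tau> i" "\<forall>i\<in>Obj J. Comp Sh h2 (\<iota> i) = \<tau> i" for h1 h2
    proof (rule Sh_map_eqI[OF h(1,2)])
      show "app h1 x a = app h2 x a" if "x \<in> Obj C" "a \<in> FObj S x" for x a
      proof (rule completion_unique[OF comp F Sh_HomD(3)[OF h(1)] Sh_HomD(3)[OF h(2)] _ that])
        fix x r assume x: "x \<in> Obj C" and "r \<in> elements D J x"
        then obtain i a where r: "r = (i, a)" "i \<in> Obj J" "a \<in> FObj (FObj D i) x" by (auto simp: elements_def)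
        show "app h1 x (\<eta> x r) = app h2 x (\<eta> x r)"
          using app_\<iota>[OF h(1) r(2) x r(3)] app_\<iota>[OF h(2) r(2) x r(3)] h(3,4) r by simp
      qed
    qed
    ultimately show ?thesis using gH by blast
  qed
  then show "\<exists>c \<iota>. is_colimit J Sh D c \<iota>" using cone unfolding is_colimit_def by blast
qed

end

section \<open>Finitely presentable sheaves\<close>

text \<open>Two stages reached from \<open>i\<close> have a common successor compatible with both
  arrows, and by \<open>stable\<close> a condition once reached persists. The set \<open>E\<close>
  will be the finite set of generators of a sheaf.\<close>

lemma filtered_finite_stage:
  assumes J: "filtered J" and i: "i \<in> Obj J" and "finite E"
    and ex: "\<And>e. e \<in> E \<Longrightarrow> \<exists>k. \<exists>u\<in>Hom J i k. \<Phi> e u"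
    and stable: "\<And>e k l u w. e \<in> E \<Longrightarrow> u \<in> Hom J i k \<Longrightarrow> w \<in> Hom J k l \<Longrightarrow> \<Phi> e u \<Longrightarrow> \<Phi> e (Comp J w u)"
  shows "\<exists>k. \<exists>u\<in>Hom J i k. \<forall>e\<in>E. \<Phi> e u"
proof -
  interpret J: category J by (rule filteredD(1)[OF J])
  show ?thesis
    using \<open>finite E\<close> ex stable
  proof (induction E)
    case empty
    then show ?case using J.Ide_closed[OF i] by blast
  next
    case (insert e E)
    obtain k u where u: "u \<in> Hom J i k" "\<forall>e\<in>E. \<Phi> e u" using insert.IH insert.prems by blast
    obtain l v where v: "v \<in> Hom J i l" "\<Phi> e v" using insert.prems(1) by blast
    obtain m x y where m: "x \<in> Hom J k m" "y \<in> Hom J l m" "Comp J x u = Comp J y v" using filtered_span[OF J u(1) v(1)] .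
    have "\<Phi> e' (Comp J x u)" if e': "e' \<in> insert e E" for e'
    proof (cases "e' = e")
      case True
      then show ?thesis using insert.prems(2)[OF _ v(1) m(2) v(2)] m(3) by simp
    next
      case False
      then show ?thesis using insert.prems(2)[OF _ u(1) m(1)] u(2) e' by blast
    qed
    then show ?case using J.Comp_closed[OF u(1) m(1)] by blast
  qed
qed

section \<open>Germs in a filtered diagram of sheaves\<close>

context noetherian_site
begin

text \<open>Equality in the pointwise filtered colimit, phrased for raw elements so that it can
  serve as the congruence of \<open>completion\<close>.\<close>

definition germ_eq :: "('i, 'j) category \<Rightarrow> ('i, 'j, ('o, 'u) presheaf, ('o, 'u) presheaf_map) functor_data \<Rightarrow>
    'o \<Rightarrow> 'i \<times> 'u \<Rightarrow> 'i \<times> 'u \<Rightarrow> bool" where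
  "germ_eq J D x = (\<lambda>(i, a) (j, b). \<exists>k. \<exists>u\<in>Hom J i k. \<exists>v\<in>Hom J j k. app (FArr D u) x a = app (FArr D v) x b)"

context
  fixes J :: "('i, 'j) category" and D
  assumes J: "filtered J" and D: "cat_functor J Sh D"
begin

interpretation J: category J by (rule filteredD(1)[OF J])
interpretation D: cat_functor J Sh D by (rule D)

abbreviation (input) "tr u x a \<equiv> app (FArr D u) x a"

lemma D_shf: "i \<in> Obj J \<Longrightarrow> shf (FObj D i)"
  using PiE_mem[OF D.FObj_closed] by simp

lemma tr_closed: "u \<in> Hom J i k \<Longrightarrow> x \<in> Obj C \<Longrightarrow> a \<in> FObj (FObj D i) x \<Longrightarrow> tr u x a \<in> FObj (FObj D k) x"
  using Sh_app_closed D.FArr_closed by blast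

lemma tr_act: "u \<in> Hom J i k \<Longrightarrow> f \<in> Hom C x y \<Longrightarrow> a \<in> FObj (FObj D i) x \<Longrightarrow>
    tr u y (act (FObj D i) f a) = act (FObj D k) f (tr u x a)"
  using Sh_app_act D.FArr_closed by blast

lemma tr_Comp: "u \<in> Hom J i k \<Longrightarrow> w \<in> Hom J k l \<Longrightarrow> x \<in> Obj C \<Longrightarrow> a \<in> FObj (FObj D i) x \<Longrightarrow>
    tr (Comp J w u) x a = tr w x (tr u x a)"
  using Sh_app_Comp[OF D.FArr_closed D.FArr_closed] D.FArr_Comp by simp

abbreviation (input) "germ \<equiv> germ_eq J D"

lemma germ_eqI: "u \<in> Hom J i k \<Longrightarrow> v \<in> Hom J j k \<Longrightarrow> tr u x a = tr v x b \<Longrightarrow> germ x (i, a) (j, b)"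
  unfolding germ_eq_def by auto

lemma germ_eqE:
  assumes "germ x (i, a) (j, b)"
  obtains k u v where "u \<in> Hom J i k" "v \<in> Hom J j k" "tr u x a = tr v x b"
  using assms unfolding germ_eq_def by auto

text \<open>The two arrows witnessing the equality of germs are parallel, so one further arrow of
  the diagram makes them equal.\<close>

lemma germ_eq_same:
  assumes q: "germ x (i, a) (i, b)" and x: "x \<in> Obj C" and ab: "a \<in> FObj (FObj D i) x" "b \<in> FObj (FObj D i) x"
  obtains k u where "u \<in> Hom J i k" "tr u x a = tr u x b"
proof -
  obtain k u v where uv: "u \<in> Hom J i k" "v \<in> Hom J i k" "tr u x a = tr v x b" using germ_eqE[OF q] .
  obtain l w where w: "w \<in> Hom J k l" "Comp J w u = Comp J w v" using filteredD(4)[OF J uv(1,2)] by blast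
  have "tr (Comp J w u) x a = tr (Comp J w u) x b"
    using tr_Comp[OF uv(1) w(1) x ab(1)] tr_Comp[OF uv(2) w(1) x ab(2)] uv(3) w(2) by simp
  then show thesis using that J.Comp_closed[OF uv(1) w(1)] by blast
qed

lemma germ_eq_refl: "i \<in> Obj J \<Longrightarrow> germ x (i, a) (i, a)"
  using J.Ide_closed germ_eqI by blast

lemma germ_eq_sym: "germ x (i, a) (j, b) \<Longrightarrow> germ x (j, b) (i, a)"
  by (metis germ_eqI germ_eqE)

lemma germ_eq_trans:
  assumes q: "germ x (i, a) (j, b)" "germ x (j, b) (k, c)" and x: "x \<in> Obj C"
    and abc: "a \<in> FObj (FObj D i) x" "b \<in> FObj (FObj D j) x" "c \<in> FObj (FObj D k) x"
  shows "germ x (i, a) (k, c)"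
proof -
  obtain l u v where uv: "u \<in> Hom J i l" "v \<in> Hom J j l" "tr u x a = tr v x b" using germ_eqE[OF q(1)] .
  obtain m s t where st: "s \<in> Hom J j m" "t \<in> Hom J k m" "tr s x b = tr t x c" using germ_eqE[OF q(2)] .
  obtain w p r where pr: "p \<in> Hom J l w" "r \<in> Hom J m w" "Comp J p v = Comp J r s" using filtered_span[OF J uv(2) st(1)] .
  have "tr (Comp J p u) x a = tr (Comp J r t) x c"
    using tr_Comp[OF uv(1) pr(1) x abc(1)] tr_Comp[OF uv(2) pr(1) x abc(2)] tr_Comp[OF st(1) pr(2) x abc(2)]
      tr_Comp[OF st(2) pr(2) x abc(3)] uv(3) st(3) pr(3) by simp
  then show ?thesis by (rule germ_eqI[OF J.Comp_closed[OF uv(1) pr(1)] J.Comp_closed[OF st(2) pr(2)]])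
qed

lemma germ_eq_act:
  assumes q: "germ x (i, a) (j, b)" and f: "f \<in> Hom C x y"
    and ab: "a \<in> FObj (FObj D i) x" "b \<in> FObj (FObj D j) x"
  shows "germ y (i, act (FObj D i) f a) (j, act (FObj D j) f b)"
proof -
  obtain k u v where uv: "u \<in> Hom J i k" "v \<in> Hom J j k" "tr u x a = tr v x b" using germ_eqE[OF q] .
  show ?thesis by (rule germ_eqI[OF uv(1,2)]) (simp add: tr_act[OF uv(1) f ab(1)] tr_act[OF uv(2) f ab(2)] uv(3))
qed

lemma germ_eq_saturated:
  assumes q: "germ y (i, act (FObj D i) f a) (j, act (FObj D j) f b)" and f: "f \<in> Hom C x y"
    and ab: "a \<in> FObj (FObj D i) x" "b \<in> FObj (FObj D j) x"
  shows "germ x (i, a) (j, b)"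
proof -
  obtain k u v where uv: "u \<in> Hom J i k" "v \<in> Hom J j k"
    "tr u y (act (FObj D i) f a) = tr v y (act (FObj D j) f b)" using germ_eqE[OF q] .
  then have "act (FObj D k) f (tr u x a) = act (FObj D k) f (tr v x b)"
    using tr_act[OF uv(1) f ab(1)] tr_act[OF uv(2) f ab(2)] by simp
  then have "tr u x a = tr v x b"
    using shf_inj[OF D_shf[OF J.Hom_Obj(2)[OF uv(1)]] f] tr_closed uv(1,2) ab Hom_Obj(1)[OF f] by blast
  then show ?thesis by (rule germ_eqI[OF uv(1,2)])
qed

lemma germ_eq_tr: "u \<in> Hom J i k \<Longrightarrow> x \<in> Obj C \<Longrightarrow> a \<in> FObj (FObj D i) x \<Longrightarrow> germ x (i, a) (k, tr u x a)"
proof -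
  assume u: "u \<in> Hom J i k" and x: "x \<in> Obj C" and a: "a \<in> FObj (FObj D i) x"
  note k = J.Hom_Obj(2)[OF u]
  have "tr (Ide J k) x (tr u x a) = tr u x a"
    using D.FArr_Ide[OF k] Sh_app_Ide[OF x tr_closed[OF u x a]] by simp
  then show ?thesis by (intro germ_eqI[OF u J.Ide_closed[OF k]]) simp
qed

text \<open>The stabilizers of the images of \<open>a\<close> form a directed family of subgroups, so one of them is the
  largest.\<close>

lemma stabilizer_stage:
  assumes i: "i \<in> Obj J" and n: "n \<in> Obj C" and a: "a \<in> FObj (FObj D i) n"
  obtains k u where "u \<in> Hom J i k"
    "\<And>h. h \<in> Hom C n n \<Longrightarrow> is_iso C h \<Longrightarrow> germ n (i, act (FObj D i) h a) (i, a) \<Longrightarrow>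
       act (FObj D k) h (tr u n a) = tr u n a"
proof -
  define \<H> where "\<H> = {stabilizer (FObj D k) n (tr u n a) | k u. u \<in> Hom J i k}"
  have gr: "group (Aut C n)" using noetherian[OF n] by (simp add: noetherian_group_def)
  have sub: "subgroup H (Aut C n)" if H: "H \<in> \<H>" for H
  proof -
    obtain k u where u: "u \<in> Hom J i k" "H = stabilizer (FObj D k) n (tr u n a)" using H unfolding \<H>_def by blast
    show ?thesis unfolding u(2)
      by (rule subgroup_stabilizer[OF gr shf_psh[OF D_shf[OF J.Hom_Obj(2)[OF u(1)]]] n tr_closed[OF u(1) n a]])
  qed
  have ne: "\<H> \<noteq> {}" using J.Ide_closed[OF i] unfolding \<H>_def by blast
  obtain M where M: "M \<in> \<H>" "\<And>H. H \<in> \<H> \<Longrightarrow> M \<subseteq> H \<Longrightarrow> H = M"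
    using noetherian_group_maximal[OF noetherian[OF n] ne sub] by blast
  obtain k u where u: "u \<in> Hom J i k" "M = stabilizer (FObj D k) n (tr u n a)" using M(1) unfolding \<H>_def by blast
  have "act (FObj D k) h (tr u n a) = tr u n a"
    if h: "h \<in> Hom C n n" "is_iso C h" "germ n (i, act (FObj D i) h a) (i, a)" for h
  proof -
    obtain l v where v: "v \<in> Hom J i l" "tr v n (act (FObj D i) h a) = tr v n a"
      using germ_eq_same[OF h(3) n act_closed[OF shf_psh[OF D_shf[OF i]] h(1) a] a] .
    \<comment> \<open>Stage \<open>w\<close> lies beyond the stage \<open>k\<close> of the maximal
      stabilizer and beyond the stage \<open>l\<close> at which \<open>h\<close> fixes
      \<open>a\<close>. The stabilizer there contains \<open>h\<close> and, by maximality, equals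
      \<open>M\<close>.\<close>
    obtain w p r where pr: "p \<in> Hom J k w" "r \<in> Hom J l w" "Comp J p u = Comp J r v" using filtered_span[OF J u(1) v(1)] .
    note pu = J.Comp_closed[OF u(1) pr(1)]
    have S: "stabilizer (FObj D w) n (tr (Comp J p u) n a) \<in> \<H>" unfolding \<H>_def using pu by blast
    have "act (FObj D w) g (tr p n (tr u n a)) = tr p n (tr u n a)" if "g \<in> Hom C n n" "act (FObj D k) g (tr u n a) = tr u n a" for g
      using tr_act[OF pr(1) that(1) tr_closed[OF u(1) n a]] that(2) by simp
    then have "M \<subseteq> stabilizer (FObj D w) n (tr (Comp J p u) n a)"
      unfolding u(2) stabilizer_def using tr_Comp[OF u(1) pr(1) n a] by auto
    then have "stabilizer (FObj D w) n (tr (Comp J p u) n a) = M" using M(2)[OF S] by blast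
    moreover have "act (FObj D w) h (tr (Comp J p u) n a) = tr (Comp J p u) n a"
      unfolding pr(3) using tr_Comp[OF v(1) pr(2) n a] tr_act[OF v(1) h(1) a] tr_act[OF pr(2) h(1) tr_closed[OF v(1) n a]] v(2) by simp
    then have "h \<in> stabilizer (FObj D w) n (tr (Comp J p u) n a)" using h unfolding stabilizer_def by simp
    ultimately show ?thesis unfolding u(2) stabilizer_def by simp
  qed
  then show thesis using that u(1) by blast
qed

text \<open>The presheaf colimit is already a sheaf: an element \<open>b\<close> of it comes from an element \<open>c\<close> of
  minimal support, and at a late stage the stabilizer of \<open>c\<close> no longer grows, so that any two
  maps out of the support agree on \<open>c\<close> at that stage as soon as they agree in the colimit.\<close>

lemma germ_glue:
  assumes f: "f \<in> Hom C x y" and i: "i \<in> Obj J" and b: "b \<in> FObj (FObj D i) y"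
    and compat: "\<And>z g h. g \<in> Hom C y z \<Longrightarrow> h \<in> Hom C y z \<Longrightarrow> Comp C g f = Comp C h f \<Longrightarrow>
      germ z (i, act (FObj D i) g b) (i, act (FObj D i) h b)"
  obtains k a where "k \<in> Obj J" "a \<in> FObj (FObj D k) x" "germ y (k, act (FObj D k) f a) (i, b)"
proof -
  note y = Hom_Obj(2)[OF f]
  note P = shf_psh[OF D_shf]
  \<comment> \<open>The support is minimized in the colimit and not at stage \<open>i\<close>: an
    element may acquire a smaller support later, so \<open>?Q\<close> lets the stage vary.\<close>
  let ?Q = "\<lambda>w m. \<exists>k\<in>Obj J. \<exists>c\<in>FObj (FObj D k) w. germ y (k, act (FObj D k) m c) (i, b)"
  have "?Q y (Ide C y)" using i b germ_eq_refl[OF i] act_Ide[OF P[OF i] y b] by metis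
  then obtain w m where m: "m \<in> Hom C w y" "?Q w m"
    and iso: "\<And>v \<kappa>. \<kappa> \<in> Hom C v w \<Longrightarrow> ?Q v (Comp C m \<kappa>) \<Longrightarrow> is_iso C \<kappa>"
    using well_founded_support[OF wf, of ?Q, OF _ Ide_closed[OF y]] by metis
  obtain k0 c0 where c0: "k0 \<in> Obj J" "c0 \<in> FObj (FObj D k0) w" "germ y (k0, act (FObj D k0) m c0) (i, b)" using m(2) by blast
  obtain l u v where uv: "u \<in> Hom J k0 l" "v \<in> Hom J i l" "tr u y (act (FObj D k0) m c0) = tr v y b" using germ_eqE[OF c0(3)] .
  note w = Hom_Obj(1)[OF m(1)] and l = J.Hom_Obj(2)[OF uv(1)]
  define c1 where "c1 = tr u w c0"
  have c1: "c1 \<in> FObj (FObj D l) w" unfolding c1_def by (rule tr_closed[OF uv(1) w c0(2)])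
  have mc1: "act (FObj D l) m c1 = tr v y b" unfolding c1_def using tr_act[OF uv(1) m(1) c0(2)] uv(3) by simp
  \<comment> \<open>At stage \<open>l\<close> the equation between \<open>b\<close> and
    \<open>m c1\<close> holds on the nose; at \<open>l'\<close> the stabilizer of the image of
    \<open>c1\<close> has moreover reached its final size. Everything that follows is compared with
    this one stage.\<close>
  obtain l' e where e: "e \<in> Hom J l l'" and stab: "\<And>h. h \<in> Hom C w w \<Longrightarrow> is_iso C h \<Longrightarrow>
     germ w (l, act (FObj D l) h c1) (l, c1) \<Longrightarrow> act (FObj D l') h (tr e w c1) = tr e w c1"
    using stabilizer_stage[OF l w c1] by blast
  define c where "c = tr e w c1"
  note l' = J.Hom_Obj(2)[OF e]
  have c: "c \<in> FObj (FObj D l') w" unfolding c_def by (rule tr_closed[OF e w c1])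
  define ev where "ev = Comp J e v"
  have ev: "ev \<in> Hom J i l'" unfolding ev_def by (rule J.Comp_closed[OF uv(2) e])
  define b' where "b' = tr ev y b"
  have b': "b' \<in> FObj (FObj D l') y" unfolding b'_def by (rule tr_closed[OF ev y b])
  have mc: "act (FObj D l') m c = b'"
    unfolding b'_def ev_def c_def using tr_Comp[OF uv(2) e y b] tr_act[OF e m(1) c1] mc1 by simp
  have bb': "germ y (l', b') (i, b)"
    unfolding b'_def using germ_eq_tr[OF ev y b] by (rule germ_eq_sym)
  \<comment> \<open>A factorization of the support at any stage after \<open>l'\<close> is also one
    in the colimit, where \<open>w\<close> cannot be reduced further. So \<open>c\<close> stays
    minimal from \<open>l'\<close> on.\<close>
  have min: "minimal (FObj D r) w (tr s w c)" if s: "s \<in> Hom J l' r" for r s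
  proof -
    note r = J.Hom_Obj(2)[OF s]
    have "is_iso C \<kappa>" if \<kappa>: "\<kappa> \<in> Hom C w' w" and d: "d \<in> FObj (FObj D r) w'" "tr s w c = act (FObj D r) \<kappa> d" for w' \<kappa> d
    proof (rule iso[OF \<kappa>])
      have "act (FObj D r) (Comp C m \<kappa>) d = act (FObj D r) m (tr s w c)"
        using act_Comp[OF P[OF r] \<kappa> m(1) d(1)] d(2) by simp
      also have "\<dots> = tr s y b'" using tr_act[OF s m(1) c] mc by simp
      finally have *: "act (FObj D r) (Comp C m \<kappa>) d = tr s y b'" .
      have "germ y (r, act (FObj D r) (Comp C m \<kappa>) d) (l', b')" unfolding * by (rule germ_eq_sym[OF germ_eq_tr[OF s y b']])
      from germ_eq_trans[OF this bb' y act_closed[OF P[OF r] Comp_closed[OF \<kappa> m(1)] d(1)] b' b]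
      show "?Q w' (Comp C m \<kappa>)" using r d(1) by blast
    qed
    then show ?thesis unfolding minimal_def using w tr_closed[OF s w c] by blast
  qed
  \<comment> \<open>The two sides agree at some stage \<open>r\<close> that depends on
    \<open>g\<close> and \<open>h\<close>. There \<open>minimal_meet\<close> turns the agreement
    into an automorphism \<open>\<theta>\<close> fixing the image of \<open>c\<close>. The choice of
    \<open>l'\<close> makes \<open>\<theta>\<close> fix \<open>c\<close> already at
    \<open>l'\<close>, and the dependence on the pair is gone.\<close>
  have "act (FObj D l') g b' = act (FObj D l') h b'" if g: "g \<in> Hom C y z" and h: "h \<in> Hom C y z" and gh: "Comp C g f = Comp C h f" for g h z
  proof -
    note z = Hom_Obj(2)[OF g]
    note gb = act_closed[OF P[OF i] g b] and hb = act_closed[OF P[OF i] h b]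
    obtain p t where t: "t \<in> Hom J i p" "tr t z (act (FObj D i) g b) = tr t z (act (FObj D i) h b)"
      using germ_eq_same[OF compat[OF g h gh] z gb hb] .
    obtain r s s' where s: "s \<in> Hom J l' r" "s' \<in> Hom J p r" "Comp J s ev = Comp J s' t" using filtered_span[OF J ev t(1)] .
    note r = J.Hom_Obj(2)[OF s(1)]
    let ?c = "tr s w c"
    have t': "act (FObj D p) g (tr t y b) = act (FObj D p) h (tr t y b)"
      using t(2) tr_act[OF t(1) g b] tr_act[OF t(1) h b] by simp
    have sb: "tr s y b' = tr s' y (tr t y b)" unfolding b'_def using tr_Comp[OF ev s(1) y b] tr_Comp[OF t(1) s(2) y b] s(3) by simp
    have eq: "act (FObj D r) g (tr s y b') = act (FObj D r) h (tr s y b')"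
      unfolding sb using tr_act[OF s(2) g tr_closed[OF t(1) y b]] tr_act[OF s(2) h tr_closed[OF t(1) y b]] t' by simp
    have sm: "tr s y b' = act (FObj D r) m ?c" using tr_act[OF s(1) m(1) c] mc by simp
    have sc: "?c \<in> FObj (FObj D r) w" by (rule tr_closed[OF s(1) w c])
    have eq': "act (FObj D r) (Comp C g m) ?c = act (FObj D r) (Comp C h m) ?c"
      using eq sm act_Comp[OF P[OF r] m(1) g sc] act_Comp[OF P[OF r] m(1) h sc] by simp
    obtain \<theta> where \<theta>: "\<theta> \<in> Hom C w w" "is_iso C \<theta>" "act (FObj D r) \<theta> ?c = ?c" "Comp C g m = Comp C (Comp C h m) \<theta>"
      using minimal_meet[OF D_shf[OF r] min[OF s(1)] min[OF s(1)] Comp_closed[OF m(1) g] Comp_closed[OF m(1) h] eq'] by blast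
    have "tr (Comp J s e) w (act (FObj D l) \<theta> c1) = tr (Comp J s e) w c1"
      using tr_Comp[OF e s(1) w c1] tr_Comp[OF e s(1) w act_closed[OF P[OF l] \<theta>(1) c1]] tr_act[OF e \<theta>(1) c1]
        tr_act[OF s(1) \<theta>(1) c] \<theta>(3) unfolding c_def by simp
    then have "germ w (l, act (FObj D l) \<theta> c1) (l, c1)"
      by (rule germ_eqI[OF J.Comp_closed[OF e s(1)] J.Comp_closed[OF e s(1)]])
    then have \<theta>c: "act (FObj D l') \<theta> c = c" using stab[OF \<theta>(1,2)] unfolding c_def by blast
    have "act (FObj D l') g b' = act (FObj D l') (Comp C g m) c" using act_Comp[OF P[OF l'] m(1) g c] mc by simp
    also have "\<dots> = act (FObj D l') (Comp C h m) c" unfolding \<theta>(4)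
      using act_Comp[OF P[OF l'] \<theta>(1) Comp_closed[OF m(1) h] c] \<theta>c by simp
    also have "\<dots> = act (FObj D l') h b'" using act_Comp[OF P[OF l'] m(1) h c] mc by simp
    finally show ?thesis .
  qed
  then obtain a where "a \<in> FObj (FObj D l') x" "act (FObj D l') f a = b'"
    by (rule shf_glue[OF D_shf[OF l'] f b'])
  then show thesis using that[OF l'] bb' by blast
qed

text \<open>By \<open>germ_glue\<close> every element of the completion for equality of germs comes
  from a stage, so this completion is a colimit with the desired elements. The colimit given in
  advance is isomorphic to it, which transports the description.\<close>

lemma filtered_colimit_pointwise:
  assumes sm: "sml (Arr J)" and col: "is_colimit J Sh D F \<iota>"
  shows "x \<in> Obj C \<Longrightarrow> b \<in> FObj F x \<Longrightarrow> \<exists>i\<in>Obj J. \<exists>a\<in>FObj (FObj D i) x. b = app (\<iota> i) x a"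
    and "x \<in> Obj C \<Longrightarrow> i \<in> Obj J \<Longrightarrow> a \<in> FObj (FObj D i) x \<Longrightarrow> b \<in> FObj (FObj D i) x \<Longrightarrow>
       app (\<iota> i) x a = app (\<iota> i) x b \<Longrightarrow> \<exists>k. \<exists>u\<in>Hom J i k. tr u x a = tr u x b"
proof -
  note raw = elements_raw[OF D sm]
  have el: "(i, a) \<in> elements D J x \<longleftrightarrow> i \<in> Obj J \<and> a \<in> FObj (FObj D i) x" for i a x by (simp add: elements_def)
  have elE: thesis if "r \<in> elements D J x" "\<And>i a. r = (i, a) \<Longrightarrow> i \<in> Obj J \<Longrightarrow> a \<in> FObj (FObj D i) x \<Longrightarrow> thesis" for r x thesis
    using that by (auto simp: elements_def)
  have ea: "elements_act D f (i, a) = (i, act (FObj D i) f a)" for f i a by (simp add: elements_act_def)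
  obtain S \<eta> where comp: "completion_of (elements D J) (elements_act D) germ S \<eta>"
  proof (rule completion[of "elements D J" "elements_act D" germ, OF raw])
    note found = that
    show "germ x r r" if "r \<in> elements D J x" for x r using that by (rule elE) (simp add: germ_eq_refl)
    show "germ x s r" if "germ x r s" for x r s using that germ_eq_sym by (cases r; cases s) auto
    show "germ x r t" if "x \<in> Obj C" "r \<in> elements D J x" "s \<in> elements D J x" "t \<in> elements D J x" "germ x r s" "germ x s t" for x r s t
    proof -
      obtain i a j b k c where e: "r = (i, a)" "s = (j, b)" "t = (k, c)" by (metis surj_pair)
      show ?thesis using that germ_eq_trans unfolding e el by blast
    qed
    show "germ y (elements_act D f r) (elements_act D f s)"
      if "f \<in> Hom C x y" "r \<in> elements D J x" "s \<in> elements D J x" "germ x r s" for x y f r s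
      using that(2,3) by (elim elE) (use that(1,4) germ_eq_act ea in simp)
    show "germ x r s" if "f \<in> Hom C x y" "r \<in> elements D J x" "s \<in> elements D J x"
      "germ y (elements_act D f r) (elements_act D f s)" for x y f r s
      using that(2,3) by (elim elE) (use that(1,4) germ_eq_saturated ea in simp)
    show thesis if "completion_of (elements D J) (elements_act D) germ S \<eta>" for S \<eta> by (rule found[OF that])
  qed
  note E = completion_ofD[OF comp]
  note S = shf_psh[OF E(1)]
  have surj: "\<exists>i\<in>Obj J. \<exists>a\<in>FObj (FObj D i) x. s = \<eta> x (i, a)" if x: "x \<in> Obj C" and s: "s \<in> FObj S x" for x s
  proof -
    obtain y f r where f: "f \<in> Hom C x y" "r \<in> elements D J y" "act S f s = \<eta> y r" using E(6)[OF x s] by blast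
    obtain i b where r: "r = (i, b)" "i \<in> Obj J" "b \<in> FObj (FObj D i) y" using f(2) by (rule elE)
    have gr: "\<eta> z (i, act (FObj D i) g b) = act S (Comp C g f) s" if "g \<in> Hom C y z" for g z
      using E(4)[OF that f(2)] r(1) f(3) act_Comp[OF S f(1) that s] ea by simp
    have "germ z (i, act (FObj D i) g b) (i, act (FObj D i) h b)"
      if "g \<in> Hom C y z" "h \<in> Hom C y z" "Comp C g f = Comp C h f" for g h z
      using E(5)[OF Hom_Obj(2)[OF that(1)], of "(i, act (FObj D i) g b)" "(i, act (FObj D i) h b)"] gr that el r
        act_closed[OF shf_psh[OF D_shf[OF r(2)]] _ r(3)] by simp
    then obtain k a where k: "k \<in> Obj J" "a \<in> FObj (FObj D k) x" "germ y (k, act (FObj D k) f a) (i, b)"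
      by (rule germ_glue[OF f(1) r(2,3)])
    have ka: "(k, a) \<in> elements D J x" using k el by simp
    have "act S f (\<eta> x (k, a)) = \<eta> y (i, b)"
      using E(4)[OF f(1) ka] E(5)[OF Hom_Obj(2)[OF f(1)] E(3)[OF f(1) ka] f(2)] k(3) ea r(1) by simp
    then have "s = \<eta> x (k, a)" using shf_inj[OF E(1) f(1) s E(2)[OF x ka]] f(3) r(1) by simp
    then show ?thesis using k by blast
  qed
  define \<sigma> where "\<sigma> i = mk_map (FObj D i) (\<lambda>x a. \<eta> x (i, a)) S" for i
  have \<sigma>_app: "app (\<sigma> i) x a = \<eta> x (i, a)" if "x \<in> Obj C" "a \<in> FObj (FObj D i) x" for i x a
    using that unfolding \<sigma>_def by simp
  have cone: "cocone J Sh D S \<sigma>"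
    unfolding \<sigma>_def by (rule completion_cocone[OF D comp]) (rule germ_eq_sym[OF germ_eq_tr])
  note \<sigma> = cocone_Hom[OF cone]
  have same: "\<exists>k. \<exists>u\<in>Hom J i k. tr u x a = tr u x b" if "x \<in> Obj C" "i \<in> Obj J" "a \<in> FObj (FObj D i) x" "b \<in> FObj (FObj D i) x"
    "app (\<sigma> i) x a = app (\<sigma> i) x b" for x i a b
  proof -
    have "germ x (i, a) (i, b)" using E(5)[OF that(1), of "(i, a)" "(i, b)"] that \<sigma>_app el by simp
    then show ?thesis using germ_eq_same[OF _ that(1,3,4)] by blast
  qed
  have colS: "is_colimit J Sh D S \<sigma>"
    by (rule filtered_colimit_ShI[OF J D cone]) (use surj same \<sigma>_app in metis)+
  have ccF: "cocone J Sh D F \<iota>" using col by (simp add: is_colimit_def)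
  obtain h where h: "h \<in> Hom Sh F S" "\<And>i. i \<in> Obj J \<Longrightarrow> Comp Sh h (\<iota> i) = \<sigma> i" using col cone unfolding is_colimit_def by blast
  obtain g where g: "g \<in> Hom Sh S F" "\<And>i. i \<in> Obj J \<Longrightarrow> Comp Sh g (\<sigma> i) = \<iota> i" using colS ccF unfolding is_colimit_def by blast
  note Sh_Ide_closed = category.Ide_closed[OF category_Sh] and Sh_Comp_closed = category.Comp_closed[OF category_Sh]
  have F: "shf F" using ccF by (simp add: cocone_def)
  \<comment> \<open>Both sides are maps of the cocone \<open>\<iota>\<close> to itself, and a
    colimit cocone admits only one.\<close>
  have gh: "Comp Sh g h = Ide Sh F"
  proof -
    have "\<exists>!k. k \<in> Hom Sh F F \<and> (\<forall>i\<in>Obj J. Comp Sh k (\<iota> i) = \<iota> i)" using col ccF unfolding is_colimit_def by blast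
    moreover have "Comp Sh (Comp Sh g h) (\<iota> i) = \<iota> i" if "i \<in> Obj J" for i
      using category.Comp_assoc[OF category_Sh cocone_Hom[OF ccF that] h(1) g(1)] h(2)[OF that] g(2)[OF that] by simp
    moreover have "Comp Sh (Ide Sh F) (\<iota> i) = \<iota> i" if "i \<in> Obj J" for i
      by (rule category.Ide_Comp[OF category_Sh cocone_Hom[OF ccF that]])
    moreover have "Comp Sh g h \<in> Hom Sh F F" "Ide Sh F \<in> Hom Sh F F"
      using Sh_Comp_closed[OF h(1) g(1)] Sh_Ide_closed[of F] F by auto
    ultimately show ?thesis by blast
  qed
  show "\<exists>i\<in>Obj J. \<exists>a\<in>FObj (FObj D i) x. b = app (\<iota> i) x a" if x: "x \<in> Obj C" and b: "b \<in> FObj F x"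
  proof -
    obtain i a where i: "i \<in> Obj J" "a \<in> FObj (FObj D i) x" "app h x b = \<eta> x (i, a)" using surj[OF x Sh_app_closed[OF h(1) x b]] by blast
    have "b = app g x (app h x b)" using Sh_app_Comp[OF h(1) g(1) x b] gh Sh_app_Ide[OF x b] by simp
    also have "\<dots> = app (\<iota> i) x a" using Sh_app_Comp[OF \<sigma>[OF i(1)] g(1) x i(2)] g(2)[OF i(1)] i(3) \<sigma>_app[OF x i(2)] by simp
    finally show ?thesis using i by blast
  qed
  show "\<exists>k. \<exists>u\<in>Hom J i k. tr u x a = tr u x b" if x: "x \<in> Obj C" and i: "i \<in> Obj J" and a: "a \<in> FObj (FObj D i) x"
    and b: "b \<in> FObj (FObj D i) x" and eq: "app (\<iota> i) x a = app (\<iota> i) x b"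
    by (rule same[OF x i a b])
      (use Sh_app_Comp[OF cocone_Hom[OF ccF i] h(1) x a] Sh_app_Comp[OF cocone_Hom[OF ccF i] h(1) x b] h(2)[OF i] eq in simp)
qed

end

text \<open>Finite disjoint unions of quotients of \<open>Hom(n, -)\<close> by a stabilizer,
  described from inside: \<open>E\<close> holds one generator of minimal support per orbit. The
  condition on \<open>f\<close> and \<open>g\<close> says that different orbits never meet.\<close>

definition presented :: "('o, 'u) presheaf \<Rightarrow> ('o \<times> 'u) set \<Rightarrow> bool" where
  "presented P E \<longleftrightarrow> shf P \<and> finite E \<and> (\<forall>n c. (n, c) \<in> E \<longrightarrow> minimal P n c) \<and>
     (\<forall>n c n' c' z. \<forall>f\<in>Hom C n z. \<forall>g\<in>Hom C n' z. (n, c) \<in> E \<longrightarrow> (n', c') \<in> E \<longrightarrow>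
        act P f c = act P g c' \<longrightarrow> n = n' \<and> c = c') \<and>
     (\<forall>x\<in>Obj C. FObj P x = orbits P E x)"

lemma presentedD:
  assumes "presented P E"
  shows "shf P" "finite E" "(n, c) \<in> E \<Longrightarrow> minimal P n c"
    "(n, c) \<in> E \<Longrightarrow> n \<in> Obj C" "(n, c) \<in> E \<Longrightarrow> c \<in> FObj P n"
    "f \<in> Hom C n z \<Longrightarrow> g \<in> Hom C n' z \<Longrightarrow> (n, c) \<in> E \<Longrightarrow> (n', c') \<in> E \<Longrightarrow> act P f c = act P g c' \<Longrightarrow> n = n' \<and> c = c'"
    "x \<in> Obj C \<Longrightarrow> b \<in> FObj P x \<Longrightarrow> \<exists>n f c. b = act P f c \<and> (n, c) \<in> E \<and> f \<in> Hom C n x"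
  using assms unfolding presented_def orbits_def minimal_def by blast+

lemma generated_map_eqI:
  assumes "presented P E" "m \<in> Hom Sh P F" "m' \<in> Hom Sh P F" "\<And>n c. (n, c) \<in> E \<Longrightarrow> app m n c = app m' n c"
  shows "m = m'"
proof (rule Sh_map_eqI[OF assms(2,3)])
  fix x b assume "x \<in> Obj C" "b \<in> FObj P x"
  then obtain n f c where f: "b = act P f c" "(n, c) \<in> E" "f \<in> Hom C n x" using presentedD(7)[OF assms(1)] by blast
  note c = presentedD(5)[OF assms(1) f(2)]
  show "app m x b = app m' x b"
    using Sh_app_act[OF assms(2) f(3) c] Sh_app_act[OF assms(3) f(3) c] assms(4)[OF f(2)] f(1) by simp
qed

text \<open>A map is determined by its values at the generators, hence by a finite set of pairs of a
  generator and an element of \<open>F\<close>. Of finite subsets of a small set there are only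
  few.\<close>

lemma small_Hom_presented:
  assumes P: "presented P E" and F: "shf F"
  shows "sml (Hom Sh P F)"
proof (rule small_inj)
  let ?v = "\<lambda>m. (\<lambda>(n, c). ((n, c), app m n c)) ` E"
  let ?V = "\<Union>n\<in>Obj C. FObj F n"
  show "inj_on ?v (Hom Sh P F)"
  proof (rule inj_onI)
    fix m m' assume m: "m \<in> Hom Sh P F" "m' \<in> Hom Sh P F" and eq: "?v m = ?v m'"
    have "app m n c = app m' n c" if "(n, c) \<in> E" for n c
    proof -
      have "((n, c), app m n c) \<in> ?v m" using that by force
      then show ?thesis unfolding eq by auto
    qed
    then show "m = m'" by (rule generated_map_eqI[OF P m])
  qed
  show "?v ` Hom Sh P F \<subseteq> {X. finite X \<and> X \<subseteq> E \<times> ?V}"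
    using presentedD(2,4,5)[OF P] Sh_app_closed by fastforce
  show "sml {X. finite X \<and> X \<subseteq> E \<times> ?V}"
    using presentedD(2)[OF P] psh_small[OF shf_psh[OF F]]
    by (intro small_Fpow small_Times small_UN small_Obj small_countable[OF countable_finite[OF presentedD(2)[OF P]]])
qed

text \<open>A map into the colimit lifts to a stage as soon as the finitely many generators lift and
  their relations hold there. Since orbits never meet, the relations reduce to
  \<open>h c = c\<close> for \<open>h\<close> in the stabilizer of a generator, and
  \<open>stabilizer_stage\<close> settles all of these at once.\<close>

lemma finitely_presentable_presented:
  assumes P: "presented P E"
  shows "finitely_presentable TYPE('u) Sh P"
  unfolding finitely_presentable_def
proof (intro conjI allI impI)
  note PD = presentedD[OF P]
  show "P \<in> Obj Sh" using PD(1) by simp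
  show H: "cat_functor Sh (set_category TYPE('u)) (hom_functor Sh P)"
    by (rule cat_functor_hom_functor[OF category_Sh]) (use PD(1) small_Hom_presented[OF P] in auto)
  fix J :: "('u, 'u) category" and D F \<iota>
  assume "small_category TYPE('u) J \<and> filtered J \<and> cat_functor J Sh D \<and> is_colimit J Sh D F \<iota>"
  then have sm: "sml (Arr J)" and J: "filtered J" and D: "cat_functor J Sh D" and col: "is_colimit J Sh D F \<iota>"
    by (simp_all add: small_category_def)
  interpret J: category J by (rule filteredD(1)[OF J])
  interpret D: cat_functor J Sh D by fact
  note surj = filtered_colimit_pointwise(1)[OF J D sm col] and inj = filtered_colimit_pointwise(2)[OF J D sm col]
  have cc: "cocone J Sh D F \<iota>" using col by (simp add: is_colimit_def)
  note D_shf = D_shf[OF J D] and tr_act = tr_act[OF J D] and tr_closed = tr_closed[OF J D] and tr_Comp = tr_Comp[OF J D]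
  have \<iota>_tr: "app (\<iota> k) x (app (FArr D u) x a) = app (\<iota> i) x a"
    if "u \<in> Hom J i k" "x \<in> Obj C" "a \<in> FObj (FObj D i) x" for u i k x a
    using Sh_app_Comp[OF D.FArr_closed[OF that(1)] cocone_Hom[OF cc J.Hom_Obj(2)[OF that(1)]] that(2,3)]
      cocone_Comp[OF J.category_axioms cc that(1)] by simp
  show "is_colimit J (set_category TYPE('u)) (functor_comp J (hom_functor Sh P) D)
          (FObj (hom_functor Sh P) F) (\<lambda>i. FArr (hom_functor Sh P) (\<iota> i))"
  proof (rule hom_functor_preserves_colimitI[OF J H D cc])
    fix i \<phi> \<psi> assume i: "i \<in> Obj J" and \<phi>: "\<phi> \<in> Hom Sh P (FObj D i)" and \<psi>: "\<psi> \<in> Hom Sh P (FObj D i)"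
      and eq: "Comp Sh (\<iota> i) \<phi> = Comp Sh (\<iota> i) \<psi>"
    \<comment> \<open>Maps that agree in the colimit agree on each single generator at some later
      stage; finiteness of \<open>E\<close> gives one stage for all generators.\<close>
    let ?\<Phi> = "\<lambda>(n, c) u. app (FArr D u) n (app \<phi> n c) = app (FArr D u) n (app \<psi> n c)"
    have "\<exists>k. \<exists>u\<in>Hom J i k. \<forall>e\<in>E. ?\<Phi> e u"
    proof (rule filtered_finite_stage[OF J i PD(2)])
      fix e assume "e \<in> E"
      then obtain n c where e: "e = (n, c)" "(n, c) \<in> E" by (metis surj_pair)
      note n = PD(4)[OF e(2)] and c = PD(5)[OF e(2)]
      note \<phi>c = Sh_app_closed[OF \<phi> n c] and \<psi>c = Sh_app_closed[OF \<psi> n c]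
      have "app (\<iota> i) n (app \<phi> n c) = app (\<iota> i) n (app \<psi> n c)"
        using Sh_app_Comp[OF \<phi> cocone_Hom[OF cc i] n c] Sh_app_Comp[OF \<psi> cocone_Hom[OF cc i] n c] eq by simp
      from inj[OF n i \<phi>c \<psi>c this] show "\<exists>k. \<exists>u\<in>Hom J i k. ?\<Phi> e u" unfolding e by simp
      fix k l u w assume "u \<in> Hom J i k" "w \<in> Hom J k l" "?\<Phi> e u"
      then show "?\<Phi> e (Comp J w u)" unfolding e using tr_Comp[OF _ _ n \<phi>c] tr_Comp[OF _ _ n \<psi>c] by simp
    qed
    then obtain k u where u: "u \<in> Hom J i k" "\<forall>e\<in>E. ?\<Phi> e u" by blast
    note Du = D.FArr_closed[OF u(1)]
    have "Comp Sh (FArr D u) \<phi> = Comp Sh (FArr D u) \<psi>"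
    proof (rule generated_map_eqI[OF P category.Comp_closed[OF category_Sh \<phi> Du] category.Comp_closed[OF category_Sh \<psi> Du]])
      fix n c assume "(n, c) \<in> E"
      then show "app (Comp Sh (FArr D u) \<phi>) n c = app (Comp Sh (FArr D u) \<psi>) n c"
        using Sh_app_Comp[OF \<phi> Du PD(4,5)] Sh_app_Comp[OF \<psi> Du PD(4,5)] u(2) by auto
    qed
    then show "\<exists>k. \<exists>u\<in>Hom J i k. Comp Sh (FArr D u) \<phi> = Comp Sh (FArr D u) \<psi>" using u(1) by blast
  next
    fix m assume m: "m \<in> Hom Sh P F"
    \<comment> \<open>The generators are lifted one at a time. No starting stage is fixed yet, so
      this is a separate induction and not an instance of
      \<open>filtered_finite_stage\<close>.\<close>
    have "\<exists>i\<in>Obj J. \<forall>e\<in>E'. \<exists>a\<in>FObj (FObj D i) (fst e). app (\<iota> i) (fst e) a = app m (fst e) (snd e)"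
      if "E' \<subseteq> E" for E'
      using finite_subset[OF that PD(2)] that
    proof (induction E')
      case empty
      then show ?case using filteredD(2)[OF J] by blast
    next
      case (insert e E')
      obtain n c where e: "e = (n, c)" by fastforce
      note nc = PD(4,5)[of n c] and n = PD(4)[of n c]
      obtain i where i: "i \<in> Obj J" "\<forall>e\<in>E'. \<exists>a\<in>FObj (FObj D i) (fst e). app (\<iota> i) (fst e) a = app m (fst e) (snd e)"
        using insert by auto
      obtain j b where j: "j \<in> Obj J" "b \<in> FObj (FObj D j) n" "app m n c = app (\<iota> j) n b"
        using surj[OF nc(1) Sh_app_closed[OF m nc]] insert.prems e by blast
      obtain k u v where uv: "u \<in> Hom J i k" "v \<in> Hom J j k" using filteredD(3)[OF J i(1) j(1)] by blast
      have "\<exists>a\<in>FObj (FObj D k) (fst e'). app (\<iota> k) (fst e') a = app m (fst e') (snd e')" if e': "e' \<in> insert e E'" for e'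
      proof (cases "e' = e")
        case True
        then show ?thesis using tr_closed[OF uv(2) nc(1) j(2)] \<iota>_tr[OF uv(2) nc(1) j(2)] j(3) e insert.prems by auto
      next
        case False
        then have "e' \<in> E'" using e' by simp
        then obtain a where a: "a \<in> FObj (FObj D i) (fst e')" "app (\<iota> i) (fst e') a = app m (fst e') (snd e')" using i(2) by blast
        have "fst e' \<in> Obj C" using PD(4)[of "fst e'" "snd e'"] \<open>e' \<in> E'\<close> insert.prems by auto
        then show ?thesis using tr_closed[OF uv(1) _ a(1)] \<iota>_tr[OF uv(1) _ a(1)] a(2) by metis
      qed
      then show ?case using J.Hom_Obj(2)[OF uv(1)] by blast
    qed
    from this[OF order_refl] obtain i where i: "i \<in> Obj J"
      "\<forall>e\<in>E. \<exists>a\<in>FObj (FObj D i) (fst e). app (\<iota> i) (fst e) a = app m (fst e) (snd e)" by blast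
    then obtain \<alpha> where \<alpha>': "\<forall>e\<in>E. \<alpha> e \<in> FObj (FObj D i) (fst e) \<and> app (\<iota> i) (fst e) (\<alpha> e) = app m (fst e) (snd e)" by metis
    have \<alpha>: "\<alpha> (n, c) \<in> FObj (FObj D i) n" "app (\<iota> i) n (\<alpha> (n, c)) = app m n c" if "(n, c) \<in> E" for n c
      using bspec[OF \<alpha>' that] by simp_all
    \<comment> \<open>All relations of one generator form a single condition, so that finitely many
      conditions remain. The stage appears as \<open>Cod J u\<close> because the condition sees only
      the generator and the arrow.\<close>
    let ?\<Phi> = "\<lambda>(n, c) u. \<forall>h\<in>Hom C n n. is_iso C h \<longrightarrow> act P h c = c \<longrightarrow>
       act (FObj D (Cod J u)) h (app (FArr D u) n (\<alpha> (n, c))) = app (FArr D u) n (\<alpha> (n, c))"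
    have "\<exists>k. \<exists>u\<in>Hom J i k. \<forall>e\<in>E. ?\<Phi> e u"
    proof (rule filtered_finite_stage[OF J i(1) PD(2)])
      fix e assume "e \<in> E"
      then obtain n c where e: "e = (n, c)" "(n, c) \<in> E" by (metis surj_pair)
      note n = PD(4)[OF e(2)] and c = PD(5)[OF e(2)] and a = \<alpha>[OF e(2)]
      obtain k u where u: "u \<in> Hom J i k" and st: "\<And>h. h \<in> Hom C n n \<Longrightarrow> is_iso C h \<Longrightarrow>
        germ_eq J D n (i, act (FObj D i) h (\<alpha> (n, c))) (i, \<alpha> (n, c)) \<Longrightarrow>
        act (FObj D k) h (app (FArr D u) n (\<alpha> (n, c))) = app (FArr D u) n (\<alpha> (n, c))"
        using stabilizer_stage[OF J D i(1) n a(1)] by blast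
      have "germ_eq J D n (i, act (FObj D i) h (\<alpha> (n, c))) (i, \<alpha> (n, c))" if h: "h \<in> Hom C n n" "act P h c = c" for h
      proof -
        note ha = act_closed[OF shf_psh[OF D_shf[OF i(1)]] h(1) a(1)]
        have "app (\<iota> i) n (act (FObj D i) h (\<alpha> (n, c))) = app (\<iota> i) n (\<alpha> (n, c))"
          using Sh_app_act[OF cocone_Hom[OF cc i(1)] h(1) a(1)] a(2) Sh_app_act[OF m h(1) c] h(2) by simp
        then obtain l v where "v \<in> Hom J i l" "app (FArr D v) n (act (FObj D i) h (\<alpha> (n, c))) = app (FArr D v) n (\<alpha> (n, c))"
          using inj[OF n i(1) ha a(1)] by blast
        then show ?thesis using germ_eqI[OF J D] by blast
      qed
      then show "\<exists>k. \<exists>u\<in>Hom J i k. ?\<Phi> e u" unfolding e using u st HomD(3)[OF u] by auto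
      fix k l u w assume uw: "u \<in> Hom J i k" "w \<in> Hom J k l" "?\<Phi> e u"
      have "Cod J u = k" "Cod J (Comp J w u) = l" using HomD(3)[OF uw(1)] HomD(3)[OF J.Comp_closed[OF uw(1,2)]] by auto
      then show "?\<Phi> e (Comp J w u)"
        unfolding e using uw(3) tr_Comp[OF uw(1,2) n a(1)] tr_act[OF uw(2) _ tr_closed[OF uw(1) n a(1)], of _ n] e
        by auto metis
    qed
    then obtain k u where u: "u \<in> Hom J i k" "\<forall>e\<in>E. ?\<Phi> e u" by blast
    note k = J.Hom_Obj(2)[OF u(1)]
    let ?K = "FObj D k"
    note Kp = shf_psh[OF D_shf[OF k]]
    define \<beta> where "\<beta> n c = app (FArr D u) n (\<alpha> (n, c))" for n c
    have \<beta>: "\<beta> n c \<in> FObj ?K n" "app (\<iota> k) n (\<beta> n c) = app m n c" if "(n, c) \<in> E" for n c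
      unfolding \<beta>_def using tr_closed[OF u(1) PD(4)[OF that] \<alpha>(1)[OF that]] \<iota>_tr[OF u(1) PD(4)[OF that] \<alpha>(1)[OF that]] \<alpha>(2)[OF that] by simp_all
    have st: "act ?K h (\<beta> n c) = \<beta> n c" if "(n, c) \<in> E" "h \<in> Hom C n n" "is_iso C h" "act P h c = c" for n c h
      using bspec[OF u(2) that(1)] that HomD(3)[OF u(1)] unfolding \<beta>_def by simp
    \<comment> \<open>Generators with a common image are equal, and two arrows sending
      \<open>c\<close> to the same element differ by an automorphism that fixes \<open>c\<close>. By
      the choice of \<open>k\<close> it fixes the lift \<open>\<beta> n c\<close> as well.\<close>
    have wd: "act ?K f (\<beta> n c) = act ?K g (\<beta> n' c')"
      if fg: "f \<in> Hom C n z" "g \<in> Hom C n' z" and E: "(n, c) \<in> E" "(n', c') \<in> E" and eq: "act P f c = act P g c'" for n c n' c' f g z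
    proof -
      have same: "n' = n" "c' = c" using PD(6)[OF fg E eq] by auto
      note g = fg(2)[unfolded same]
      obtain h where h: "h \<in> Hom C n n" "is_iso C h" "act P h c = c" "f = Comp C g h"
        using minimal_meet[OF PD(1) PD(3)[OF E(1)] PD(3)[OF E(1)] fg(1) g eq[unfolded same]] by blast
      show ?thesis unfolding same h(4) using act_Comp[OF Kp h(1) g \<beta>(1)[OF E(1)]] st[OF E(1) h(1-3)] by simp
    qed
    define \<phi> where "\<phi> x b = (SOME a. \<exists>n f c. b = act P f c \<and> (n, c) \<in> E \<and> f \<in> Hom C n x \<and> a = act ?K f (\<beta> n c))" for x b
    have \<phi>: "\<phi> x (act P f c) = act ?K f (\<beta> n c)" if E: "(n, c) \<in> E" and f: "f \<in> Hom C n x" for n c f x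
    proof -
      have "\<exists>n' f' c'. act P f c = act P f' c' \<and> (n', c') \<in> E \<and> f' \<in> Hom C n' x \<and> \<phi> x (act P f c) = act ?K f' (\<beta> n' c')"
        unfolding \<phi>_def by (rule someI[of _ "act ?K f (\<beta> n c)"]) (use E f in blast)
      then show ?thesis using wd[OF f _ E] by metis
    qed
    have "natural P ?K \<phi>"
      unfolding natural_def
    proof (intro conjI ballI allI)
      show "\<phi> x b \<in> FObj ?K x" if xb: "x \<in> Obj C" "b \<in> FObj P x" for x b
      proof -
        obtain n f c where f: "b = act P f c" "(n, c) \<in> E" "f \<in> Hom C n x" using PD(7)[OF xb] by blast
        then show ?thesis using \<phi>[OF f(2,3)] act_closed[OF Kp f(3) \<beta>(1)[OF f(2)]] by simp
      qed
      show "\<phi> y (act P g b) = act ?K g (\<phi> x b)" if g: "g \<in> Hom C x y" and b: "b \<in> FObj P x" for x y g b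
      proof -
        obtain n f c where f: "b = act P f c" "(n, c) \<in> E" "f \<in> Hom C n x" using PD(7)[OF Hom_Obj(1)[OF g] b] by blast
        then show ?thesis
          using \<phi>[OF f(2,3)] \<phi>[OF f(2) Comp_closed[OF f(3) g]] act_Comp[OF Kp f(3) g \<beta>(1)[OF f(2)]]
            act_Comp[OF shf_psh[OF PD(1)] f(3) g PD(5)[OF f(2)]] by simp
      qed
    qed
    note \<phi>H = Sh_map[OF PD(1) D_shf[OF k] this]
    have "Comp Sh (\<iota> k) (mk_map P \<phi> ?K) = m"
    proof (rule generated_map_eqI[OF P category.Comp_closed[OF category_Sh \<phi>H cocone_Hom[OF cc k]] m])
      fix n c assume E: "(n, c) \<in> E"
      note n = PD(4)[OF E] and c = PD(5)[OF E]
      have "\<phi> n c = \<beta> n c" using \<phi>[OF E Ide_closed[OF n]] act_Ide[OF shf_psh[OF PD(1)] n c] act_Ide[OF Kp n \<beta>(1)[OF E]] by simp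
      then show "app (Comp Sh (\<iota> k) (mk_map P \<phi> ?K)) n c = app m n c"
        using Sh_app_Comp[OF \<phi>H cocone_Hom[OF cc k] n c] n c \<beta>(2)[OF E] by simp
    qed
    then show "\<exists>i\<in>Obj J. \<exists>\<phi>\<in>Hom Sh P (FObj D i). m = Comp Sh (\<iota> i) \<phi>" using k \<phi>H by blast
  qed
qed

end

section \<open>Sheaves as filtered colimits of finitely presentable ones\<close>

context universe
begin

text \<open>Index categories of colimits have their arrows in \<open>'u\<close>, so the pairs of the
  order relation are coded by an injection \<open>p\<close> into \<open>'u\<close>.\<close>

lemma preorder_category:
  fixes I :: "'u set" and R :: "'u \<Rightarrow> 'u \<Rightarrow> bool"
  assumes I: "small U I" and refl: "\<And>i. i \<in> I \<Longrightarrow> R i i"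
    and trans: "\<And>i j k. i \<in> I \<Longrightarrow> j \<in> I \<Longrightarrow> k \<in> I \<Longrightarrow> R i j \<Longrightarrow> R j k \<Longrightarrow> R i k"
  obtains J :: "('u, 'u) category" where "small_category U J" "Obj J = I"
    "\<And>i j. Hom J i j \<noteq> {} \<longleftrightarrow> i \<in> I \<and> j \<in> I \<and> R i j"
    "\<And>i j u v. u \<in> Hom J i j \<Longrightarrow> v \<in> Hom J i j \<Longrightarrow> u = v"
proof -
  have II: "small U (I \<times> I)" by (rule small_Times[OF I I])
  obtain p :: "'u \<times> 'u \<Rightarrow> 'u" where p: "inj_on p (I \<times> I)" using small_embed[OF II] by blast
  let ?q = "inv_into (I \<times> I) p"
  define J :: "('u, 'u) category" where "J = \<lparr>Obj = I, Arr = p ` {(i, j). i \<in> I \<and> j \<in> I \<and> R i j},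
    Dom = (\<lambda>u. fst (?q u)), Cod = (\<lambda>u. snd (?q u)), Ide = (\<lambda>i. p (i, i)),
    Comp = (\<lambda>v u. p (fst (?q u), snd (?q v)))\<rparr>"
  have q: "?q (p (i, j)) = (i, j)" if "i \<in> I" "j \<in> I" for i j
    by (rule inv_into_f_f[OF p]) (use that in simp)
  have Hom: "u \<in> Hom J i j \<longleftrightarrow> u = p (i, j) \<and> i \<in> I \<and> j \<in> I \<and> R i j" for u i j
    unfolding Hom_def J_def using q by auto
  have Comp: "Comp J (p (j, k)) (p (i, j)) = p (i, k)" if "i \<in> I" "j \<in> I" "k \<in> I" for i j k
    unfolding J_def using q that by simp
  have "category J"
  proof
    show "\<And>f. f \<in> Arr J \<Longrightarrow> Dom J f \<in> Obj J" "\<And>f. f \<in> Arr J \<Longrightarrow> Cod J f \<in> Obj J"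
      unfolding J_def using q by auto
    show "Ide J x \<in> Hom J x x" if "x \<in> Obj J" for x
      unfolding Hom using that refl by (simp add: J_def)
    show "Comp J g f \<in> Hom J x z" if "f \<in> Hom J x y" "g \<in> Hom J y z" for f g x y z
    proof -
      have "f = p (x, y)" "g = p (y, z)" "x \<in> I" "y \<in> I" "z \<in> I" "R x y" "R y z" using that unfolding Hom by auto
      then show ?thesis unfolding Hom using Comp[of x y z] trans[of x y z] by simp
    qed
    show "Comp J f (Ide J x) = f" "Comp J (Ide J y) f = f" if "f \<in> Hom J x y" for f x y
    proof -
      have "Ide J x = p (x, x)" "Ide J y = p (y, y)" by (simp_all add: J_def)
      then show "Comp J f (Ide J x) = f" "Comp J (Ide J y) f = f" using that Comp unfolding Hom by auto
    qed
    show "Comp J h (Comp J g f) = Comp J (Comp J h g) f"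
      if "f \<in> Hom J w x" "g \<in> Hom J x y" "h \<in> Hom J y z" for f g h w x y z
      using that Comp unfolding Hom by auto
  qed
  moreover have "small U (Arr J)"
    by (rule small_subset[OF _ small_image[OF II, of p]]) (auto simp: J_def)
  ultimately show thesis
    using that[of J] Hom by (auto simp: small_category_def J_def)
qed

end

context category
begin

text \<open>Stated without the Ore condition, since the derivation of that condition from (C1)
  relies on it.\<close>

lemma canonical_FObj:
  assumes "small TYPE('a) (Arr C)" "n \<in> Obj C"
  shows "FObj (canonical_functor (opposite C) J) n = fst (sheafify (opposite C) J (yon n))"
  using assms psh_yon[OF assms(1), of n]
  by (simp add: canonical_functor_def functor_comp_def sheafification_def Let_def yoneda_FObj presheaf_category_opposite psh_def)

end

section \<open>A small set of representatives for the finite unions of orbits\<close>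

locale noetherian_universe_site = noetherian_site C for C :: "('o, 'u) category" +
  assumes powers: "\<And>A :: 'u set. sml A \<Longrightarrow> sml (Arr C \<rightarrow>\<^sub>E A)"
begin

text \<open>Carries closure under powers from subsets of \<open>'u\<close> to small sets of any
  type, by coding values into \<open>'u\<close>. It will be applied to a set of functions, whose
  type is not \<open>'u\<close>.\<close>

lemma small_powers: assumes "sml A" shows "sml (Arr C \<rightarrow>\<^sub>E A)"
proof -
  obtain e :: "_ \<Rightarrow> 'u" where e: "inj_on e A" using small_embed[OF assms] by blast
  show ?thesis
  proof (rule small_inj)
    show "inj_on (\<lambda>h. \<lambda>f\<in>Arr C. e (h f)) (Arr C \<rightarrow>\<^sub>E A)"
    proof (rule inj_onI)
      fix h k assume h: "h \<in> Arr C \<rightarrow>\<^sub>E A" and k: "k \<in> Arr C \<rightarrow>\<^sub>E A"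
        and eq: "(\<lambda>f\<in>Arr C. e (h f)) = (\<lambda>f\<in>Arr C. e (k f))"
      have "h f = k f" if f: "f \<in> Arr C" for f
      proof (rule inj_onD[OF e])
        show "e (h f) = e (k f)" using fun_cong[OF eq, of f] f by simp
      qed (use h k f in auto)
      then show "h = k" using h k by (intro PiE_ext)
    qed
    show "(\<lambda>h. \<lambda>f\<in>Arr C. e (h f)) ` (Arr C \<rightarrow>\<^sub>E A) \<subseteq> Arr C \<rightarrow>\<^sub>E e ` A" by auto
    show "sml (Arr C \<rightarrow>\<^sub>E e ` A)" by (rule powers[OF small_image[OF assms]])
  qed
qed

text \<open>A finitely generated sheaf is determined up to isomorphism by the relation between its
  generators, which ranges over a small set.\<close>

definition relations :: "('o, 'u) presheaf \<Rightarrow> ('o \<times> 'u) list \<Rightarrow> ((nat \<times> 'u) \<times> nat \<times> 'u) set" where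
  "relations P es = {((i, f), (j, g)) | i j f g z. i < length es \<and> j < length es \<and>
     f \<in> Hom C (fst (es ! i)) z \<and> g \<in> Hom C (fst (es ! j)) z \<and> act P f (snd (es ! i)) = act P g (snd (es ! j))}"

text \<open>A relation set among \<open>k\<close> generators is curried into a function of two
  arrows with values in the finite set of sets of index pairs. Closure under powers with exponent
  \<open>Arr C\<close>, applied twice, makes such functions a small set, and there are countably
  many \<open>k\<close>.\<close>

lemma small_relations: "sml {relations P es | P es. True}"
proof -
  let ?B = "\<lambda>k :: nat. Pow (({..<k} \<times> Arr C) \<times> ({..<k} \<times> Arr C))"
  have "sml (?B k)" for k
  proof (rule small_inj)
    let ?e = "\<lambda>K. \<lambda>f\<in>Arr C. \<lambda>g\<in>Arr C. {(i :: nat, j :: nat). ((i, f), (j, g)) \<in> K}"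
    show "inj_on ?e (?B k)"
    proof (rule inj_onI)
      fix K L assume K: "K \<in> ?B k" and L: "L \<in> ?B k" and eq: "?e K = ?e L"
      have "((i, f), (j, g)) \<in> K \<longleftrightarrow> ((i, f), (j, g)) \<in> L" if "f \<in> Arr C" "g \<in> Arr C" for i f j g
      proof -
        have "{(i :: nat, j :: nat). ((i, f), (j, g)) \<in> K} = {(i, j). ((i, f), (j, g)) \<in> L}"
          using fun_cong[OF fun_cong[OF eq, of f], of g] that by simp
        then show ?thesis by blast
      qed
      then show "K = L" using K L by fast
    qed
    show "?e ` ?B k \<subseteq> Arr C \<rightarrow>\<^sub>E (Arr C \<rightarrow>\<^sub>E Pow ({..<k} \<times> {..<k}))" by auto
    show "sml (Arr C \<rightarrow>\<^sub>E (Arr C \<rightarrow>\<^sub>E Pow ({..<k} \<times> {..<k})))"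
      by (intro small_powers small_countable countable_finite) auto
  qed
  then have "sml (\<Union>k. ?B k)" by (intro small_UN small_countable[of UNIV]) auto
  moreover have "{relations P es | P es. True} \<subseteq> (\<Union>k. ?B k)"
    by (auto simp: relations_def Hom_def)
  ultimately show ?thesis using small_subset by blast
qed

text \<open>Whatever coincides among translates of generators of \<open>P\<close> also coincides in
  \<open>P'\<close>, so sending the \<open>i\<close>-th generator to the \<open>i\<close>-th
  generator is well defined on all elements.\<close>

lemma relations_map:
  assumes P: "presented P (set es)" and P': "presented P' (set es')" and sub: "relations P es \<subseteq> relations P' es'"
  obtains \<phi> where "\<phi> \<in> Hom Sh P P'"
    "\<And>i. i < length es \<Longrightarrow> i < length es' \<and> fst (es' ! i) = fst (es ! i) \<and> app \<phi> (fst (es ! i)) (snd (es ! i)) = snd (es' ! i)"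
proof -
  note PD = presentedD[OF P] and PD' = presentedD[OF P']
  note Pp = shf_psh[OF PD(1)] and Pp' = shf_psh[OF PD'(1)]
  have nth: "(fst (es ! i), snd (es ! i)) \<in> set es" if "i < length es" for i using that by simp
  have nth': "(fst (es' ! i), snd (es' ! i)) \<in> set es'" if "i < length es'" for i using that by simp
  have rel: "i < length es' \<and> j < length es' \<and> f \<in> Hom C (fst (es' ! i)) z \<and> g \<in> Hom C (fst (es' ! j)) z \<and>
     act P' f (snd (es' ! i)) = act P' g (snd (es' ! j))"
    if "i < length es" "j < length es" "f \<in> Hom C (fst (es ! i)) z" "g \<in> Hom C (fst (es ! j)) z" "act P f (snd (es ! i)) = act P g (snd (es ! j))"
    for i j f g z
  proof -
    have "((i, f), (j, g)) \<in> relations P' es'" using sub that unfolding relations_def by blast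
    then obtain w where w: "i < length es'" "j < length es'" "f \<in> Hom C (fst (es' ! i)) w" "g \<in> Hom C (fst (es' ! j)) w"
      "act P' f (snd (es' ! i)) = act P' g (snd (es' ! j))" unfolding relations_def by blast
    have "w = z" using HomD(3)[OF w(3)] HomD(3)[OF that(3)] by simp
    with w show ?thesis by simp
  qed
  have gen: "\<exists>i f. i < length es \<and> f \<in> Hom C (fst (es ! i)) x \<and> b = act P f (snd (es ! i))" if xb: "x \<in> Obj C" "b \<in> FObj P x" for x b
  proof -
    obtain n f c where f: "b = act P f c" "(n, c) \<in> set es" "f \<in> Hom C n x" using PD(7)[OF xb] by blast
    then obtain i where "i < length es" "es ! i = (n, c)" by (metis in_set_conv_nth)
    then show ?thesis using f by (metis fst_conv snd_conv)
  qed
  define \<phi> where "\<phi> x b = (SOME a. \<exists>i f. i < length es \<and> f \<in> Hom C (fst (es ! i)) x \<and> b = act P f (snd (es ! i)) \<and> a = act P' f (snd (es' ! i)))" for x b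
  have \<phi>: "\<phi> x (act P f (snd (es ! i))) = act P' f (snd (es' ! i))" if i: "i < length es" and f: "f \<in> Hom C (fst (es ! i)) x" for i f x
  proof -
    have "\<exists>j g. j < length es \<and> g \<in> Hom C (fst (es ! j)) x \<and> act P f (snd (es ! i)) = act P g (snd (es ! j)) \<and>
        \<phi> x (act P f (snd (es ! i))) = act P' g (snd (es' ! j))"
      unfolding \<phi>_def by (rule someI[of _ "act P' f (snd (es' ! i))"]) (use i f in blast)
    then show ?thesis using rel[OF i _ f] by metis
  qed
  have "natural P P' \<phi>"
    unfolding natural_def
  proof (intro conjI ballI allI)
    show "\<phi> x b \<in> FObj P' x" if xb: "x \<in> Obj C" "b \<in> FObj P x" for x b
    proof -
      obtain i f where i: "i < length es" "f \<in> Hom C (fst (es ! i)) x" "b = act P f (snd (es ! i))" using gen[OF xb] by blast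
      have i': "i < length es'" "f \<in> Hom C (fst (es' ! i)) x" using rel[OF i(1,1,2,2)] by auto
      show ?thesis using \<phi>[OF i(1,2)] i(3) act_closed[OF Pp' i'(2) PD'(5)[OF nth'[OF i'(1)]]] by simp
    qed
    show "\<phi> y (act P g b) = act P' g (\<phi> x b)" if g: "g \<in> Hom C x y" and b: "b \<in> FObj P x" for x y g b
    proof -
      obtain i f where i: "i < length es" "f \<in> Hom C (fst (es ! i)) x" "b = act P f (snd (es ! i))" using gen[OF Hom_Obj(1)[OF g] b] by blast
      have i': "i < length es'" "f \<in> Hom C (fst (es' ! i)) x" using rel[OF i(1,1,2,2)] by auto
      show ?thesis
        using \<phi>[OF i(1,2)] \<phi>[OF i(1) Comp_closed[OF i(2) g]] i(3) act_Comp[OF Pp i(2) g PD(5)[OF nth[OF i(1)]]]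
          act_Comp[OF Pp' i'(2) g PD'(5)[OF nth'[OF i'(1)]]] by simp
    qed
  qed
  note H = Sh_map[OF PD(1) PD'(1) this]
  have "i < length es' \<and> fst (es' ! i) = fst (es ! i) \<and> app (mk_map P \<phi> P') (fst (es ! i)) (snd (es ! i)) = snd (es' ! i)"
    if i: "i < length es" for i
  proof -
    note n = PD(4)[OF nth[OF i]] and c = PD(5)[OF nth[OF i]]
    have "Ide C (fst (es ! i)) \<in> Hom C (fst (es ! i)) (fst (es ! i))" by (rule Ide_closed[OF n])
    \<comment> \<open>The trivial relation of a generator with itself, carried over to
      \<open>es'\<close>, shows that the index is in range there and that the two generators live
      over the same object.\<close>
    from rel[OF i i this this refl] have i': "i < length es'" and "Ide C (fst (es ! i)) \<in> Hom C (fst (es' ! i)) (fst (es ! i))" by auto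
    then have e: "fst (es' ! i) = fst (es ! i)" using HomD(2) HomD(2)[OF Ide_closed[OF n]] by metis
    have "\<phi> (fst (es ! i)) (snd (es ! i)) = snd (es' ! i)"
      using \<phi>[OF i Ide_closed[OF n]] act_Ide[OF Pp n c] act_Ide[OF Pp', of "fst (es' ! i)"] PD'(4,5)[OF nth'[OF i']] e by simp
    then show ?thesis using i' e n c by simp
  qed
  then show thesis using that[OF H] by blast
qed

lemma relations_iso:
  assumes P: "presented P (set es)" and P': "presented P' (set es')" and eq: "relations P es = relations P' es'"
  obtains \<phi> \<psi> where "\<phi> \<in> Hom Sh P P'" "\<psi> \<in> Hom Sh P' P" "Comp Sh \<psi> \<phi> = Ide Sh P" "Comp Sh \<phi> \<psi> = Ide Sh P'"
proof -
  obtain \<phi> where \<phi>: "\<phi> \<in> Hom Sh P P'"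
    "\<And>i. i < length es \<Longrightarrow> i < length es' \<and> fst (es' ! i) = fst (es ! i) \<and> app \<phi> (fst (es ! i)) (snd (es ! i)) = snd (es' ! i)"
    using relations_map[OF P P'] eq by blast
  obtain \<psi> where \<psi>: "\<psi> \<in> Hom Sh P' P"
    "\<And>i. i < length es' \<Longrightarrow> i < length es \<and> fst (es ! i) = fst (es' ! i) \<and> app \<psi> (fst (es' ! i)) (snd (es' ! i)) = snd (es ! i)"
    using relations_map[OF P' P] eq by blast
  note C = category.Comp_closed[OF category_Sh] and I = category.Ide_closed[OF category_Sh]
  have "Comp Sh \<psi> \<phi> = Ide Sh P"
  proof (rule generated_map_eqI[OF P C[OF \<phi>(1) \<psi>(1)]])
    show "Ide Sh P \<in> Hom Sh P P" by (rule I) (use presentedD(1)[OF P] in simp)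
    fix n c assume E: "(n, c) \<in> set es"
    then obtain i where i: "i < length es" "es ! i = (n, c)" by (metis in_set_conv_nth)
    then show "app (Comp Sh \<psi> \<phi>) n c = app (Ide Sh P) n c"
      using \<phi>(2)[OF i(1)] \<psi>(2)[of i] Sh_app_Comp[OF \<phi>(1) \<psi>(1) presentedD(4,5)[OF P E]] Sh_app_Ide[OF presentedD(4,5)[OF P E]] by simp
  qed
  moreover have "Comp Sh \<phi> \<psi> = Ide Sh P'"
  proof (rule generated_map_eqI[OF P' C[OF \<psi>(1) \<phi>(1)]])
    show "Ide Sh P' \<in> Hom Sh P' P'" by (rule I) (use presentedD(1)[OF P'] in simp)
    fix n c assume E: "(n, c) \<in> set es'"
    then obtain i where i: "i < length es'" "es' ! i = (n, c)" by (metis in_set_conv_nth)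
    then show "app (Comp Sh \<phi> \<psi>) n c = app (Ide Sh P') n c"
      using \<psi>(2)[OF i(1)] \<phi>(2)[of i] Sh_app_Comp[OF \<psi>(1) \<phi>(1) presentedD(4,5)[OF P' E]] Sh_app_Ide[OF presentedD(4,5)[OF P' E]] by simp
  qed
  ultimately show thesis using that \<phi>(1) \<psi>(1) by blast
qed

text \<open>Isomorphic copies of a sheaf are not bounded by a small set, so one sheaf is fixed for
  each relation set that occurs.\<close>

definition presented_rep :: "((nat \<times> 'u) \<times> nat \<times> 'u) set \<Rightarrow> ('o, 'u) presheaf" where
  "presented_rep K = (SOME P. \<exists>es. presented P (set es) \<and> relations P es = K)"

definition presented_reps :: "('o, 'u) presheaf set" where
  "presented_reps = presented_rep ` {relations P es | P es. presented P (set es)}"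

lemma presented_rep:
  assumes "presented P (set es)"
  obtains es' where "presented (presented_rep (relations P es)) (set es')"
    "relations (presented_rep (relations P es)) es' = relations P es"
proof -
  have "\<exists>es'. presented (presented_rep (relations P es)) (set es') \<and> relations (presented_rep (relations P es)) es' = relations P es"
    unfolding presented_rep_def[of "relations P es"] by (rule someI[of _ P]) (use assms in blast)
  then show thesis using that by blast
qed

lemma small_presented_reps: "sml presented_reps"
  unfolding presented_reps_def by (rule small_image[OF small_subset[OF _ small_relations]]) blast

lemma finitely_presentable_presented_reps: "Q \<in> presented_reps \<Longrightarrow> finitely_presentable TYPE('u) Sh Q"
  unfolding presented_reps_def using finitely_presentable_presented by (elim imageE CollectE exE conjE) (metis presented_rep)

lemma presented_iso_rep:
  assumes "presented P E"
  obtains Q \<phi> \<psi> where "Q \<in> presented_reps" "\<phi> \<in> Hom Sh Q P" "\<psi> \<in> Hom Sh P Q"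
    "Comp Sh \<psi> \<phi> = Ide Sh Q" "Comp Sh \<phi> \<psi> = Ide Sh P"
proof -
  obtain es where es: "E = set es" using finite_list[OF presentedD(2)[OF assms]] by metis
  note P = assms[unfolded es]
  obtain es' where Q: "presented (presented_rep (relations P es)) (set es')"
    "relations (presented_rep (relations P es)) es' = relations P es" using presented_rep[OF P] .
  obtain \<phi> \<psi> where "\<phi> \<in> Hom Sh (presented_rep (relations P es)) P" "\<psi> \<in> Hom Sh P (presented_rep (relations P es))"
    "Comp Sh \<psi> \<phi> = Ide Sh (presented_rep (relations P es))" "Comp Sh \<phi> \<psi> = Ide Sh P"
    using relations_iso[OF Q(1) P Q(2)] .
  moreover have "presented_rep (relations P es) \<in> presented_reps" unfolding presented_reps_def using P by blast
  ultimately show thesis using that by blast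
qed

text \<open>Minimal elements that differ by an isomorphism of supports are equivalent, and one is
  chosen from each class. By \<open>minimal_meet\<close> minimal elements with a common image are
  equivalent, so the orbits of chosen elements are disjoint; by \<open>minimal_support\<close> they
  exhaust \<open>F\<close>.\<close>

lemma orbit_transversal:
  fixes F :: "('o, 'u) presheaf"
  assumes F: "shf F"
  obtains T where "\<And>n c. (n, c) \<in> T \<Longrightarrow> minimal F n c"
    "\<And>n c n' c' z f g. (n, c) \<in> T \<Longrightarrow> (n', c') \<in> T \<Longrightarrow> f \<in> Hom C n z \<Longrightarrow> g \<in> Hom C n' z \<Longrightarrow>
       act F f c = act F g c' \<Longrightarrow> n = n' \<and> c = c'"
    "\<And>x b. x \<in> Obj C \<Longrightarrow> b \<in> FObj F x \<Longrightarrow> b \<in> orbits F T x"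
proof -
  note Fp = shf_psh[OF F]
  define cls where "cls t = {t'. minimal F (fst t') (snd t') \<and> (\<exists>h\<in>Hom C (fst t) (fst t'). is_iso C h \<and> act F h (snd t) = snd t')}" for t :: "'o \<times> 'u"
  \<comment> \<open>The choice depends only on the class as a set, so two members of
    \<open>T\<close> with equal classes coincide.\<close>
  define T where "T = {SOME t'. t' \<in> cls t | t. minimal F (fst t) (snd t)}"
  have minD: "n \<in> Obj C" "c \<in> FObj F n" if "minimal F n c" for n c using that by (auto simp: minimal_def)
  have self: "t \<in> cls t" if "minimal F (fst t) (snd t)" for t
  proof -
    note n = minD[OF that]
    have "is_iso C (Ide C (fst t))" by (rule is_iso_inverse[OF Ide_closed[OF n(1)] Ide_closed[OF n(1)]])
        (simp_all add: Comp_Ide[OF Ide_closed[OF n(1)]])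
    then show ?thesis unfolding cls_def using that Ide_closed[OF n(1)] act_Ide[OF Fp n] by blast
  qed
  have sub: "cls t' \<subseteq> cls t" if t: "minimal F (fst t) (snd t)" and t': "t' \<in> cls t" for t t'
  proof
    fix s assume s: "s \<in> cls t'"
    obtain h where h: "h \<in> Hom C (fst t) (fst t')" "is_iso C h" "act F h (snd t) = snd t'" using t' unfolding cls_def by blast
    obtain k where k: "k \<in> Hom C (fst t') (fst s)" "is_iso C k" "act F k (snd t') = snd s" "minimal F (fst s) (snd s)" using s unfolding cls_def by blast
    have "act F (Comp C k h) (snd t) = snd s" using act_Comp[OF Fp h(1) k(1) minD(2)[OF t]] h(3) k(3) by simp
    then show "s \<in> cls t" unfolding cls_def using Comp_closed[OF h(1) k(1)] is_iso_Comp[OF h(1) k(1) h(2) k(2)] k(4) by blast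
  qed
  have sym: "t \<in> cls t'" if m: "minimal F (fst t) (snd t)" and t': "t' \<in> cls t" for t t'
  proof -
    obtain h where h: "h \<in> Hom C (fst t) (fst t')" "is_iso C h" "act F h (snd t) = snd t'" using t' unfolding cls_def by blast
    obtain k where k: "k \<in> Hom C (fst t') (fst t)" "Comp C k h = Ide C (fst t)" "Comp C h k = Ide C (fst t')"
      by (rule is_isoE[OF h(2,1)])
    note t = minD[OF m]
    have "act F k (snd t') = snd t" using act_Comp[OF Fp h(1) k(1) t(2)] k(2) act_Ide[OF Fp t] h(3) by simp
    then show ?thesis unfolding cls_def using k(1) is_iso_inverse[OF h(1) k] m by blast
  qed
  have clsD: "minimal F (fst t') (snd t')" if "t' \<in> cls t" for t t' using that unfolding cls_def by blast
  have T_cls: "t = (SOME s. s \<in> cls t)" "minimal F (fst t) (snd t)" if tT: "t \<in> T" for t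
  proof -
    obtain s where s: "t = (SOME t'. t' \<in> cls s)" "minimal F (fst s) (snd s)" using tT unfolding T_def by blast
    have ts: "t \<in> cls s" unfolding s(1) by (rule someI[of "\<lambda>t'. t' \<in> cls s", OF self[OF s(2)]])
    show "minimal F (fst t) (snd t)" by (rule clsD[OF ts])
    have "cls s = cls t" using sub[OF s(2) ts] sub[OF clsD[OF ts] sym[OF s(2) ts]] by blast
    then show "t = (SOME s. s \<in> cls t)" using s(1) by simp
  qed
  show thesis
  proof (rule that[of T])
    show "minimal F n c" if "(n, c) \<in> T" for n c using T_cls(2)[OF that] by simp
    show "n = n' \<and> c = c'" if T: "(n, c) \<in> T" "(n', c') \<in> T" and fg: "f \<in> Hom C n z" "g \<in> Hom C n' z"
      and eq: "act F f c = act F g c'" for n c n' c' z f g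
    proof -
      have m: "minimal F n c" "minimal F n' c'" using T_cls(2)[OF T(1)] T_cls(2)[OF T(2)] by auto
      obtain h where "h \<in> Hom C n n'" "is_iso C h" "act F h c = c'" using minimal_meet[OF F m fg eq] by blast
      then have *: "(n', c') \<in> cls (n, c)" using m unfolding cls_def by auto
      then have "cls (n, c) = cls (n', c')" using sub[of "(n, c)" "(n', c')"] sub[of "(n', c')" "(n, c)"] sym[of "(n, c)" "(n', c')"] m by auto
      then have "(n, c) = (n', c')" using T_cls(1)[OF T(1)] T_cls(1)[OF T(2)] by metis
      then show ?thesis by simp
    qed
    show "b \<in> orbits F T x" if xb: "x \<in> Obj C" "b \<in> FObj F x" for x b
    proof -
      obtain w m c where m: "m \<in> Hom C w x" "minimal F w c" "act F m c = b" using minimal_support[OF wf Fp xb] .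
      define t where "t = (SOME t. t \<in> cls (w, c))"
      have t: "t \<in> cls (w, c)" unfolding t_def by (rule someI[of "\<lambda>t'. t' \<in> cls (w, c)", OF self]) (use m in simp)
      have tT: "t \<in> T" unfolding T_def t_def using m(2) by force
      have "(w, c) \<in> cls t" using sym[OF _ t] m(2) by simp
      then obtain h where h: "h \<in> Hom C (fst t) w" "act F h (snd t) = c" unfolding cls_def by auto
      have "act F (Comp C m h) (snd t) = b" using act_Comp[OF Fp h(1) m(1) minD(2)[OF T_cls(2)[OF tT]]] h(2) m(3) by simp
      moreover have "(fst t, snd t) \<in> T" using tT by simp
      ultimately show ?thesis unfolding orbits_def using Comp_closed[OF h(1) m(1)] by blast
    qed
  qed
qed

text \<open>The finite subsets of a transversal, ordered by inclusion, are closed under union, and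
  every element of \<open>F\<close> lies in the orbit of a single generator.\<close>

lemma sheaf_is_filtered_colimit:
  fixes F :: "('o, 'u) presheaf"
  assumes F: "shf F"
  shows "\<exists>(J :: ('u, 'u) category) D \<iota>. small_category TYPE('u) J \<and> filtered J \<and> cat_functor J Sh D \<and>
     (\<forall>i\<in>Obj J. FObj D i \<in> presented_reps) \<and> is_colimit J Sh D F \<iota>"
proof -
  note Fp = shf_psh[OF F]
  obtain T where T: "\<And>n c. (n, c) \<in> T \<Longrightarrow> minimal F n c"
    "\<And>n c n' c' z f g. (n, c) \<in> T \<Longrightarrow> (n', c') \<in> T \<Longrightarrow> f \<in> Hom C n z \<Longrightarrow> g \<in> Hom C n' z \<Longrightarrow>
       act F f c = act F g c' \<Longrightarrow> n = n' \<and> c = c'"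
    "\<And>x b. x \<in> Obj C \<Longrightarrow> b \<in> FObj F x \<Longrightarrow> b \<in> orbits F T x"
    using orbit_transversal[OF F] by blast
  let ?S = "{E. finite E \<and> E \<subseteq> T}"
  have "T \<subseteq> (SIGMA n : Obj C. FObj F n)" using T(1) by (auto simp: minimal_def)
  then have "sml T" by (rule small_subset[OF _ small_Sigma[OF small_Obj psh_small[OF Fp]]])
  then have S: "sml ?S" by (rule small_Fpow)
  obtain e :: "('o \<times> 'u) set \<Rightarrow> 'u" where e: "inj_on e ?S" using small_embed[OF S] by blast
  define d where "d = inv_into ?S e"
  have de: "d (e E) = E" if "finite E" "E \<subseteq> T" for E unfolding d_def by (rule inv_into_f_f[OF e]) (use that in simp)
  let ?I = "e ` ?S"
  have dI: "finite (d i)" "d i \<subseteq> T" if "i \<in> ?I" for i using that de by auto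
  obtain J :: "('u, 'u) category" where J: "small_category TYPE('u) J" and JO: "Obj J = ?I"
    and JH: "\<And>i j. Hom J i j \<noteq> {} \<longleftrightarrow> i \<in> ?I \<and> j \<in> ?I \<and> d i \<subseteq> d j"
    and thin: "\<And>i j u v. u \<in> Hom J i j \<Longrightarrow> v \<in> Hom J i j \<Longrightarrow> u = v"
    using preorder_category[OF small_image[OF S, of e], of "\<lambda>i j. d i \<subseteq> d j"] by blast
  interpret J: category J using J by (simp add: small_category_def)
  have JD: "i \<in> ?I \<and> j \<in> ?I \<and> d i \<subseteq> d j" if "u \<in> Hom J i j" for u i j using JH that by blast
  have filt: "filtered J"
    unfolding filtered_def
  proof (intro conjI ballI)
    show "category J" by (rule J.category_axioms)
    show "Obj J \<noteq> {}" unfolding JO by auto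
    show "\<exists>z\<in>Obj J. Hom J x z \<noteq> {} \<and> Hom J y z \<noteq> {}" if "x \<in> Obj J" "y \<in> Obj J" for x y
    proof -
      have xy: "x \<in> ?I" "y \<in> ?I" using that JO by auto
      have E: "finite (d x \<union> d y)" "d x \<union> d y \<subseteq> T" using dI[OF xy(1)] dI[OF xy(2)] by auto
      then have "e (d x \<union> d y) \<in> ?I" by blast
      then show ?thesis unfolding JO JH using xy de[OF E] by blast
    qed
    show "\<exists>z\<in>Obj J. \<exists>h\<in>Hom J y z. Comp J h f = Comp J h g" if "f \<in> Hom J x y" "g \<in> Hom J x y" "y \<in> Obj J" for x y f g
      using thin[OF that(1,2)] J.Ide_closed[OF that(3)] that(3) by blast
  qed
  define P where "P i = orbit_sheaf F (d i)" for i
  have min: "minimal F n c" if "i \<in> ?I" "(n, c) \<in> d i" for i n c using that dI(2) T(1) by blast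
  have PO: "FObj (P i) x = orbits F (d i) x" if "i \<in> ?I" "x \<in> Obj C" for i x
    unfolding P_def using that by (intro orbit_sheaf_Obj[OF F min])
  have Pact: "act (P i) f a = act F f a" if "i \<in> ?I" "f \<in> Hom C x y" "a \<in> FObj (P i) x" for i f x y a
    unfolding P_def by (rule orbit_sheaf_act[OF F min[OF that(1)] that(2)]) (use that PO Hom_Obj in auto)
  have presented: "presented (P i) (d i)" if i: "i \<in> ?I" for i
  proof -
    have m: "minimal (P i) n c" if "(n, c) \<in> d i" for n c
      unfolding P_def by (rule orbit_sheaf_minimal[OF F min[OF i] that])
    have a: "act (P i) f c = act F f c" if "(n, c) \<in> d i" "f \<in> Hom C n x" for n c f x
      using Pact[OF i that(2)] m[OF that(1)] by (simp add: minimal_def)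
    show ?thesis
      unfolding presented_def
    proof (intro conjI allI ballI impI)
      show "shf (P i)" unfolding P_def by (rule shf_orbit_sheaf[OF F min[OF i]])
      show "finite (d i)" by (rule dI[OF i])
      show "minimal (P i) n c" if "(n, c) \<in> d i" for n c by (rule m[OF that])
      show "n = n'" "c = c'" if "f \<in> Hom C n z" "g \<in> Hom C n' z" "(n, c) \<in> d i" "(n', c') \<in> d i" "act (P i) f c = act (P i) g c'"
        for n c n' c' z f g
        using T(2)[OF subsetD[OF dI(2)[OF i] that(3)] subsetD[OF dI(2)[OF i] that(4)] that(1,2)]
          that(5) a[OF that(3,1)] a[OF that(4,2)] by simp_all
      show "FObj (P i) x = orbits (P i) (d i) x" if "x \<in> Obj C" for x
      proof -
        have "b \<in> orbits F (d i) x \<longleftrightarrow> b \<in> orbits (P i) (d i) x" for b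
        proof
          assume "b \<in> orbits F (d i) x"
          then obtain n f c where "b = act F f c" "(n, c) \<in> d i" "f \<in> Hom C n x" unfolding orbits_def by blast
          then show "b \<in> orbits (P i) (d i) x" unfolding orbits_def using a[of n c f x] by force
        next
          assume "b \<in> orbits (P i) (d i) x"
          then obtain n f c where "b = act (P i) f c" "(n, c) \<in> d i" "f \<in> Hom C n x" unfolding orbits_def by blast
          then show "b \<in> orbits F (d i) x" unfolding orbits_def using a[of n c f x] by force
        qed
        then show ?thesis using PO[OF i that] by blast
      qed
    qed
  qed
  \<comment> \<open>The diagram has to take its values in the small set
    \<open>presented_reps\<close>, so each \<open>P i\<close> is replaced by an isomorphic
    \<open>Q i\<close>, with isomorphisms chosen in both directions.\<close>
  define G where "G i Q \<phi> \<psi> \<longleftrightarrow> Q \<in> presented_reps \<and> \<phi> \<in> Hom Sh Q (P i) \<and> \<psi> \<in> Hom Sh (P i) Q \<and>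
    Comp Sh \<psi> \<phi> = Ide Sh Q \<and> Comp Sh \<phi> \<psi> = Ide Sh (P i)" for i Q \<phi> \<psi>
  have "\<forall>i\<in>?I. \<exists>Q \<phi> \<psi>. G i Q \<phi> \<psi>"
  proof
    fix i assume i: "i \<in> ?I"
    show "\<exists>Q \<phi> \<psi>. G i Q \<phi> \<psi>" by (rule presented_iso_rep[OF presented[OF i]]) (use G_def in blast)
  qed
  then obtain Q where "\<forall>i\<in>?I. \<exists>\<phi> \<psi>. G i (Q i) \<phi> \<psi>" by (rule bchoice[THEN exE])
  then obtain \<alpha> where "\<forall>i\<in>?I. \<exists>\<psi>. G i (Q i) (\<alpha> i) \<psi>" by (rule bchoice[THEN exE])
  then obtain \<beta> where "\<forall>i\<in>?I. G i (Q i) (\<alpha> i) (\<beta> i)" by (rule bchoice[THEN exE])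
  then have Q: "Q i \<in> presented_reps" and \<alpha>: "\<alpha> i \<in> Hom Sh (Q i) (P i)" and \<beta>: "\<beta> i \<in> Hom Sh (P i) (Q i)"
    and \<beta>\<alpha>: "Comp Sh (\<beta> i) (\<alpha> i) = Ide Sh (Q i)" and \<alpha>\<beta>: "Comp Sh (\<alpha> i) (\<beta> i) = Ide Sh (P i)"
    if "i \<in> ?I" for i
    using that unfolding G_def by (simp_all only: simp_thms ball_simps) blast+
  have QS: "shf (Q i)" if "i \<in> ?I" for i using Sh_HomD(1)[OF \<alpha>[OF that]] .
  have A_inv: "app (\<beta> i) x (app (\<alpha> i) x a) = a" if "i \<in> ?I" "x \<in> Obj C" "a \<in> FObj (Q i) x" for i x a
    using Sh_app_Comp[OF \<alpha> \<beta>, of i] \<beta>\<alpha>[OF that(1)] Sh_app_Ide[OF that(2,3)] that by simp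
  have B_inv: "app (\<alpha> i) x (app (\<beta> i) x a) = a" if "i \<in> ?I" "x \<in> Obj C" "a \<in> FObj (P i) x" for i x a
    using Sh_app_Comp[OF \<beta> \<alpha>, of i] \<alpha>\<beta>[OF that(1)] Sh_app_Ide[OF that(2,3)] that by simp
  have incl: "natural (P i) (P j) (\<lambda>x a. a)" if u: "u \<in> Hom J i j" for u i j
  proof -
    have ij: "i \<in> ?I" "j \<in> ?I" "d i \<subseteq> d j" using JD[OF u] by auto
    then have "FObj (P i) x \<subseteq> FObj (P j) x" if "x \<in> Obj C" for x using that by (auto simp: PO orbits_def)
    then show ?thesis unfolding natural_def using Pact[OF ij(1)] Pact[OF ij(2)] Hom_Obj(1) by fastforce
  qed
  have inclF: "natural (P i) F (\<lambda>x a. a)" if "i \<in> ?I" for i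
    unfolding P_def by (rule orbit_sheaf_inclusion[OF F min[OF that]])
  \<comment> \<open>The inclusion of \<open>P i\<close> in \<open>P j\<close>, which is the identity
    on elements, conjugated by the chosen isomorphisms.\<close>
  define tr where "tr u x a = app (\<beta> (Cod J u)) x (app (\<alpha> (Dom J u)) x a)" for u x a
  define D where "D = \<lparr>FObj = (\<lambda>i\<in>?I. Q i), FArr = (\<lambda>u\<in>Arr J. mk_map (Q (Dom J u)) (tr u) (Q (Cod J u)))\<rparr>"
  have DO: "FObj D i = Q i" if "i \<in> ?I" for i using that by (simp add: D_def)
  have DA: "FArr D u = mk_map (Q i) (tr u) (Q j)" "tr u x a = app (\<beta> j) x (app (\<alpha> i) x a)" if "u \<in> Hom J i j" for u i j x a
    using HomD[OF that] by (simp_all add: D_def tr_def)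
  have trN: "natural (Q i) (Q j) (tr u)" if u: "u \<in> Hom J i j" for u i j
  proof -
    have ij: "i \<in> ?I" "j \<in> ?I" using JD[OF u] by auto
    have "natural (Q i) (Q j) (\<lambda>x a. app (\<beta> j) x (app (\<alpha> i) x a))"
      by (rule natural_comp[OF natural_comp[OF Sh_HomD(3)[OF \<alpha>[OF ij(1)]] incl[OF u]] Sh_HomD(3)[OF \<beta>[OF ij(2)]]])
    moreover have "tr u = (\<lambda>x a. app (\<beta> j) x (app (\<alpha> i) x a))" using DA(2)[OF u] by blast
    ultimately show ?thesis by simp
  qed
  have DH: "FArr D u \<in> Hom Sh (Q i) (Q j)" if u: "u \<in> Hom J i j" for u i j
    unfolding DA(1)[OF u] using JD[OF u] by (intro Sh_map QS trN[OF u]) auto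
  have D_app: "app (FArr D u) x a = app (\<beta> j) x (app (\<alpha> i) x a)" if "u \<in> Hom J i j" "x \<in> Obj C" "a \<in> FObj (Q i) x" for u i j x a
    using DA[OF that(1)] that(2,3) by simp
  have Aj: "app (\<alpha> j) x (app (FArr D u) x a) = app (\<alpha> i) x a" if u: "u \<in> Hom J i j" and x: "x \<in> Obj C" and a: "a \<in> FObj (Q i) x" for u i j x a
  proof -
    have ij: "i \<in> ?I" "j \<in> ?I" using JD[OF u] by auto
    have "app (\<alpha> i) x a \<in> FObj (P i) x" by (rule Sh_app_closed[OF \<alpha>[OF ij(1)] x a])
    then have "app (\<alpha> i) x a \<in> FObj (P j) x" using incl[OF u] x unfolding natural_def by blast
    then show ?thesis unfolding D_app[OF u x a] by (rule B_inv[OF ij(2) x])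
  qed
  have A_inj: "a = b" if "i \<in> ?I" "x \<in> Obj C" "a \<in> FObj (Q i) x" "b \<in> FObj (Q i) x" "app (\<alpha> i) x a = app (\<alpha> i) x b" for i x a b
  proof -
    have "a = app (\<beta> i) x (app (\<alpha> i) x a)" by (rule A_inv[OF that(1,2,3), symmetric])
    also have "\<dots> = b" unfolding that(5) by (rule A_inv[OF that(1,2,4)])
    finally show ?thesis .
  qed
  have Dfun: "cat_functor J Sh D"
  proof (intro cat_functor.intro cat_functor_axioms.intro J.category_axioms category_Sh)
    show "FObj D \<in> Obj J \<rightarrow>\<^sub>E Obj Sh" unfolding JO D_def using QS by auto
    show "FArr D \<in> extensional (Arr J)" by (simp add: D_def)
    show "FArr D u \<in> Hom Sh (FObj D i) (FObj D j)" if "u \<in> Hom J i j" for u i j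
      using DH[OF that] JD[OF that] DO by simp
    show "FArr D (Ide J i) = Ide Sh (FObj D i)" if "i \<in> Obj J" for i
    proof -
      have i: "i \<in> ?I" using that JO by simp
      note u = J.Ide_closed[OF that]
      show ?thesis unfolding DO[OF i]
      proof (rule Sh_map_eqI[OF DH[OF u]])
        show "Ide Sh (Q i) \<in> Hom Sh (Q i) (Q i)" by (rule category.Ide_closed[OF category_Sh]) (use QS[OF i] in simp)
        show "app (FArr D (Ide J i)) x a = app (Ide Sh (Q i)) x a" if "x \<in> Obj C" "a \<in> FObj (Q i) x" for x a
          using D_app[OF u that] A_inv[OF i that] Sh_app_Ide[OF that] by simp
      qed
    qed
    show "FArr D (Comp J v u) = Comp Sh (FArr D v) (FArr D u)" if u: "u \<in> Hom J i j" and v: "v \<in> Hom J j k" for u v i j k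
    proof (rule Sh_map_eqI[OF DH[OF J.Comp_closed[OF u v]] category.Comp_closed[OF category_Sh DH[OF u] DH[OF v]]])
      fix x a assume x: "x \<in> Obj C" and a: "a \<in> FObj (Q i) x"
      note ua = Sh_app_closed[OF DH[OF u] x a]
      show "app (FArr D (Comp J v u)) x a = app (Comp Sh (FArr D v) (FArr D u)) x a"
        using D_app[OF J.Comp_closed[OF u v] x a] Sh_app_Comp[OF DH[OF u] DH[OF v] x a] D_app[OF v x ua] Aj[OF u x a] by simp
    qed
  qed
  define \<iota> where "\<iota> i = mk_map (Q i) (app (\<alpha> i)) F" for i
  have \<iota>H: "\<iota> i \<in> Hom Sh (Q i) F" if "i \<in> ?I" for i
    unfolding \<iota>_def using natural_comp[OF Sh_HomD(3)[OF \<alpha>[OF that]] inclF[OF that]] by (intro Sh_map QS[OF that] F)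
  have \<iota>_app: "app (\<iota> i) x a = app (\<alpha> i) x a" if "x \<in> Obj C" "a \<in> FObj (Q i) x" for i x a
    using that unfolding \<iota>_def by simp
  have cone: "cocone J Sh D F \<iota>"
    unfolding cocone_def
  proof (intro conjI ballI)
    show "F \<in> Obj Sh" using F by simp
    show "\<iota> i \<in> Hom Sh (FObj D i) F" if "i \<in> Obj J" for i using that JO DO \<iota>H by simp
    fix u assume "u \<in> Arr J"
    note u = HomI[OF this]
    have ij: "Dom J u \<in> ?I" "Cod J u \<in> ?I" using JD[OF u] by auto
    show "Comp Sh (\<iota> (Cod J u)) (FArr D u) = \<iota> (Dom J u)"
    proof (rule Sh_map_eqI[OF category.Comp_closed[OF category_Sh DH[OF u] \<iota>H[OF ij(2)]] \<iota>H[OF ij(1)]])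
      fix x a assume x: "x \<in> Obj C" and a: "a \<in> FObj (Q (Dom J u)) x"
      show "app (Comp Sh (\<iota> (Cod J u)) (FArr D u)) x a = app (\<iota> (Dom J u)) x a"
        using Sh_app_Comp[OF DH[OF u] \<iota>H[OF ij(2)] x a] \<iota>_app[OF x a] \<iota>_app[OF x Sh_app_closed[OF DH[OF u] x a]] Aj[OF u x a] by simp
    qed
  qed
  have "is_colimit J Sh D F \<iota>"
  proof (rule filtered_colimit_ShI[OF filt Dfun cone])
    fix x b assume x: "x \<in> Obj C" and b: "b \<in> FObj F x"
    obtain n f c where f: "b = act F f c" "(n, c) \<in> T" "f \<in> Hom C n x" using T(3)[OF x b] unfolding orbits_def by blast
    \<comment> \<open>The generator of \<open>b\<close> alone is already a stage.\<close>
    define i where "i = e {(n, c)}"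
    have i: "i \<in> ?I" "d i = {(n, c)}" unfolding i_def using f(2) de by auto
    have bP: "b \<in> FObj (P i) x" unfolding PO[OF i(1) x] i(2) orbits_def using f by blast
    have "b = app (\<iota> i) x (app (\<beta> i) x b)"
      using \<iota>_app[OF x Sh_app_closed[OF \<beta>[OF i(1)] x bP]] B_inv[OF i(1) x bP] by simp
    moreover have "app (\<beta> i) x b \<in> FObj (FObj D i) x"
      unfolding DO[OF i(1)] by (rule Sh_app_closed[OF \<beta>[OF i(1)] x bP])
    moreover have "i \<in> Obj J" unfolding JO by (rule i(1))
    ultimately show "\<exists>i\<in>Obj J. \<exists>a\<in>FObj (FObj D i) x. b = app (\<iota> i) x a" by blast
  next
    fix x i a b assume x: "x \<in> Obj C" and "i \<in> Obj J" and ab: "a \<in> FObj (FObj D i) x" "b \<in> FObj (FObj D i) x"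
      and eq: "app (\<iota> i) x a = app (\<iota> i) x b"
    then have i: "i \<in> ?I" using JO by simp
    note ab = ab[unfolded DO[OF i]]
    \<comment> \<open>Each leg is an isomorphism followed by an inclusion, so elements identified in
      \<open>F\<close> are equal at their own stage, and the identity arrow serves as
      witness.\<close>
    have "a = b" by (rule A_inj[OF i x ab]) (use eq \<iota>_app[OF x ab(1)] \<iota>_app[OF x ab(2)] in simp)
    then show "\<exists>k. \<exists>u\<in>Hom J i k. app (FArr D u) x a = app (FArr D u) x b"
      using J.Ide_closed[OF \<open>i \<in> Obj J\<close>] by blast
  qed
  moreover have "\<forall>i\<in>Obj J. FObj D i \<in> presented_reps" unfolding JO using DO Q by simp
  ultimately show ?thesis using J filt Dfun by blast
qed

theorem locally_finitely_presentable_Sh: "locally_finitely_presentable TYPE('u) Sh"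
  unfolding locally_finitely_presentable_def
  using category_Sh cocomplete_Sh small_presented_reps finitely_presentable_presented_reps sheaf_is_filtered_colimit
  by (intro conjI exI[of _ presented_reps]) auto

end

theorem theorem2p4:
  fixes C :: "('o, 'u) category"
  defines "D \<equiv> opposite C"
  defines "Sh \<equiv> sheaf_category D (atomic_topology D)"
  defines "X \<equiv> canonical_functor D (atomic_topology D)"
  assumes "small_category TYPE('u) C"
    and "universe_for TYPE('u) (Arr C)"
    and C1: "fully_faithful D Sh X" "\<And>n. n \<in> Obj D \<Longrightarrow> is_atom Sh (FObj X n)"
    and C2: "has_pushouts D" "preserves_pushouts D Sh X"
    and C3: "well_founded C"
    and C4: "\<And>n. n \<in> Obj C \<Longrightarrow> noetherian_group (Aut C n)"
  shows "locally_finitely_presentable TYPE('u) Sh"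
proof -
  interpret category C using \<open>small_category TYPE('u) C\<close> by (simp add: small_category_def)
  have sm: "small TYPE('u) (Arr C)" using \<open>small_category TYPE('u) C\<close> by (simp add: small_category_def)
  have un: "universe TYPE('u)" using \<open>universe_for TYPE('u) (Arr C)\<close> unfolding universe_for_def by unfold_locales auto
  \<comment> \<open>Atoms are not initial, and \<open>FObj X n\<close> is the sheafification of the
    functor represented by \<open>n\<close>; this excludes spans without a cocone.\<close>
  have ore
  proof (rule ore_if_not_initial[OF sm un])
    fix n assume n: "n \<in> Obj C"
    show "\<not> is_initial (sheaf_category (opposite C) (atomic_topology (opposite C))) (fst (sheafify (opposite C) (atomic_topology (opposite C)) (yon n)))"
      using C1(2)[of n] n canonical_FObj[OF sm n] unfolding is_atom_def D_def Sh_def X_def by simp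
  qed
  then interpret site: atomic_site C
    by (intro atomic_site.intro atomic_site_axioms.intro category_axioms un sm)
  have Sh: "Sh = site.Sh" unfolding Sh_def D_def by (rule site.sheaf_category_Sh)
  \<comment> \<open>(C2) enters through its effect on elements: a pair of elements that agree over
    \<open>d\<close> is induced from one element over the pullback.\<close>
  interpret site: noetherian_universe_site C
  proof unfold_locales
    show "\<exists>w. \<exists>p\<in>Hom C w a. \<exists>q\<in>Hom C w b. Comp C u p = Comp C v q \<and>
      (\<forall>F :: ('o, 'u) presheaf. \<forall>\<alpha>\<in>FObj F a. \<forall>\<beta>\<in>FObj F b. shf F \<longrightarrow> act F u \<alpha> = act F v \<beta> \<longrightarrow>
         (\<exists>\<gamma>\<in>FObj F w. act F p \<gamma> = \<alpha> \<and> act F q \<gamma> = \<beta>))" if "u \<in> Hom C a d" "v \<in> Hom C b d" for u v a b d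
      using site.sheaves_preserve_pullbacks[OF _ _ that] C2 unfolding Sh unfolding X_def D_def by blast
    show "small TYPE('u) (Arr C \<rightarrow>\<^sub>E A)" if "small TYPE('u) A" for A :: "'u set"
      using \<open>universe_for TYPE('u) (Arr C)\<close> that unfolding universe_for_def by blast
  qed (use C3 C4 in auto)
  show ?thesis unfolding Sh by (rule site.locally_finitely_presentable_Sh)
qed

end
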